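(* Every non-trivial weakly Cauchy sequence in $JT$ has a subsequence which is equivalent to the unit vector basis of the James space $J$ and whose closed linear span is complemented in $JT$. Consequently, every closed non-reflexive subspace of $JT$ contains a subspace isomorphic to $J$ which is complemented in $JT$.
   Context: Let $\mathcal T$ be the dyadic tree, with nodes enumerated by $\mathbb N$ so that the tree order $\preceq$ satisfies $n\preceq m\Rightarrow n\le m$. A segment is a subset $s\subseteq\mathcal T$ totally ordered by $\preceq$ and convex. For $x\in c_0(\mathcal T)$, $\|x\|_{JT}=\sup\big(\sum_{j=1}^k(\sum_{t\in s_j}x(t))^2\big)^{1/2}$ over all finite families of pairwise disjoint finite segments; $JT=\{x\in c_0:\|x\|_{JT}<\infty\}$. The James space $J$ is the space of real sequences $x=(x(n))_{n\in\mathbb N}$ with $\|x\|_J=\sup\big(\sum_{i=1}^m|\sum_{k\in I_i}x(k)|^2\big)^{1/2}<\infty$ over all pairwise disjoint finite intervals $I_1,\dots,I_m$ of $\mathbb N$, with unit vector basis $(e_n)$. A sequence $(x_n)$ in a Banach space $X$ is non-trivial weakly Cauchy if it converges weak$^*$ in $X^{**}$ to some $x^{**}\in X^{**}\setminus X$. *)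

theory Defs
  imports Complex_Main "HOL-Library.Sublist"
begin

text \<open>The dyadic tree is modelled by finite 0-1 words (type bool list), ordered by
  the prefix order (root = empty word). Any enumeration of the nodes by the naturals
  compatible with the tree order is irrelevant for the statement.\<close>

definition tree_segment :: "bool list set \<Rightarrow> bool" where
  "tree_segment s \<longleftrightarrow>
     (\<forall>u\<in>s. \<forall>v\<in>s. prefix u v \<or> prefix v u) \<and>
     (\<forall>u\<in>s. \<forall>w\<in>s. \<forall>v. prefix u v \<and> prefix v w \<longrightarrow> v \<in> s)"

definition jt_sums :: "(bool list \<Rightarrow> real) \<Rightarrow> real set" where
  "jt_sums x = {sqrt (\<Sum>s\<in>F. (\<Sum>t\<in>s. x t)^2) | F.
      finite F \<and> (\<forall>s\<in>F. finite s \<and> tree_segment s) \<and> pairwise disjnt F}"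

definition jt_norm :: "(bool list \<Rightarrow> real) \<Rightarrow> real" where
  "jt_norm x = Sup (jt_sums x)"

definition JT :: "(bool list \<Rightarrow> real) set" where
  "JT = {x. (x \<longlongrightarrow> 0) cofinite \<and> bdd_above (jt_sums x)}"

definition j_sums :: "(nat \<Rightarrow> real) \<Rightarrow> real set" where
  "j_sums a = {sqrt (\<Sum>I\<in>F. \<bar>\<Sum>k\<in>I. a k\<bar>^2) | F.
      finite F \<and> (\<forall>I\<in>F. \<exists>m n. I = {m..n}) \<and> pairwise disjnt F}"

definition j_norm :: "(nat \<Rightarrow> real) \<Rightarrow> real" where
  "j_norm a = Sup (j_sums a)"

definition J_space :: "(nat \<Rightarrow> real) set" where
  "J_space = {a. bdd_above (j_sums a)}"

definition lin_functional_on :: "('a \<Rightarrow> real) set \<Rightarrow> (('a \<Rightarrow> real) \<Rightarrow> real) \<Rightarrow> bool" where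
  "lin_functional_on V f \<longleftrightarrow>
     (\<forall>x\<in>V. \<forall>y\<in>V. f (\<lambda>t. x t + y t) = f x + f y) \<and>
     (\<forall>x\<in>V. \<forall>c. f (\<lambda>t. c * x t) = c * f x)"

definition dual_sp :: "('a \<Rightarrow> real) set \<Rightarrow> (('a \<Rightarrow> real) \<Rightarrow> real) \<Rightarrow> (('a \<Rightarrow> real) \<Rightarrow> real) set" where
  "dual_sp V N = {f. lin_functional_on V f \<and> (\<exists>C. \<forall>x\<in>V. \<bar>f x\<bar> \<le> C * N x)
                    \<and> (\<forall>x. x \<notin> V \<longrightarrow> f x = 0)}"

definition dual_norm :: "('a \<Rightarrow> real) set \<Rightarrow> (('a \<Rightarrow> real) \<Rightarrow> real) \<Rightarrow> (('a \<Rightarrow> real) \<Rightarrow> real) \<Rightarrow> real" where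
  "dual_norm V N f = Sup {\<bar>f x\<bar> | x. x \<in> V \<and> N x \<le> 1}"

definition bidual_sp :: "('a \<Rightarrow> real) set \<Rightarrow> (('a \<Rightarrow> real) \<Rightarrow> real)
     \<Rightarrow> ((('a \<Rightarrow> real) \<Rightarrow> real) \<Rightarrow> real) set" where
  "bidual_sp V N = {\<Phi>.
      (\<forall>f\<in>dual_sp V N. \<forall>g\<in>dual_sp V N. \<Phi> (\<lambda>x. f x + g x) = \<Phi> f + \<Phi> g) \<and>
      (\<forall>f\<in>dual_sp V N. \<forall>c. \<Phi> (\<lambda>x. c * f x) = c * \<Phi> f) \<and>
      (\<exists>C. \<forall>f\<in>dual_sp V N. \<bar>\<Phi> f\<bar> \<le> C * dual_norm V N f)}"

definition in_canonical_image :: "('a \<Rightarrow> real) set \<Rightarrow> (('a \<Rightarrow> real) \<Rightarrow> real)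
     \<Rightarrow> ((('a \<Rightarrow> real) \<Rightarrow> real) \<Rightarrow> real) \<Rightarrow> bool" where
  "in_canonical_image V N \<Phi> \<longleftrightarrow> (\<exists>y\<in>V. \<forall>f\<in>dual_sp V N. \<Phi> f = f y)"

definition nontrivial_weakly_cauchy :: "('a \<Rightarrow> real) set \<Rightarrow> (('a \<Rightarrow> real) \<Rightarrow> real)
     \<Rightarrow> (nat \<Rightarrow> 'a \<Rightarrow> real) \<Rightarrow> bool" where
  "nontrivial_weakly_cauchy V N x \<longleftrightarrow> (\<forall>n. x n \<in> V) \<and>
     (\<exists>\<Phi>\<in>bidual_sp V N. (\<forall>f\<in>dual_sp V N. (\<lambda>n. f (x n)) \<longlonglongrightarrow> \<Phi> f)
                          \<and> \<not> in_canonical_image V N \<Phi>)"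

definition reflexive_sp :: "('a \<Rightarrow> real) set \<Rightarrow> (('a \<Rightarrow> real) \<Rightarrow> real) \<Rightarrow> bool" where
  "reflexive_sp V N \<longleftrightarrow> (\<forall>\<Phi>\<in>bidual_sp V N. in_canonical_image V N \<Phi>)"

definition lin_subspace :: "('a \<Rightarrow> real) set \<Rightarrow> bool" where
  "lin_subspace W \<longleftrightarrow> (\<lambda>t. 0) \<in> W \<and>
     (\<forall>x\<in>W. \<forall>y\<in>W. (\<lambda>t. x t + y t) \<in> W) \<and> (\<forall>x\<in>W. \<forall>c. (\<lambda>t. c * x t) \<in> W)"

definition norm_closed_in :: "('a \<Rightarrow> real) set \<Rightarrow> (('a \<Rightarrow> real) \<Rightarrow> real) \<Rightarrow> ('a \<Rightarrow> real) set \<Rightarrow> bool" where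
  "norm_closed_in V N W \<longleftrightarrow>
     (\<forall>y\<in>V. (\<forall>e>0. \<exists>z\<in>W. N (\<lambda>t. y t - z t) < e) \<longrightarrow> y \<in> W)"

definition closed_subspace :: "('a \<Rightarrow> real) set \<Rightarrow> (('a \<Rightarrow> real) \<Rightarrow> real) \<Rightarrow> ('a \<Rightarrow> real) set \<Rightarrow> bool" where
  "closed_subspace V N W \<longleftrightarrow> W \<subseteq> V \<and> lin_subspace W \<and> norm_closed_in V N W"

definition closed_span :: "('a \<Rightarrow> real) set \<Rightarrow> (('a \<Rightarrow> real) \<Rightarrow> real) \<Rightarrow> (nat \<Rightarrow> 'a \<Rightarrow> real) \<Rightarrow> ('a \<Rightarrow> real) set" where
  "closed_span V N y = {v\<in>V. \<forall>e>0. \<exists>m a. N (\<lambda>t. v t - (\<Sum>k<m. a k * y k t)) < e}"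

definition complemented_in :: "('a \<Rightarrow> real) set \<Rightarrow> (('a \<Rightarrow> real) \<Rightarrow> real) \<Rightarrow> ('a \<Rightarrow> real) set \<Rightarrow> bool" where
  "complemented_in V N W \<longleftrightarrow> (\<exists>P.
     (\<forall>x\<in>V. P x \<in> W) \<and> (\<forall>w\<in>W. P w = w) \<and>
     (\<forall>x\<in>V. \<forall>y\<in>V. P (\<lambda>t. x t + y t) = (\<lambda>t. P x t + P y t)) \<and>
     (\<forall>x\<in>V. \<forall>c. P (\<lambda>t. c * x t) = (\<lambda>t. c * P x t)) \<and>
     (\<exists>C. \<forall>x\<in>V. N (P x) \<le> C * N x))"

definition equiv_J_basis :: "(('a \<Rightarrow> real) \<Rightarrow> real) \<Rightarrow> (nat \<Rightarrow> 'a \<Rightarrow> real) \<Rightarrow> bool" where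
  "equiv_J_basis N y \<longleftrightarrow> (\<exists>C>0. \<forall>m a.
      j_norm (\<lambda>k. if k < m then a k else 0) \<le> C * N (\<lambda>t. \<Sum>k<m. a k * y k t) \<and>
      N (\<lambda>t. \<Sum>k<m. a k * y k t) \<le> C * j_norm (\<lambda>k. if k < m then a k else 0))"

definition isomorphic_to_J :: "(('a \<Rightarrow> real) \<Rightarrow> real) \<Rightarrow> ('a \<Rightarrow> real) set \<Rightarrow> bool" where
  "isomorphic_to_J N W \<longleftrightarrow> (\<exists>T. bij_betw T J_space W \<and>
     (\<forall>a\<in>J_space. \<forall>b\<in>J_space. T (\<lambda>k. a k + b k) = (\<lambda>t. T a t + T b t)) \<and>
     (\<forall>a\<in>J_space. \<forall>c. T (\<lambda>k. c * a k) = (\<lambda>t. c * T a t)) \<and>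
     (\<exists>c>0. \<exists>C>0. \<forall>a\<in>J_space. c * j_norm a \<le> N (T a) \<and> N (T a) \<le> C * j_norm a))"

end

theory Submission
  imports Defs "HOL-Analysis.Analysis" "HOL-Library.Diagonal_Subsequence"
begin

text \<open>
  Let \<open>z\<^sub>n\<close> be a bounded sequence in \<open>JT\<close> that converges to \<open>x\<close> at every node and whose sums
  along every branch \<open>\<gamma>\<close> converge, and let \<open>a\<^sub>\<gamma>\<close> be the limit of the branch sums of \<open>z\<^sub>n - x\<close>.
  Then \<open>\<Sum> a\<^sub>\<gamma>\<^sup>2 < \<infinity>\<close>, and along a subsequence \<open>z\<^sub>n - x\<close> is, up to a summable error, a
  sequence of level blocks \<open>v\<^sub>n = w\<^sub>n + D\<^sub>n\<close>. Here \<open>D\<^sub>n\<close> carries the masses \<open>a\<^sub>\<gamma>\<close> at one level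
  and satisfies an upper \<open>J\<close>-estimate, while all branch sums of \<open>w\<^sub>n\<close> tend to zero, which after
  thinning out gives an upper \<open>\<ell>\<^sub>2\<close>-estimate.

  If some \<open>a\<^sub>\<gamma> \<noteq> 0\<close>, the block sums along \<open>\<gamma>\<close> define a bounded operator from \<open>JT\<close> to \<open>J\<close> that
  sends \<open>z\<^sub>n\<close>, up to a scalar and a small error, to the \<open>n\<close>-th unit vector. Corrected by a Neumann
  series it is a left inverse of \<open>e\<^sub>n \<mapsto> z\<^sub>n\<close>, which yields the equivalence to the basis of \<open>J\<close> and
  the projection at once. If all \<open>a\<^sub>\<gamma>\<close> vanish, averages of a subsequence converge to \<open>x\<close> in norm,
  so \<open>x\<close> represents the weak limit.

  Every bounded sequence has a subsequence of the above kind. If the second alternative holds for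
  all bounded sequences of a closed subspace \<open>Z\<close>, then, approximating \<open>\<Phi> \<in> Z\<^sup>*\<^sup>*\<close> by Goldstine's
  theorem simultaneously on all coordinates and on one given functional, \<open>\<Phi>\<close> is evaluation at the
  vector of its coordinates, so \<open>Z\<close> is reflexive.
\<close>

section \<open>Norms given by disjoint families of segments\<close>

text \<open>Both norms are suprema of l2-sums over disjoint families of finite segments, graded by
  \<open>length\<close> on the tree and by the identity on the naturals. What holds for both is
  proved once, for a set with levels whose segments remain segments when cut at a level. The masses
  \<open>a \<gamma>\<close> obstruct an l2-estimate: a combination of the \<open>z n\<close> adds up
  its coefficients along every branch with nonzero mass, and that is J-behaviour. Finitely many
  branches have disjoint tails, hence the square summability, and only countably many of the
  uncountably many branches carry mass. After their removal the branch sums vanish in the limit, but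
  not uniformly in the branch; thinning out ensures that, relative to a threshold fixed earlier, no
  branch carries two large blocks. The limit \<open>x\<close> is a second source of J-behaviour,
  since a combination contains \<open>x\<close> times the sum of the coefficients. It would also
  spoil the left inverse, so a rank-one correction removes it before block sums are taken. A
  sequence can match \<Phi> on countably many functionals only. The coordinates are always among
  them and fix the limit vector, whichever functional is added.\<close>

locale seg_space =
  fixes seg :: "'a set \<Rightarrow> bool" and lev :: "'a \<Rightarrow> nat"
  assumes seg_finite: "seg s \<Longrightarrow> finite s"
    and seg_sing: "seg {t}"
    and seg_ge: "seg s \<Longrightarrow> seg (s \<inter> {t. n \<le> lev t})"
    and seg_lt: "seg s \<Longrightarrow> seg (s \<inter> {t. lev t < n})"
    and finite_lev: "finite {t. lev t < n}"
begin

definition adm :: "'a set set \<Rightarrow> bool" where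
  "adm F \<longleftrightarrow> finite F \<and> (\<forall>s\<in>F. seg s) \<and> pairwise disjnt F"

definition Q :: "'a set set \<Rightarrow> ('a \<Rightarrow> real) \<Rightarrow> real" where
  "Q F x = (\<Sum>s\<in>F. (\<Sum>t\<in>s. x t)^2)"

text \<open>Membership in c_0 is derived from the finite norm in \<open>tendsto_0_cofinite\<close>;
  \<open>JT_X\<close> then identifies this set with \<open>JT\<close>.\<close>

definition X :: "('a \<Rightarrow> real) set" where
  "X = {x. bdd_above {sqrt (Q F x) |F. adm F}}"

definition nrm :: "('a \<Rightarrow> real) \<Rightarrow> real" where
  "nrm x = Sup {sqrt (Q F x) |F. adm F}"

definition blk :: "nat \<Rightarrow> nat \<Rightarrow> ('a \<Rightarrow> real) \<Rightarrow> 'a \<Rightarrow> real" where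
  "blk l m x = (\<lambda>t. if l \<le> lev t \<and> lev t < m then x t else 0)"

definition tail :: "nat \<Rightarrow> ('a \<Rightarrow> real) \<Rightarrow> 'a \<Rightarrow> real" where
  "tail l x = (\<lambda>t. if l \<le> lev t then x t else 0)"

section \<open>Linear structure and norm properties\<close>

lemma Q_nonneg: "0 \<le> Q F x"
  unfolding Q_def by (simp add: sum_nonneg)

lemma adm_empty: "adm {}"
  unfolding adm_def by simp

lemma sqrt_Q_le: assumes "x \<in> X" "adm F" shows "sqrt (Q F x) \<le> nrm x"
  unfolding nrm_def by (rule cSup_upper) (use assms in \<open>auto simp: X_def\<close>)

lemma nrm_nonneg: "x \<in> X \<Longrightarrow> 0 \<le> nrm x"
  using sqrt_Q_le[OF _ adm_empty, of x] by (simp add: Q_def)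

lemma Q_le: assumes "x \<in> X" "adm F" shows "Q F x \<le> (nrm x)\<^sup>2"
  using sqrt_Q_le[OF assms] nrm_nonneg[OF assms(1)] Q_nonneg[of F x]
  by (metis real_sqrt_le_iff real_sqrt_abs abs_of_nonneg)

lemma X_nrm_leI:
  assumes "\<And>F. adm F \<Longrightarrow> Q F x \<le> B\<^sup>2" "0 \<le> B"
  shows X_I: "x \<in> X" and nrm_leI: "nrm x \<le> B"
proof -
  have *: "sqrt (Q F x) \<le> B" if "adm F" for F
    using assms(1)[OF that] assms(2) by (simp add: real_le_lsqrt Q_nonneg)
  show "x \<in> X" unfolding X_def using * by (auto intro!: bdd_aboveI[of _ B])
  show "nrm x \<le> B" unfolding nrm_def
    by (rule cSup_least) (use adm_empty * in auto)
qed

text \<open>The indexed form tolerates repetitions: two equal members are disjoint, hence empty, and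
  contribute 0.\<close>

lemma sum_family_le:
  assumes "finite S" "\<And>i. i \<in> S \<Longrightarrow> seg (g i)"
    "\<And>i j. i \<in> S \<Longrightarrow> j \<in> S \<Longrightarrow> i \<noteq> j \<Longrightarrow> g i \<inter> g j = {}" "x \<in> X"
  shows "(\<Sum>i\<in>S. (\<Sum>t\<in>g i. x t)\<^sup>2) \<le> (nrm x)\<^sup>2"
proof -
  have "adm (g ` S)"
    unfolding adm_def pairwise_def disjnt_def using assms(1-3) by auto
  moreover have "Q (g ` S) x = (\<Sum>i\<in>S. (\<Sum>t\<in>g i. x t)\<^sup>2)"
    unfolding Q_def
  proof (subst sum.reindex_nontrivial)
    fix i j assume "i \<in> S" "j \<in> S" "i \<noteq> j" "g i = g j"
    then have "g i = {}" using assms(3) by blast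
    then show "(\<Sum>t\<in>g i. x t)\<^sup>2 = 0" by simp
  qed (use assms(1) in auto)
  ultimately show ?thesis using Q_le[OF assms(4)] by metis
qed

lemma abs_seg_sum_le: assumes "x \<in> X" "seg s" shows "\<bar>\<Sum>t\<in>s. x t\<bar> \<le> nrm x"
proof -
  have "(\<Sum>i\<in>{s}. (\<Sum>t\<in>i. x t)\<^sup>2) \<le> (nrm x)\<^sup>2"
    by (rule sum_family_le) (use assms in auto)
  then show ?thesis using nrm_nonneg[OF assms(1)]
    by (simp add: abs_le_square_iff[symmetric])
qed

lemma abs_le_nrm: "x \<in> X \<Longrightarrow> \<bar>x t\<bar> \<le> nrm x"
  using abs_seg_sum_le[OF _ seg_sing, of x t] by simp

lemma nrm_eq_0D: "x \<in> X \<Longrightarrow> nrm x \<le> 0 \<Longrightarrow> x = (\<lambda>t. 0)"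
  using abs_le_nrm by (metis abs_le_zero_iff order_trans)

lemma zero_X: "(\<lambda>t. 0) \<in> X" and nrm_zero: "nrm (\<lambda>t. 0) = 0"
proof -
  have *: "Q F (\<lambda>t. 0) \<le> 0\<^sup>2" for F by (simp add: Q_def)
  show "(\<lambda>t. 0) \<in> X" by (rule X_I[OF *]) auto
  then show "nrm (\<lambda>t. 0) = 0" using nrm_leI[OF *] nrm_nonneg by fastforce
qed

lemma sqrt_Q_triangle: "sqrt (Q F (\<lambda>t. x t + y t)) \<le> sqrt (Q F x) + sqrt (Q F y)"
  using L2_set_triangle_ineq[of "\<lambda>s. \<Sum>t\<in>s. x t" "\<lambda>s. \<Sum>t\<in>s. y t" F]
  by (simp add: Q_def L2_set_def sum.distrib)

lemma
  assumes "x \<in> X" "y \<in> X"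
  shows add_X: "(\<lambda>t. x t + y t) \<in> X"
    and nrm_triangle: "nrm (\<lambda>t. x t + y t) \<le> nrm x + nrm y"
proof -
  have *: "Q F (\<lambda>t. x t + y t) \<le> (nrm x + nrm y)\<^sup>2" if "adm F" for F
  proof -
    have "sqrt (Q F (\<lambda>t. x t + y t)) \<le> nrm x + nrm y"
      using sqrt_Q_triangle[of F x y] sqrt_Q_le[OF assms(1) that] sqrt_Q_le[OF assms(2) that] by linarith
    then show ?thesis by (rule sqrt_le_D)
  qed
  have "0 \<le> nrm x + nrm y" using assms nrm_nonneg by (simp add: add_nonneg_nonneg)
  then show "(\<lambda>t. x t + y t) \<in> X" "nrm (\<lambda>t. x t + y t) \<le> nrm x + nrm y"
    using X_I nrm_leI * by blast+
qed

lemma Q_scale: "Q F (\<lambda>t. c * x t) = c\<^sup>2 * Q F x"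
  by (simp add: Q_def sum_distrib_left[symmetric] power_mult_distrib)

lemma assumes "x \<in> X" shows scale_X: "(\<lambda>t. c * x t) \<in> X"
  and nrm_scale_le: "nrm (\<lambda>t. c * x t) \<le> \<bar>c\<bar> * nrm x"
proof -
  have *: "Q F (\<lambda>t. c * x t) \<le> (\<bar>c\<bar> * nrm x)\<^sup>2" if "adm F" for F
    using Q_le[OF assms that] by (simp add: Q_scale power_mult_distrib mult_left_mono)
  have "0 \<le> \<bar>c\<bar> * nrm x" using nrm_nonneg[OF assms] by simp
  then show "(\<lambda>t. c * x t) \<in> X" "nrm (\<lambda>t. c * x t) \<le> \<bar>c\<bar> * nrm x"
    using X_I nrm_leI * by blast+
qed

lemma nrm_scale: assumes "x \<in> X" shows "nrm (\<lambda>t. c * x t) = \<bar>c\<bar> * nrm x"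
proof (cases "c = 0")
  case True then show ?thesis by (simp add: nrm_zero)
next
  case False
  have "nrm (\<lambda>t. inverse c * (c * x t)) \<le> \<bar>inverse c\<bar> * nrm (\<lambda>t. c * x t)"
    by (rule nrm_scale_le[OF scale_X[OF assms]])
  moreover have "(\<lambda>t. inverse c * (c * x t)) = x" using False by (simp add: fun_eq_iff)
  ultimately have "\<bar>c\<bar> * nrm x \<le> nrm (\<lambda>t. c * x t)"
    using False by (simp add: field_simps abs_inverse)
  then show ?thesis using nrm_scale_le[OF assms, of c] by linarith
qed

lemma uminus_X: "x \<in> X \<Longrightarrow> (\<lambda>t. - x t) \<in> X"
  and nrm_uminus: "x \<in> X \<Longrightarrow> nrm (\<lambda>t. - x t) = nrm x"
  using scale_X[of x "-1"] nrm_scale[of x "-1"] by auto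

lemma diff_X: "x \<in> X \<Longrightarrow> y \<in> X \<Longrightarrow> (\<lambda>t. x t - y t) \<in> X"
  and nrm_diff_le: "x \<in> X \<Longrightarrow> y \<in> X \<Longrightarrow> nrm (\<lambda>t. x t - y t) \<le> nrm x + nrm y"
  using add_X[of x "\<lambda>t. - y t"] nrm_triangle[of x "\<lambda>t. - y t"] uminus_X[of y] nrm_uminus[of y]
  by auto

lemma nrm_minus_commute: "x \<in> X \<Longrightarrow> y \<in> X \<Longrightarrow> nrm (\<lambda>t. x t - y t) = nrm (\<lambda>t. y t - x t)"
  using nrm_uminus[of "\<lambda>t. x t - y t"] diff_X[of x y] by simp

lemma
  assumes "finite K" "\<And>k. k \<in> K \<Longrightarrow> y k \<in> X"
  shows sum_X: "(\<lambda>t. \<Sum>k\<in>K. c k * y k t) \<in> X"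
    and nrm_sum_le: "nrm (\<lambda>t. \<Sum>k\<in>K. c k * y k t) \<le> (\<Sum>k\<in>K. \<bar>c k\<bar> * nrm (y k))"
proof -
  have "(\<lambda>t. \<Sum>k\<in>K. c k * y k t) \<in> X \<and>
      nrm (\<lambda>t. \<Sum>k\<in>K. c k * y k t) \<le> (\<Sum>k\<in>K. \<bar>c k\<bar> * nrm (y k))"
    using assms
  proof (induction K rule: finite_induct)
    case empty then show ?case by (simp add: zero_X nrm_zero)
  next
    case (insert k K)
    then have IH: "(\<lambda>t. \<Sum>k\<in>K. c k * y k t) \<in> X"
      "nrm (\<lambda>t. \<Sum>k\<in>K. c k * y k t) \<le> (\<Sum>k\<in>K. \<bar>c k\<bar> * nrm (y k))" by auto
    have k: "(\<lambda>t. c k * y k t) \<in> X" "nrm (\<lambda>t. c k * y k t) = \<bar>c k\<bar> * nrm (y k)"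
      using insert scale_X nrm_scale by auto
    show ?case using add_X[OF k(1) IH(1)] nrm_triangle[OF k(1) IH(1)] k(2) IH(2) insert(1,2) by simp
  qed
  then show "(\<lambda>t. \<Sum>k\<in>K. c k * y k t) \<in> X"
    "nrm (\<lambda>t. \<Sum>k\<in>K. c k * y k t) \<le> (\<Sum>k\<in>K. \<bar>c k\<bar> * nrm (y k))" by auto
qed

text \<open>Each \<open>Q F\<close> looks at finitely many coordinates, so the norm is lower
  semicontinuous under coordinatewise convergence. This takes the place of completeness: series are
  summed coordinatewise, and the limit inherits membership and bound.\<close>

lemma
  assumes lim: "\<And>t. (\<lambda>n. x n t) \<longlonglongrightarrow> y t"
    and bd: "\<forall>\<^sub>F n in sequentially. x n \<in> X \<and> nrm (x n) \<le> M"
  shows lim_X: "y \<in> X" and nrm_lim_le: "nrm y \<le> M"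
proof -
  obtain n where n: "x n \<in> X" "nrm (x n) \<le> M"
    using eventually_happens[OF bd] by auto
  have M: "0 \<le> M" using nrm_nonneg[OF n(1)] n(2) by simp
  have *: "Q F y \<le> M\<^sup>2" if F: "adm F" for F
  proof (rule tendsto_upperbound)
    show "(\<lambda>n. Q F (x n)) \<longlonglongrightarrow> Q F y"
      unfolding Q_def by (intro tendsto_sum tendsto_power lim)
    show "\<forall>\<^sub>F n in sequentially. Q F (x n) \<le> M\<^sup>2"
      using bd
    proof eventually_elim
      case (elim n)
      have "(nrm (x n))\<^sup>2 \<le> M\<^sup>2" using elim nrm_nonneg by (simp add: power_mono)
      then show ?case using Q_le[OF _ F, of "x n"] elim by simp
    qed
  qed auto
  show "y \<in> X" "nrm y \<le> M" using X_I[OF * M] nrm_leI[OF * M] by auto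
qed

text \<open>If \<open>A\<close> meets every segment in a segment, replacing each \<open>s\<close> of
  a disjoint family by \<open>s \<inter> A\<close> gives another such family, so setting
  \<open>x\<close> to 0 outside \<open>A\<close> cannot increase the norm.\<close>

lemma
  assumes x: "x \<in> X"
  shows tail_X: "tail l x \<in> X"
    and blk_X: "blk l m x \<in> X" and nrm_blk_le: "nrm (blk l m x) \<le> nrm x"
proof -
  have res: "Q F (\<lambda>t. if t \<in> A then x t else 0) \<le> (nrm x)\<^sup>2"
    if F: "adm F" and A: "\<And>s. seg s \<Longrightarrow> seg (s \<inter> A)" for F A
  proof -
    have "Q F (\<lambda>t. if t \<in> A then x t else 0) = (\<Sum>s\<in>F. (\<Sum>t\<in>s \<inter> A. x t)\<^sup>2)"
      unfolding Q_def
    proof (rule sum.cong)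
      fix s assume "s \<in> F"
      then have "finite s" using F seg_finite by (auto simp: adm_def)
      then show "(\<Sum>t\<in>s. if t \<in> A then x t else 0)\<^sup>2 = (\<Sum>t\<in>s \<inter> A. x t)\<^sup>2"
        by (simp add: sum.inter_restrict)
    qed simp
    also have "\<dots> \<le> (nrm x)\<^sup>2"
      by (rule sum_family_le) (use F A x in \<open>unfold adm_def pairwise_def disjnt_def, blast+\<close>)
    finally show ?thesis .
  qed
  have "seg (s \<inter> {t. l \<le> lev t})" if "seg s" for s using seg_ge[OF that] .
  from res[OF _ this] have 1: "Q F (tail l x) \<le> (nrm x)\<^sup>2" if "adm F" for F
    using that by (simp add: tail_def)
  have "seg (s \<inter> {t. l \<le> lev t \<and> lev t < m})" if "seg s" for s
    using seg_lt[OF seg_ge[OF that], of l m] by (simp add: Int_assoc Collect_conj_eq)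
  from res[OF _ this] have 2: "Q F (blk l m x) \<le> (nrm x)\<^sup>2" if "adm F" for F
    using that by (simp add: blk_def)
  show "tail l x \<in> X" "blk l m x \<in> X" "nrm (blk l m x) \<le> nrm x"
    using X_I nrm_leI 1 2 nrm_nonneg[OF x] by blast+
qed

text \<open>A family that nearly attains the norm lives below some level. Families beyond that level
  can be adjoined to it, so their sums must fit into the remaining gap
  \<open>e\<^sup>2\<close>.\<close>

lemma nrm_tail_small:
  assumes x: "x \<in> X" and e: "0 < e"
  shows "\<exists>n. \<forall>m\<ge>n. nrm (tail m x) \<le> e"
proof -
  have "\<exists>F. adm F \<and> (nrm x)\<^sup>2 - e\<^sup>2 \<le> Q F x"
  proof (cases "nrm x \<le> e")
    case True
    then have "(nrm x)\<^sup>2 \<le> e\<^sup>2" using nrm_nonneg[OF x] by (simp add: power_mono)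
    then show ?thesis using adm_empty Q_nonneg[of "{}" x] by (intro exI[of _ "{}"]) auto
  next
    case False
    define d where "d = sqrt ((nrm x)\<^sup>2 - e\<^sup>2)"
    have "(nrm x)\<^sup>2 - e\<^sup>2 < (nrm x)\<^sup>2" using e by simp
    then have "d < nrm x" using nrm_nonneg[OF x] unfolding d_def
      by (metis abs_of_nonneg real_sqrt_abs real_sqrt_less_iff)
    then obtain F where F: "adm F" "d < sqrt (Q F x)"
      unfolding nrm_def using adm_empty x
      by (subst (asm) less_cSup_iff) (auto simp: X_def)
    then show ?thesis unfolding d_def by (intro exI[of _ F]) simp
  qed
  then obtain F where F: "adm F" "(nrm x)\<^sup>2 - e\<^sup>2 \<le> Q F x" by blast
  have "finite (\<Union>F)" using F(1) seg_finite by (auto simp: adm_def)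
  then have "finite (lev ` \<Union>F)" by simp
  then obtain n where n: "\<And>t. t \<in> \<Union>F \<Longrightarrow> lev t < n"
    by (metis finite_nat_set_iff_bounded imageI)
  have "nrm (tail m x) \<le> e" if m: "n \<le> m" for m
  proof (rule nrm_leI)
    fix F' assume F': "adm F'"
    define r where "r s = s \<inter> {t. m \<le> lev t}" for s
    \<comment> \<open>The disjoint sum keeps the index sets apart even if several cut segments
      become equal, namely empty.\<close>
    define g where "g = case_sum (\<lambda>s. s) r"
    have "(\<Sum>i\<in>F <+> F'. (\<Sum>t\<in>g i. x t)\<^sup>2) \<le> (nrm x)\<^sup>2"
    proof (rule sum_family_le)
      show "finite (F <+> F')" using F F' by (auto simp: adm_def)
      show "seg (g i)" if "i \<in> F <+> F'" for i
        using that F F' seg_ge by (auto simp: g_def r_def adm_def)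
      show "g i \<inter> g j = {}" if ij: "i \<in> F <+> F'" "j \<in> F <+> F'" "i \<noteq> j" for i j
      proof -
        have "s \<inter> r s' = {}" if "s \<in> F" for s s'
          using n that m by (force simp: r_def)
        moreover have dF: "\<And>s s'. s \<in> F \<Longrightarrow> s' \<in> F \<Longrightarrow> s \<noteq> s' \<Longrightarrow> s \<inter> s' = {}"
          and dF': "\<And>s s'. s \<in> F' \<Longrightarrow> s' \<in> F' \<Longrightarrow> s \<noteq> s' \<Longrightarrow> r s \<inter> r s' = {}"
          using F(1) F' unfolding adm_def pairwise_def disjnt_def r_def by blast+
        ultimately show ?thesis
          using ij unfolding g_def by (elim PlusE) (simp_all add: Int_commute)
      qed
    qed (rule x)
    also have "(\<Sum>i\<in>F <+> F'. (\<Sum>t\<in>g i. x t)\<^sup>2) = Q F x + Q F' (tail m x)"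
    proof -
      have "(\<Sum>t\<in>r s. x t) = (\<Sum>t\<in>s. tail m x t)" if "s \<in> F'" for s
        using that F' seg_finite unfolding tail_def r_def
        by (subst sum.If_cases) (auto simp: adm_def)
      then show ?thesis
        using F F' by (simp add: sum.Plus adm_def g_def Q_def)
    qed
    finally show "Q F' (tail m x) \<le> e\<^sup>2" using F(2) by linarith
  qed (use e in auto)
  then show ?thesis by blast
qed

lemma tendsto_0_cofinite: assumes x: "x \<in> X" shows "(x \<longlongrightarrow> 0) cofinite"
proof (rule tendstoI)
  fix e :: real assume e: "0 < e"
  then obtain n where n: "nrm (tail n x) \<le> e / 2"
    using nrm_tail_small[OF x, of "e/2"] by auto
  have "\<bar>x t\<bar> < e" if "\<not> lev t < n" for t
    using abs_le_nrm[OF tail_X[OF x], of n t] that n e by (simp add: tail_def)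
  then have "{t. \<not> dist (x t) 0 < e} \<subseteq> {t. lev t < n}" by auto
  then show "\<forall>\<^sub>F t in cofinite. dist (x t) 0 < e"
    unfolding eventually_cofinite using finite_lev finite_subset by blast
qed

section \<open>Vectors of finite support\<close>

lemma single_X: "(\<lambda>t. if t = v then 1 else 0) \<in> X"
  and nrm_single: "nrm (\<lambda>t. if t = v then 1 else 0) \<le> 1"
proof -
  have *: "Q F (\<lambda>t. if t = v then 1 else 0) \<le> 1\<^sup>2" if F: "adm F" for F
  proof -
    have "Q F (\<lambda>t. if t = v then 1 else 0) = (\<Sum>s\<in>F. if v \<in> s then 1 else 0)"
      unfolding Q_def using F seg_finite by (intro sum.cong refl) (auto simp: adm_def)
    also have "\<dots> = card {s\<in>F. v \<in> s}"
      using F by (simp add: sum.If_cases adm_def Int_def)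
    also have "card {s\<in>F. v \<in> s} \<le> 1"
      using F by (intro card_le_Suc0_iff_eq[THEN iffD2, unfolded One_nat_def[symmetric]])
        (auto simp: adm_def pairwise_def disjnt_def)
    finally show ?thesis by simp
  qed
  show "(\<lambda>t. if t = v then 1 else 0) \<in> X" "nrm (\<lambda>t. if t = v then 1 else 0) \<le> 1"
    using X_I[OF *] nrm_leI[OF *] by auto
qed

lemma
  assumes "finite A" "\<And>t. t \<notin> A \<Longrightarrow> x t = 0"
  shows finite_support_X: "x \<in> X" and nrm_finite_support: "nrm x \<le> (\<Sum>v\<in>A. \<bar>x v\<bar>)"
proof -
  have x: "x = (\<lambda>t. \<Sum>v\<in>A. x v * (if t = v then 1 else 0))"
  proof
    fix t
    have "(\<Sum>v\<in>A. x v * (if t = v then 1 else 0)) = (\<Sum>v\<in>A. if t = v then x v else 0)"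
      by (intro sum.cong) auto
    then show "x t = (\<Sum>v\<in>A. x v * (if t = v then 1 else 0))"
      using assms by (simp add: sum.delta')
  qed
  show "x \<in> X" by (subst x) (rule sum_X[OF assms(1) single_X])
  have "nrm x \<le> (\<Sum>v\<in>A. \<bar>x v\<bar> * nrm (\<lambda>t. if t = v then 1 else 0))"
    by (subst x) (rule nrm_sum_le[OF assms(1) single_X])
  also have "\<dots> \<le> (\<Sum>v\<in>A. \<bar>x v\<bar>)"
    using nrm_single by (intro sum_mono) (simp add: mult_left_le)
  finally show "nrm x \<le> (\<Sum>v\<in>A. \<bar>x v\<bar>)" .
qed

lemma nrm_head_tendsto_0:
  assumes "\<And>t. (\<lambda>n. u n t) \<longlonglongrightarrow> 0"
  shows "(\<lambda>n. nrm (blk 0 l (u n))) \<longlonglongrightarrow> 0"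
proof (rule tendsto_sandwich[OF _ _ tendsto_const])
  have le: "nrm (blk 0 l (u n)) \<le> (\<Sum>v | lev v < l. \<bar>blk 0 l (u n) v\<bar>)"
    and X: "blk 0 l (u n) \<in> X" for n
    using nrm_finite_support[OF finite_lev[of l], of "blk 0 l (u n)"]
      finite_support_X[OF finite_lev[of l], of "blk 0 l (u n)"] by (simp_all add: blk_def)
  show "\<forall>\<^sub>F n in sequentially. 0 \<le> nrm (blk 0 l (u n))" using X nrm_nonneg by simp
  show "\<forall>\<^sub>F n in sequentially. nrm (blk 0 l (u n)) \<le> (\<Sum>v | lev v < l. \<bar>u n v\<bar>)"
    using le by (auto simp: blk_def intro!: always_eventually)
  have "(\<lambda>n. \<Sum>v | lev v < l. \<bar>u n v\<bar>) \<longlonglongrightarrow> (\<Sum>v | lev v < l. \<bar>0\<bar>)"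
    by (intro tendsto_sum tendsto_rabs assms)
  then show "(\<lambda>n. \<Sum>v | lev v < l. \<bar>u n v\<bar>) \<longlonglongrightarrow> 0" by simp
qed

text \<open>\<open>H\<close> is the alternating series of the iterates of \<open>E\<close>, and 2 is
  the sum of the powers of 1/2. The series telescopes on \<open>b + E b\<close>.\<close>

lemma neumann_left_inverse:
  assumes E_X: "\<And>a. a \<in> X \<Longrightarrow> E a \<in> X"
    and E_add: "\<And>a b. a \<in> X \<Longrightarrow> b \<in> X \<Longrightarrow> E (\<lambda>i. a i + b i) = (\<lambda>i. E a i + E b i)"
    and E_scale: "\<And>a c. a \<in> X \<Longrightarrow> E (\<lambda>i. c * a i) = (\<lambda>i. c * E a i)"
    and E_half: "\<And>a. a \<in> X \<Longrightarrow> nrm (E a) \<le> nrm a / 2"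
  obtains H where "\<And>b. b \<in> X \<Longrightarrow> H b \<in> X" "\<And>b. b \<in> X \<Longrightarrow> nrm (H b) \<le> 2 * nrm b"
    "\<And>a b. a \<in> X \<Longrightarrow> b \<in> X \<Longrightarrow> H (\<lambda>i. a i + b i) = (\<lambda>i. H a i + H b i)"
    "\<And>a c. a \<in> X \<Longrightarrow> H (\<lambda>i. c * a i) = (\<lambda>i. c * H a i)"
    "\<And>b. b \<in> X \<Longrightarrow> H (\<lambda>i. b i + E b i) = b"
proof -
  define T where "T j = (E ^^ j)" for j
  have T_Suc: "T (Suc j) a = E (T j a)" for j a by (simp add: T_def)
  have T0: "T 0 a = a" for a by (simp add: T_def)
  have T_X: "T j a \<in> X" if "a \<in> X" for j a
    by (induction j) (use that E_X T_Suc T0 in auto)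
  have T_add: "T j (\<lambda>i. a i + b i) = (\<lambda>i. T j a i + T j b i)" if "a \<in> X" "b \<in> X" for j a b
    by (induction j) (use that E_add T_Suc T0 T_X in auto)
  have T_scale: "T j (\<lambda>i. c * a i) = (\<lambda>i. c * T j a i)" if "a \<in> X" for j a c
    by (induction j) (use that E_scale T_Suc T0 T_X in auto)
  have T_nrm: "nrm (T j a) \<le> (1/2)^j * nrm a" if "a \<in> X" for j a
  proof (induction j)
    case (Suc j) then show ?case using E_half[OF T_X[OF that], of j] T_Suc by simp
  qed (simp add: T0)
  have bd: "\<bar>(-1)^j * T j a i\<bar> \<le> (1/2)^j * nrm a" if "a \<in> X" for j a i
    using abs_le_nrm[OF T_X[OF that], of j i] T_nrm[OF that, of j] by (simp add: abs_mult)
  have summ: "summable (\<lambda>j. (-1)^j * T j a i)" if "a \<in> X" for a i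
    by (rule summable_comparison_test'[where g="\<lambda>j. (1/2)^j * nrm a"])
      (use bd[OF that] in \<open>auto intro!: summable_mult2 summable_geometric\<close>)
  define H where "H a = (\<lambda>i. \<Sum>j. (-1)^j * T j a i)" for a
  have H: "H a \<in> X \<and> nrm (H a) \<le> 2 * nrm a" if a: "a \<in> X" for a
  proof -
    have lim: "(\<lambda>n. \<Sum>j<n. (-1)^j * T j a i) \<longlonglongrightarrow> H a i" for i
      unfolding H_def by (rule summable_LIMSEQ[OF summ[OF a]])
    have "nrm (\<lambda>i. \<Sum>j<n. (-1)^j * T j a i) \<le> 2 * nrm a" for n
    proof -
      have "nrm (\<lambda>i. \<Sum>j<n. (-1)^j * T j a i) \<le> (\<Sum>j<n. \<bar>(-1)^j\<bar> * nrm (T j a))"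
        by (rule nrm_sum_le) (use T_X[OF a] in auto)
      also have "\<dots> \<le> (\<Sum>j<n. (1/2)^j * nrm a)"
        by (intro sum_mono) (use T_nrm[OF a] in \<open>simp add: power_abs\<close>)
      also have "\<dots> = (\<Sum>j<n. (1/2)^j) * nrm a" by (simp add: sum_distrib_right)
      also have "\<dots> \<le> 2 * nrm a"
        by (intro mult_right_mono nrm_nonneg a) (simp add: sum_gp_strict)
      finally show ?thesis .
    qed
    moreover have "(\<lambda>i. \<Sum>j<n. (-1)^j * T j a i) \<in> X" for n
      by (rule sum_X) (use T_X[OF a] in auto)
    ultimately show ?thesis
      using lim_X[of "\<lambda>n i. \<Sum>j<n. (-1)^j * T j a i" "H a" "2 * nrm a", OF lim]
        nrm_lim_le[of "\<lambda>n i. \<Sum>j<n. (-1)^j * T j a i" "H a" "2 * nrm a", OF lim]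
      by (simp add: always_eventually)
  qed
  have "H (\<lambda>i. b i + E b i) = b" if b: "b \<in> X" for b
  proof
    fix i
    have "T j (E b) = T (Suc j) b" for j by (simp add: T_def funpow_swap1)
    then have "(-1)^j * T j (\<lambda>i. b i + E b i) i = (-1)^j * T j b i - (-1)^(Suc j) * T (Suc j) b i" for j
      using T_add[OF b E_X[OF b], of j] by (simp add: algebra_simps)
    moreover have "(\<lambda>j. (-1)^j * T j b i) \<longlonglongrightarrow> 0" by (rule summable_LIMSEQ_zero[OF summ[OF b]])
    ultimately have "(\<lambda>j. (-1)^j * T j (\<lambda>i. b i + E b i) i) sums ((-1)^0 * T 0 b i - 0)"
      using telescope_sums'[of "\<lambda>j. (-1)^j * T j b i" 0] by simp
    then show "H (\<lambda>i. b i + E b i) i = b i" unfolding H_def by (simp add: sums_iff T0)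
  qed
  moreover have "H (\<lambda>i. a i + b i) = (\<lambda>i. H a i + H b i)" if "a \<in> X" "b \<in> X" for a b
    unfolding H_def using suminf_add[OF summ summ, OF that] T_add[OF that]
    by (simp add: algebra_simps)
  moreover have "H (\<lambda>i. c * a i) = (\<lambda>i. c * H a i)" if "a \<in> X" for a c
    unfolding H_def using suminf_mult[OF summ[OF that]] T_scale[OF that]
    by (simp add: algebra_simps)
  ultimately show ?thesis using that H by blast
qed

text \<open>l2-duality on a nearly optimal family \<open>F\<close>: weight the sum over each segment
  by the normalised sum of \<open>x\<close> over it. Cauchy-Schwarz bounds \<open>g\<close> by the
  norm, and \<open>g x\<close> equals \<open>sqrt (Q F x)\<close>.\<close>

lemma norming_functional:
  assumes x: "x \<in> X"
  shows "\<exists>g. (\<forall>y z. g (\<lambda>t. y t + z t) = g y + g z) \<and> (\<forall>c y. g (\<lambda>t. c * y t) = c * g y) \<and>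
    (\<forall>y\<in>X. \<bar>g y\<bar> \<le> nrm y) \<and> nrm x / 2 \<le> g x"
proof (cases "nrm x \<le> 0")
  case True
  then show ?thesis using nrm_nonneg by (intro exI[of _ "\<lambda>_. 0"]) auto
next
  case False
  then obtain F where F: "adm F" "nrm x / 2 < sqrt (Q F x)"
    using less_cSup_iff[of "{sqrt (Q F x) |F. adm F}" "nrm x / 2"] adm_empty x
    unfolding nrm_def X_def by auto
  define q where "q = sqrt (Q F x)"
  have q: "0 < q" using F(2) False unfolding q_def by linarith
  define g where "g y = (\<Sum>s\<in>F. (\<Sum>t\<in>s. x t) / q * (\<Sum>t\<in>s. y t))" for y
  have q2: "q\<^sup>2 = Q F x" by (simp add: q_def Q_nonneg)
  show ?thesis
  proof (intro exI[of _ g] conjI allI ballI)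
    show "g (\<lambda>t. y t + z t) = g y + g z" for y z
      by (simp add: g_def sum.distrib distrib_left)
    show "g (\<lambda>t. c * y t) = c * g y" for c y
    proof -
      have "(\<Sum>t\<in>s. c * y t) = c * (\<Sum>t\<in>s. y t)" for s by (simp add: sum_distrib_left)
      then show ?thesis unfolding g_def sum_distrib_left[of c _ F] by (simp add: mult.left_commute)
    qed
    show "\<bar>g y\<bar> \<le> nrm y" if y: "y \<in> X" for y
    proof -
      have "(g y)\<^sup>2 \<le> (\<Sum>s\<in>F. ((\<Sum>t\<in>s. x t) / q)\<^sup>2) * (\<Sum>s\<in>F. (\<Sum>t\<in>s. y t)\<^sup>2)"
        unfolding g_def by (rule Cauchy_Schwarz_ineq_sum)
      also have "(\<Sum>s\<in>F. ((\<Sum>t\<in>s. x t) / q)\<^sup>2) = 1"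
        using q unfolding power_divide sum_divide_distrib[symmetric] q2[unfolded Q_def, symmetric] by simp
      also have "1 * (\<Sum>s\<in>F. (\<Sum>t\<in>s. y t)\<^sup>2) \<le> (nrm y)\<^sup>2"
        using Q_le[OF y F(1)] by (simp add: Q_def)
      finally show ?thesis using nrm_nonneg[OF y] by (simp add: abs_le_square_iff[symmetric])
    qed
    have "g x = Q F x / q"
      unfolding g_def Q_def sum_divide_distrib[of _ F] by (simp add: power2_eq_square)
    also have "\<dots> = q" using q q2 by (simp add: power2_eq_square field_simps)
    finally show "nrm x / 2 \<le> g x" using F(2) by (simp add: q_def)
  qed
qed

text \<open>A gliding hump in the dual (Sokal's proof of uniform boundedness) avoids Baire's theorem.\<close>

lemma weakly_bounded_imp_bounded:
  assumes x_X: "\<And>n. x n \<in> X" and wb: "\<And>f. f \<in> dual_sp X nrm \<Longrightarrow> \<exists>B. \<forall>n. \<bar>f (x n)\<bar> \<le> B"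
  shows "\<exists>M. \<forall>n. nrm (x n) \<le> M"
proof (rule ccontr)
  assume "\<not> ?thesis"
  \<comment> \<open>The 6 is 1 / (1/2 - 1/3): in units of \<open>(1/4)^k\<close> times the norm, the
    \<open>k\<close>-th summand contributes at least 1/2 at \<open>x (i k)\<close>, and all later
    ones together at most 1/3.\<close>
  then have "\<forall>k. \<exists>n. 6 * 4^k * real k < nrm (x n)" by (meson not_le)
  then obtain i where i: "\<And>k. 6 * 4^k * real k < nrm (x (i k))" by metis
  have "\<forall>k. \<exists>g. (\<forall>y z. g (\<lambda>t. y t + z t) = g y + g z) \<and> (\<forall>c y. g (\<lambda>t. c * y t) = c * g y) \<and>
    (\<forall>y\<in>X. \<bar>g y\<bar> \<le> nrm y) \<and> nrm (x (i k)) / 2 \<le> g (x (i k))"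
    by (intro allI norming_functional x_X)
  from choice[OF this] obtain g where g: "\<forall>k. (\<forall>y z. g k (\<lambda>t. y t + z t) = g k y + g k z) \<and>
    (\<forall>c y. g k (\<lambda>t. c * y t) = c * g k y) \<and> (\<forall>y\<in>X. \<bar>g k y\<bar> \<le> nrm y) \<and> nrm (x (i k)) / 2 \<le> g k (x (i k))" ..
  have g_add: "g k (\<lambda>t. y t + z t) = g k y + g k z" and g_scale: "g k (\<lambda>t. c * y t) = c * g k y"
    and g_ge: "nrm (x (i k)) / 2 \<le> g k (x (i k))" for k y z c
    using g by simp_all
  have g_le: "\<bar>g k y\<bar> \<le> nrm y" if "y \<in> X" for k y using g that by blast
  \<comment> \<open>The sign is that of the partial sum at \<open>x (i k)\<close>, so the new
    summand cannot cancel what is already there.\<close>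
  define \<Psi> where "\<Psi> = rec_nat (\<lambda>y. 0) (\<lambda>k \<psi> y. \<psi> y + (if 0 \<le> \<psi> (x (i k)) then 1 else -1) * (1/4)^k * g k y)"
  have \<Psi>0: "\<Psi> 0 y = 0"
    and \<Psi>S: "\<Psi> (Suc k) y = \<Psi> k y + (if 0 \<le> \<Psi> k (x (i k)) then 1 else -1) * (1/4)^k * g k y" for k y
    by (simp_all add: \<Psi>_def)
  have \<Psi>_add: "\<Psi> k (\<lambda>t. y t + z t) = \<Psi> k y + \<Psi> k z" for k y z
    by (induction k) (auto simp: \<Psi>0 \<Psi>S g_add algebra_simps)
  have \<Psi>_scale: "\<Psi> k (\<lambda>t. c * y t) = c * \<Psi> k y" for k c y
    by (induction k) (auto simp: \<Psi>0 \<Psi>S g_scale algebra_simps)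
  have step: "\<bar>\<Psi> (Suc k) y - \<Psi> k y\<bar> \<le> (1/4)^k * nrm y" if "y \<in> X" for k y
    using g_le[OF that, of k] by (simp add: \<Psi>S abs_mult)
  have diff: "\<bar>\<Psi> (k + j) y - \<Psi> k y\<bar> \<le> 4/3 * (1/4)^k * (1 - (1/4)^j) * nrm y" if y: "y \<in> X" for k j y
  proof (induction j)
    case (Suc j)
    have "\<bar>\<Psi> (k + Suc j) y - \<Psi> k y\<bar> \<le> \<bar>\<Psi> (k + j) y - \<Psi> k y\<bar> + \<bar>\<Psi> (Suc (k + j)) y - \<Psi> (k + j) y\<bar>" by simp
    also have "\<dots> \<le> 4/3 * (1/4)^k * (1 - (1/4)^j) * nrm y + (1/4)^(k + j) * nrm y"
      using Suc step[OF y, of "k + j"] by linarith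
    also have "\<dots> = 4/3 * (1/4)^k * (1 - (1/4)^Suc j) * nrm y"
      by (simp add: power_add field_simps)
    finally show ?case .
  qed simp
  have diff': "\<bar>\<Psi> m y - \<Psi> k y\<bar> \<le> 4/3 * (1/4)^k * nrm y" if y: "y \<in> X" and "k \<le> m" for k m y
  proof -
    have "4/3 * (1/4)^k * (1 - (1/4)^(m - k)) * nrm y \<le> 4/3 * (1/4)^k * 1 * nrm y"
      using nrm_nonneg[OF y] by (intro mult_right_mono mult_left_mono) auto
    moreover have "\<bar>\<Psi> m y - \<Psi> k y\<bar> \<le> 4/3 * (1/4)^k * (1 - (1/4)^(m - k)) * nrm y"
      using diff[OF y, of k "m - k"] that(2) by (simp only: le_add_diff_inverse)
    ultimately show ?thesis unfolding mult_1_right by linarith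
  qed
  have conv: "convergent (\<lambda>k. \<Psi> k y)" if y: "y \<in> X" for y
  proof -
    have "summable (\<lambda>k. \<Psi> (Suc k) y - \<Psi> k y)"
    proof (rule summable_comparison_test'[where g="\<lambda>k. (1/4)^k * nrm y"])
      show "summable (\<lambda>k. (1/4)^k * nrm y)" by (intro summable_mult2 summable_geometric) simp
    qed (use step[OF y] in simp)
    then have "convergent (\<lambda>n. \<Sum>k<n. \<Psi> (Suc k) y - \<Psi> k y)" by (simp add: summable_iff_convergent)
    moreover have "(\<Sum>k<n. \<Psi> (Suc k) y - \<Psi> k y) = \<Psi> n y" for n
      using sum_lessThan_telescope[of "\<lambda>k. \<Psi> k y" n] by (simp add: \<Psi>0)
    ultimately show ?thesis by simp
  qed
  define f where "f y = (if y \<in> X then lim (\<lambda>k. \<Psi> k y) else 0)" for y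
  have f_lim: "(\<lambda>k. \<Psi> k y) \<longlonglongrightarrow> f y" if "y \<in> X" for y
    using conv[OF that] that by (simp add: f_def convergent_LIMSEQ_iff)
  have f_diff: "\<bar>f y - \<Psi> k y\<bar> \<le> 4/3 * (1/4)^k * nrm y" if y: "y \<in> X" for k y
  proof (rule tendsto_upperbound)
    show "(\<lambda>m. \<bar>\<Psi> m y - \<Psi> k y\<bar>) \<longlonglongrightarrow> \<bar>f y - \<Psi> k y\<bar>"
      by (intro tendsto_rabs tendsto_diff f_lim[OF y] tendsto_const)
    show "\<forall>\<^sub>F m in sequentially. \<bar>\<Psi> m y - \<Psi> k y\<bar> \<le> 4/3 * (1/4)^k * nrm y"
      using eventually_ge_at_top[of k] by eventually_elim (rule diff'[OF y])
  qed simp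
  have "f \<in> dual_sp X nrm"
    unfolding dual_sp_def lin_functional_on_def
  proof (intro CollectI conjI ballI allI impI)
    show "f (\<lambda>t. y t + z t) = f y + f z" if "y \<in> X" "z \<in> X" for y z
      using f_lim[OF add_X[OF that]] tendsto_add[OF f_lim f_lim, OF that] LIMSEQ_unique
      by (force simp: \<Psi>_add)
    show "f (\<lambda>t. c * y t) = c * f y" if "y \<in> X" for y c
      using f_lim[OF scale_X[OF that, of c]] tendsto_mult[OF tendsto_const[of c] f_lim[OF that]] LIMSEQ_unique
      by (force simp: \<Psi>_scale)
    show "\<exists>C. \<forall>y\<in>X. \<bar>f y\<bar> \<le> C * nrm y"
      using f_diff[of _ 0] by (intro exI[of _ "4/3"]) (auto simp: \<Psi>0)
  qed (simp add: f_def)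
  then obtain B where B: "\<And>n. \<bar>f (x n)\<bar> \<le> B" using wb by blast
  obtain k where k: "B < real k" using reals_Archimedean2 by blast
  define y where "y = x (i k)"
  have y: "y \<in> X" by (simp add: y_def x_X)
  have "(1/4)^k * g k y \<le> \<bar>\<Psi> (Suc k) y\<bar>"
    using g_ge[of k] nrm_nonneg[OF y] by (auto simp: \<Psi>S y_def)
  moreover have "(1/4)^k * (nrm y / 2) \<le> (1/4)^k * g k y" using g_ge[of k] by (simp add: y_def)
  moreover have "\<bar>f y - \<Psi> (Suc k) y\<bar> \<le> (1/4)^k * (nrm y / 3)" using f_diff[OF y, of "Suc k"] by simp
  ultimately have "(1/4)^k * (nrm y / 2) - (1/4)^k * (nrm y / 3) \<le> \<bar>f y\<bar>" by linarith
  then have "(1/4)^k * (nrm y / 6) \<le> \<bar>f y\<bar>" by (simp add: algebra_simps)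
  moreover have "real k < (1/4)^k * (nrm y / 6)"
    using i[of k] by (simp add: y_def power_divide field_simps)
  ultimately show False using B[of "i k"] k by (simp add: y_def)
qed

end

section \<open>Sequences with a left inverse into the James space\<close>

definition j_seg :: "nat set \<Rightarrow> bool" where
  "j_seg I \<longleftrightarrow> (\<exists>m n. I = {m..n})"

definition jt_seg :: "bool list set \<Rightarrow> bool" where
  "jt_seg s \<longleftrightarrow> finite s \<and> tree_segment s"

lemma j_seg_convex:
  assumes "finite I" "\<And>i j k. i \<in> I \<Longrightarrow> k \<in> I \<Longrightarrow> i \<le> j \<Longrightarrow> j \<le> k \<Longrightarrow> j \<in> I"
  shows "j_seg I"
proof (cases "I = {}")
  case True then have "I = {1..0}" by simp
  then show ?thesis unfolding j_seg_def by blast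
next
  case False
  then have "Min I \<in> I" "Max I \<in> I" using assms(1) by auto
  from assms(2)[OF this] have "{Min I..Max I} \<subseteq> I" by auto
  moreover have "I \<subseteq> {Min I..Max I}" using assms(1) by auto
  ultimately have "I = {Min I..Max I}" by blast
  then show ?thesis unfolding j_seg_def by blast
qed

lemma seg_space_J: "seg_space j_seg (\<lambda>k. k)"
proof
  show "finite s" if "j_seg s" for s using that by (auto simp: j_seg_def)
  show "j_seg {t}" for t by (rule j_seg_convex) auto
  show "j_seg (s \<inter> {t. n \<le> t})" "j_seg (s \<inter> {t. t < n})" if j: "j_seg s" for s n
  proof -
    obtain a b where s: "s = {a..b}" using j by (auto simp: j_seg_def)
    show "j_seg (s \<inter> {t. n \<le> t})" "j_seg (s \<inter> {t. t < n})"
      by (rule j_seg_convex; auto simp: s)+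
  qed
qed simp

lemma seg_space_JT: "seg_space jt_seg length"
proof
  show "finite s" if "jt_seg s" for s using that by (auto simp: jt_seg_def)
  show "jt_seg {t}" for t
    by (auto simp: jt_seg_def tree_segment_def prefix_order.antisym)
  show "jt_seg (s \<inter> {t. n \<le> length t})" "jt_seg (s \<inter> {t. length t < n})" if "jt_seg s" for s n
  proof -
    have 1: "n \<le> length v" if "n \<le> length u" "prefix u v" for u v :: "bool list"
      using that prefix_length_le by fastforce
    have 2: "length v < n" if "length w < n" "prefix v w" for v w :: "bool list"
      using that prefix_length_le by fastforce
    show "jt_seg (s \<inter> {t. n \<le> length t})" "jt_seg (s \<inter> {t. length t < n})"
      using that 1 2 unfolding jt_seg_def tree_segment_def by blast+
  qed
  have "finite {t::bool list. set t \<subseteq> UNIV \<and> length t \<le> n}" for n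
    by (rule finite_lists_length_le) simp
  then show "finite {t::bool list. length t < n}" for n
    by (rule finite_subset[rotated, where B="{t::bool list. set t \<subseteq> UNIV \<and> length t \<le> n}"]) auto
qed

lemma J_nrm: "seg_space.nrm j_seg = j_norm" and J_X: "seg_space.X j_seg = J_space"
proof -
  interpret seg_space j_seg "\<lambda>k. k" by (rule seg_space_J)
  show "nrm = j_norm" "X = J_space"
    unfolding nrm_def[abs_def] j_norm_def[abs_def] X_def J_space_def j_sums_def adm_def Q_def j_seg_def
    by simp_all
qed

lemma JT_nrm: "seg_space.nrm jt_seg = jt_norm" and JT_X: "seg_space.X jt_seg = JT"
proof -
  interpret seg_space jt_seg length by (rule seg_space_JT)
  show "nrm = jt_norm"
    unfolding nrm_def[abs_def] jt_norm_def[abs_def] jt_sums_def adm_def Q_def jt_seg_def by simp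
  have "X = {x. bdd_above (jt_sums x)}"
    unfolding X_def jt_sums_def adm_def Q_def jt_seg_def by simp
  then show "X = JT"
    using tendsto_0_cofinite by (auto simp: JT_def)
qed

interpretation J: seg_space j_seg "\<lambda>k. k"
  rewrites "seg_space.nrm j_seg = j_norm" and "seg_space.X j_seg = J_space"
  by (rule seg_space_J J_nrm J_X)+

interpretation JT: seg_space jt_seg length
  rewrites "seg_space.nrm jt_seg = jt_norm" and "seg_space.X jt_seg = JT"
  by (rule seg_space_JT JT_nrm JT_X)+

lemma J_blk_0: "J.blk 0 m a = (\<lambda>k. if k < m then a k else 0)"
  by (simp add: J.blk_def)

lemma J_blk_in_J: "J.blk 0 m a \<in> J_space"
  by (rule J.finite_support_X[of "{..<m}"]) (auto simp: J.blk_def)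

text \<open>Controls the multiple of the limit vector \<open>x\<close> that occurs in a combination
  of the \<open>z n\<close>.\<close>

lemma abs_sum_le_j_norm: "\<bar>\<Sum>k<m. a k\<bar> \<le> j_norm (J.blk 0 m a)"
proof -
  have "\<bar>\<Sum>k\<in>{..<m}. J.blk 0 m a k\<bar> \<le> j_norm (J.blk 0 m a)"
    by (rule J.abs_seg_sum_le[OF J_blk_in_J j_seg_convex]) auto
  then show ?thesis by (simp add: J.blk_def)
qed

text \<open>Singletons form an admissible family. In this way l2-estimates are absorbed into
  estimates by the norm of \<open>J\<close>.\<close>

lemma l2_le_j_norm: "sqrt (\<Sum>k<m. (a k)\<^sup>2) \<le> j_norm (J.blk 0 m a)"
proof -
  have "(\<Sum>k<m. (\<Sum>i\<in>{k}. J.blk 0 m a i)\<^sup>2) \<le> (j_norm (J.blk 0 m a))\<^sup>2"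
    by (rule J.sum_family_le) (auto simp: J.seg_sing J_blk_in_J)
  then have "(\<Sum>k<m. (a k)\<^sup>2) \<le> (j_norm (J.blk 0 m a))\<^sup>2"
    by (simp add: J.blk_def)
  then show ?thesis using J.nrm_nonneg[OF J_blk_in_J] by (simp add: real_le_lsqrt sum_nonneg)
qed

text \<open>\<open>upper\<close> makes the map from unit vectors to \<open>y k\<close> bounded, and
  \<open>R\<close> is a bounded left inverse of it. The lower estimate, closedness of the range, the
  isomorphism with \<open>J\<close> and the projection \<open>S \<circ> R\<close> are then formal
  consequences.\<close>

locale J_system =
  fixes y :: "nat \<Rightarrow> bool list \<Rightarrow> real" and R :: "(bool list \<Rightarrow> real) \<Rightarrow> nat \<Rightarrow> real" and C D :: real
  assumes y_JT: "y k \<in> JT"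
    and C: "0 < C" and D: "0 < D"
    and upper: "jt_norm (\<lambda>t. \<Sum>k<m. a k * y k t) \<le> C * j_norm (J.blk 0 m a)"
    and R_J: "x \<in> JT \<Longrightarrow> R x \<in> J_space"
    and R_le: "x \<in> JT \<Longrightarrow> j_norm (R x) \<le> D * jt_norm x"
    and R_add: "x \<in> JT \<Longrightarrow> x' \<in> JT \<Longrightarrow> R (\<lambda>t. x t + x' t) = (\<lambda>k. R x k + R x' k)"
    and R_scale: "x \<in> JT \<Longrightarrow> R (\<lambda>t. c * x t) = (\<lambda>k. c * R x k)"
    and R_y: "R (y k) = (\<lambda>i. if i = k then 1 else 0)"
begin

definition S :: "(nat \<Rightarrow> real) \<Rightarrow> bool list \<Rightarrow> real" where
  "S a = (\<lambda>t. \<Sum>k. a k * y k t)"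

definition Sn :: "nat \<Rightarrow> (nat \<Rightarrow> real) \<Rightarrow> bool list \<Rightarrow> real" where
  "Sn m a = (\<lambda>t. \<Sum>k<m. a k * y k t)"

lemma R_diff: "x \<in> JT \<Longrightarrow> x' \<in> JT \<Longrightarrow> R (\<lambda>t. x t - x' t) = (\<lambda>k. R x k - R x' k)"
  using R_add[of x "\<lambda>t. - 1 * x' t"] R_scale[of x' "-1"] JT.uminus_X[of x'] by simp

lemma Sn_JT: "Sn m a \<in> JT"
  unfolding Sn_def by (rule JT.sum_X) (auto simp: y_JT)

lemma R_Sn: "R (Sn m a) = J.blk 0 m a"
proof (induction m)
  case 0
  have "R (\<lambda>t. 0 * y 0 t) = (\<lambda>k. 0 * R (y 0) k)" by (rule R_scale[OF y_JT])
  then show ?case by (simp add: Sn_def J.blk_def)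
next
  case (Suc m)
  have "R (Sn (Suc m) a) = (\<lambda>k. R (Sn m a) k + R (\<lambda>t. a m * y m t) k)"
    using R_add[OF Sn_JT JT.scale_X[OF y_JT], of m a "a m" m] by (simp add: Sn_def)
  then show ?case using Suc R_scale[OF y_JT, of "a m" m] R_y[of m] by (auto simp: J.blk_def fun_eq_iff less_Suc_eq)
qed

lemma jt_norm_Sn_le: "jt_norm (Sn m a) \<le> C * j_norm (J.blk 0 m a)"
  using upper by (simp add: Sn_def)

lemma jt_norm_Sn_diff_le:
  assumes a: "a \<in> J_space" and mn: "m \<le> n"
  shows "jt_norm (\<lambda>t. Sn n a t - Sn m a t) \<le> C * j_norm (J.tail m a)"
proof -
  have "{..<n} = {..<m} \<union> {m..<n}" using mn by auto
  then have "Sn n a t - Sn m a t = (\<Sum>k\<in>{m..<n}. a k * y k t)" for t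
    unfolding Sn_def by (simp add: sum.union_disjoint ivl_disj_int)
  also have "\<dots> t = Sn n (J.tail m a) t" for t
    unfolding Sn_def J.tail_def by (rule sum.mono_neutral_cong_left) auto
  finally have "(\<lambda>t. Sn n a t - Sn m a t) = Sn n (J.tail m a)" by auto
  moreover have "C * j_norm (J.blk 0 n (J.tail m a)) \<le> C * j_norm (J.tail m a)"
    by (intro mult_left_mono J.nrm_blk_le J.tail_X a) (use C in auto)
  ultimately show ?thesis using jt_norm_Sn_le[of n "J.tail m a"] by simp
qed

lemma Sn_LIMSEQ: assumes a: "a \<in> J_space" shows "(\<lambda>n. Sn n a t) \<longlonglongrightarrow> S a t"
proof -
  have "Cauchy (\<lambda>n. Sn n a t)"
  proof (rule metric_CauchyI)
    fix e :: real assume e: "0 < e"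
    then obtain N where N: "C * j_norm (J.tail N a) \<le> e / 4"
      using J.nrm_tail_small[OF a, of "e / 4 / C"] C by (auto simp: field_simps)
    have *: "\<bar>Sn n a t - Sn N a t\<bar> \<le> e / 4" if "N \<le> n" for n
      using JT.abs_le_nrm[OF JT.diff_X[OF Sn_JT[of n a] Sn_JT[of N a]], of t]
        jt_norm_Sn_diff_le[OF a that] N by linarith
    have "dist (Sn m a t) (Sn n a t) < e" if "N \<le> m" "N \<le> n" for m n
      using *[OF that(1)] *[OF that(2)] e unfolding dist_real_def by linarith
    then show "\<exists>M. \<forall>m\<ge>M. \<forall>n\<ge>M. dist (Sn m a t) (Sn n a t) < e" by blast
  qed
  then have "convergent (\<lambda>n. \<Sum>k<n. a k * y k t)" by (simp add: Cauchy_convergent Sn_def)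
  then show ?thesis
    unfolding S_def Sn_def by (intro summable_LIMSEQ) (simp add: summable_iff_convergent)
qed

lemma
  assumes a: "a \<in> J_space"
  shows S_JT: "S a \<in> JT"
    and jt_norm_S_diff_le: "jt_norm (\<lambda>t. S a t - Sn m a t) \<le> C * j_norm (J.tail m a)"
    and jt_norm_S_le: "jt_norm (S a) \<le> C * j_norm a"
proof -
  have d: "(\<lambda>t. S a t - Sn m a t) \<in> JT \<and> jt_norm (\<lambda>t. S a t - Sn m a t) \<le> C * j_norm (J.tail m a)" for m
  proof -
    have 1: "(\<lambda>n. Sn n a t - Sn m a t) \<longlonglongrightarrow> S a t - Sn m a t" for t
      by (intro tendsto_diff Sn_LIMSEQ a tendsto_const)
    have "\<forall>\<^sub>F n in sequentially. (\<lambda>t. Sn n a t - Sn m a t) \<in> JT \<and>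
        jt_norm (\<lambda>t. Sn n a t - Sn m a t) \<le> C * j_norm (J.tail m a)"
      using eventually_ge_at_top[of m]
      by eventually_elim (simp add: jt_norm_Sn_diff_le[OF a] JT.diff_X Sn_JT)
    then show ?thesis
      using JT.lim_X[of "\<lambda>n t. Sn n a t - Sn m a t" "\<lambda>t. S a t - Sn m a t", OF 1]
        JT.nrm_lim_le[of "\<lambda>n t. Sn n a t - Sn m a t" "\<lambda>t. S a t - Sn m a t", OF 1] by blast
  qed
  then show "jt_norm (\<lambda>t. S a t - Sn m a t) \<le> C * j_norm (J.tail m a)" by blast
  have "J.tail 0 a = a" "Sn 0 a = (\<lambda>t. 0)" by (auto simp: J.tail_def Sn_def)
  then show "S a \<in> JT" "jt_norm (S a) \<le> C * j_norm a" using d[of 0] by auto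
qed

lemma S_add: "a \<in> J_space \<Longrightarrow> b \<in> J_space \<Longrightarrow> S (\<lambda>k. a k + b k) = (\<lambda>t. S a t + S b t)"
proof
  fix t assume ab: "a \<in> J_space" "b \<in> J_space"
  have "(\<lambda>n. Sn n a t + Sn n b t) \<longlonglongrightarrow> S a t + S b t"
    by (intro tendsto_add Sn_LIMSEQ ab)
  moreover have "Sn n a t + Sn n b t = Sn n (\<lambda>k. a k + b k) t" for n
    by (simp add: Sn_def sum.distrib algebra_simps)
  ultimately show "S (\<lambda>k. a k + b k) t = S a t + S b t"
    using Sn_LIMSEQ[OF J.add_X[OF ab], of t] LIMSEQ_unique by fastforce
qed

lemma S_scale: "a \<in> J_space \<Longrightarrow> S (\<lambda>k. c * a k) = (\<lambda>t. c * S a t)"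
proof
  fix t assume a: "a \<in> J_space"
  have "(\<lambda>n. c * Sn n a t) \<longlonglongrightarrow> c * S a t"
    by (intro tendsto_mult tendsto_const Sn_LIMSEQ a)
  moreover have "c * Sn n a t = Sn n (\<lambda>k. c * a k) t" for n
    by (simp add: Sn_def sum_distrib_left algebra_simps)
  ultimately show "S (\<lambda>k. c * a k) t = c * S a t"
    using Sn_LIMSEQ[OF J.scale_X[OF a], of c t] LIMSEQ_unique by fastforce
qed

lemma S_diff: "a \<in> J_space \<Longrightarrow> b \<in> J_space \<Longrightarrow> S (\<lambda>k. a k - b k) = (\<lambda>t. S a t - S b t)"
  using S_add[of a "\<lambda>k. - 1 * b k"] S_scale[of b "-1"] J.uminus_X[of b] by simp

text \<open>On finite sums this is \<open>R_Sn\<close>. Tails in \<open>J\<close> are small in norm,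
  and boundedness of \<open>R\<close> and \<open>S\<close> carries the identity to the limit; the
  error is at most \<open>D * C + 1\<close> times the norm of the tail.\<close>

lemma R_S: assumes a: "a \<in> J_space" shows "R (S a) = a"
proof -
  have "j_norm (\<lambda>k. R (S a) k - a k) \<le> e" if e: "0 < e" for e
  proof -
    define d where "d = e / (D * C + 1)"
    have dpos: "0 < D * C + 1" using C D by (simp add: add_pos_pos)
    then have "0 < d" using e by (simp add: d_def)
    then obtain m where m: "j_norm (J.tail m a) \<le> d"
      using J.nrm_tail_small[OF a] by blast
    have X: "(\<lambda>t. S a t - Sn m a t) \<in> JT" using S_JT[OF a] Sn_JT by (rule JT.diff_X)
    have eq: "R (S a) k - a k = R (\<lambda>t. S a t - Sn m a t) k - J.tail m a k" for k
      using R_diff[OF S_JT[OF a] Sn_JT, of m a] R_Sn[of m a] by (simp add: J.tail_def J.blk_def)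
    have "j_norm (\<lambda>k. R (S a) k - a k) \<le> j_norm (R (\<lambda>t. S a t - Sn m a t)) + j_norm (J.tail m a)"
      unfolding eq by (rule J.nrm_diff_le[OF R_J[OF X] J.tail_X[OF a]])
    also have "\<dots> \<le> D * (C * j_norm (J.tail m a)) + j_norm (J.tail m a)"
      using R_le[OF X] mult_left_mono[OF jt_norm_S_diff_le[OF a, of m] less_imp_le[OF D]] by linarith
    also have "\<dots> = (D * C + 1) * j_norm (J.tail m a)" by (simp add: algebra_simps)
    also have "\<dots> \<le> (D * C + 1) * d" using m dpos by (intro mult_left_mono) auto
    also have "\<dots> = e" using dpos by (simp add: d_def)
    finally show ?thesis .
  qed
  then have "j_norm (\<lambda>k. R (S a) k - a k) \<le> 0" by (rule field_le_epsilon[of _ 0, simplified])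
  then have "(\<lambda>k. R (S a) k - a k) = (\<lambda>k. 0)"
    by (intro J.nrm_eq_0D J.diff_X R_J S_JT a)
  then show ?thesis by (simp add: fun_eq_iff)
qed

lemma S_blk: "S (J.blk 0 m a) = Sn m a"
proof
  fix t
  have "(\<lambda>k. J.blk 0 m a k * y k t) sums (\<Sum>k<m. J.blk 0 m a k * y k t)"
    by (rule sums_finite) (auto simp: J.blk_def)
  then show "S (J.blk 0 m a) t = Sn m a t" by (simp add: S_def Sn_def sums_iff J.blk_def)
qed

definition W :: "(bool list \<Rightarrow> real) set" where "W = S ` J_space"

text \<open>If \<open>v\<close> is close to \<open>S a\<close>, then \<open>R v\<close> is close to
  \<open>a\<close>, so \<open>S (R v)\<close> is close to \<open>S a\<close> and hence to
  \<open>v\<close>. This yields both the closedness of \<open>W\<close> and its description as a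
  closed span.\<close>

lemma in_W_if_approx:
  assumes v: "v \<in> JT" and ap: "\<And>e. 0 < e \<Longrightarrow> \<exists>a\<in>J_space. jt_norm (\<lambda>t. v t - S a t) < e"
  shows "S (R v) = v"
proof -
  have "jt_norm (\<lambda>t. S (R v) t - v t) \<le> e" if e: "0 < e" for e
  proof -
    have pos: "0 < C * D + 1" using C D by (simp add: add_pos_pos)
    obtain a where a: "a \<in> J_space" and le: "jt_norm (\<lambda>t. v t - S a t) < e / (C * D + 1)"
      using ap[of "e / (C * D + 1)"] e pos by auto
    define z where "z = (\<lambda>t. v t - S a t)"
    have z: "z \<in> JT" unfolding z_def by (rule JT.diff_X[OF v S_JT[OF a]])
    have "R z = (\<lambda>k. R v k - a k)" unfolding z_def using R_diff[OF v S_JT[OF a]] R_S[OF a] by simp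
    then have "S (R z) = (\<lambda>t. S (R v) t - S a t)" using S_diff[OF R_J[OF v] a] by simp
    then have eq: "(\<lambda>t. S (R v) t - v t) = (\<lambda>t. S (R z) t - z t)" by (simp add: z_def)
    have "jt_norm (\<lambda>t. S (R v) t - v t) \<le> jt_norm (S (R z)) + jt_norm z"
      unfolding eq by (rule JT.nrm_diff_le[OF S_JT[OF R_J[OF z]] z])
    also have "\<dots> \<le> C * (D * jt_norm z) + jt_norm z"
      using jt_norm_S_le[OF R_J[OF z]] mult_left_mono[OF R_le[OF z] less_imp_le[OF C]] by linarith
    also have "\<dots> = (C * D + 1) * jt_norm z" by (simp add: algebra_simps)
    also have "\<dots> \<le> e" using le pos unfolding z_def[symmetric] by (simp add: field_simps)
    finally show ?thesis .
  qed
  then have "jt_norm (\<lambda>t. S (R v) t - v t) \<le> 0" by (rule field_le_epsilon[of _ 0, simplified])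
  then have "(\<lambda>t. S (R v) t - v t) = (\<lambda>t. 0)"
    by (intro JT.nrm_eq_0D JT.diff_X S_JT R_J v)
  then show ?thesis by (simp add: fun_eq_iff)
qed

lemma W_closed_subspace: "closed_subspace JT jt_norm W"
  unfolding closed_subspace_def
proof (intro conjI)
  show "W \<subseteq> JT" unfolding W_def using S_JT by blast
  have "S (\<lambda>k. 0) = (\<lambda>t. 0)" by (simp add: S_def)
  then show "lin_subspace W"
    unfolding lin_subspace_def W_def
    by (auto simp: S_add[symmetric] S_scale[symmetric] intro!: imageI J.add_X J.scale_X)
      (metis J.zero_X imageI)
  show "norm_closed_in JT jt_norm W"
    unfolding norm_closed_in_def
  proof (intro ballI impI)
    fix v assume v: "v \<in> JT" "\<forall>e>0. \<exists>z\<in>W. jt_norm (\<lambda>t. v t - z t) < e"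
    then have "S (R v) = v" by (intro in_W_if_approx) (auto simp: W_def)
    then show "v \<in> W" unfolding W_def using R_J[OF v(1)] by (metis imageI)
  qed
qed

lemma closed_span_eq_W: "closed_span JT jt_norm y = W"
proof
  show "closed_span JT jt_norm y \<subseteq> W"
  proof
    fix v assume v: "v \<in> closed_span JT jt_norm y"
    have "\<exists>a\<in>J_space. jt_norm (\<lambda>t. v t - S a t) < e" if e: "0 < e" for e
    proof -
      obtain m a where "jt_norm (\<lambda>t. v t - Sn m a t) < e"
        using v e unfolding closed_span_def Sn_def by blast
      then show ?thesis using S_blk J_blk_in_J by metis
    qed
    then have "S (R v) = v" using v by (intro in_W_if_approx) (auto simp: closed_span_def)
    then show "v \<in> W" unfolding W_def using R_J[of v] v by (auto simp: closed_span_def intro!: image_eqI[of _ _ "R v"])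
  qed
  show "W \<subseteq> closed_span JT jt_norm y"
  proof
    fix v assume "v \<in> W"
    then obtain a where a: "a \<in> J_space" "v = S a" by (auto simp: W_def)
    have "\<exists>m b. jt_norm (\<lambda>t. v t - (\<Sum>k<m. b k * y k t)) < e" if e: "0 < e" for e
    proof -
      obtain m where "j_norm (J.tail m a) \<le> e / 2 / C"
        using J.nrm_tail_small[OF a(1), of "e / 2 / C"] e C by auto
      then have "C * j_norm (J.tail m a) < e" using e C by (simp add: field_simps)
      then show ?thesis using jt_norm_S_diff_le[OF a(1), of m] a(2) unfolding Sn_def
        by (intro exI[of _ m] exI[of _ a]) simp
    qed
    then show "v \<in> closed_span JT jt_norm y" using S_JT a by (simp add: closed_span_def)
  qed
qed

lemma W_complemented: "complemented_in JT jt_norm W"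
  unfolding complemented_in_def
proof (intro exI[of _ "S \<circ> R"] conjI ballI allI)
  show "\<exists>B. \<forall>x\<in>JT. jt_norm ((S \<circ> R) x) \<le> B * jt_norm x"
  proof (intro exI[of _ "C * D"] ballI)
    fix x assume x: "x \<in> JT"
    show "jt_norm ((S \<circ> R) x) \<le> C * D * jt_norm x"
      using jt_norm_S_le[OF R_J[OF x]] mult_left_mono[OF R_le[OF x] less_imp_le[OF C]]
      by (simp add: mult.assoc)
  qed
qed (auto simp: W_def R_J R_S R_add R_scale S_add S_scale)

lemma W_isomorphic: "isomorphic_to_J jt_norm W"
  unfolding isomorphic_to_J_def
proof (intro exI[of _ S] conjI ballI allI)
  show "bij_betw S J_space W"
    unfolding bij_betw_def W_def by (auto intro!: inj_on_inverseI[of _ R] R_S)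
  show "\<exists>c>0. \<exists>C>0. \<forall>a\<in>J_space. c * j_norm a \<le> jt_norm (S a) \<and> jt_norm (S a) \<le> C * j_norm a"
  proof -
    have "1 / D * j_norm a \<le> jt_norm (S a)" if a: "a \<in> J_space" for a
      using R_le[OF S_JT[OF a]] R_S[OF a] D by (simp add: field_simps)
    moreover have "0 < 1 / D" using D by simp
    ultimately show ?thesis using C jt_norm_S_le by blast
  qed
qed (auto simp: S_add S_scale)

lemma y_equiv_J_basis: "equiv_J_basis jt_norm y"
  unfolding equiv_J_basis_def J_blk_0[symmetric] Sn_def[symmetric]
proof (intro exI[of _ "C + D"] conjI allI)
  fix m a
  have 0: "0 \<le> j_norm (J.blk 0 m a)" "0 \<le> jt_norm (Sn m a)"
    by (auto intro: J.nrm_nonneg JT.nrm_nonneg J_blk_in_J Sn_JT)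
  have "j_norm (J.blk 0 m a) \<le> D * jt_norm (Sn m a)"
    using R_le[OF Sn_JT, of m a] R_Sn by simp
  then show "j_norm (J.blk 0 m a) \<le> (C + D) * jt_norm (Sn m a)"
    using 0 C by (simp add: distrib_right add_increasing)
  show "jt_norm (Sn m a) \<le> (C + D) * j_norm (J.blk 0 m a)"
    using jt_norm_Sn_le[of m a] 0 D by (simp add: distrib_right add_increasing2)
qed (use C D in auto)

end

text \<open>\<open>G\<close> sends \<open>y k\<close> to the \<open>k\<close>-th unit vector plus
  \<open>\<eta> k\<close>, so on coefficients it acts as the identity plus \<open>E\<close>.
  Coefficients are bounded by the norm and the numbers \<open>(1/2)^(k+2)\<close> add up to 1/2, so
  the Neumann series gives \<open>H\<close>. The left inverse is \<open>H \<circ> G\<close>, of norm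
  at most \<open>2 * D\<close>.\<close>

lemma J_system_perturbation:
  assumes y_JT: "\<And>k. y k \<in> JT" and C: "0 < C" and D: "0 < D"
    and upper: "\<And>m a. jt_norm (\<lambda>t. \<Sum>k<m. a k * y k t) \<le> C * j_norm (J.blk 0 m a)"
    and G_J: "\<And>x. x \<in> JT \<Longrightarrow> G x \<in> J_space"
    and G_le: "\<And>x. x \<in> JT \<Longrightarrow> j_norm (G x) \<le> D * jt_norm x"
    and G_add: "\<And>x x'. x \<in> JT \<Longrightarrow> x' \<in> JT \<Longrightarrow> G (\<lambda>t. x t + x' t) = (\<lambda>k. G x k + G x' k)"
    and G_scale: "\<And>x c. x \<in> JT \<Longrightarrow> G (\<lambda>t. c * x t) = (\<lambda>k. c * G x k)"
    and eta: "\<And>k. j_norm (\<lambda>i. G (y k) i - (if i = k then 1 else 0)) \<le> (1/2)^(k+2)"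
  shows "\<exists>R C D. J_system y R C D"
proof -
  define \<eta> where "\<eta> k = (\<lambda>i. G (y k) i - (if i = k then 1 else 0))" for k
  have \<eta>_J: "\<eta> k \<in> J_space" for k
    unfolding \<eta>_def by (rule J.diff_X[OF G_J[OF y_JT] J.single_X])
  have \<eta>_le: "j_norm (\<eta> k) \<le> (1/2)^(k+2)" for k using eta by (simp add: \<eta>_def)
  define E where "E a = (\<lambda>i. \<Sum>k. a k * \<eta> k i)" for a :: "nat \<Rightarrow> real"
  have summ: "summable (\<lambda>k. a k * \<eta> k i)" if a: "a \<in> J_space" for a i
  proof (rule summable_comparison_test'[where g="\<lambda>k. j_norm a * (1/2)^(k+2)"])
    show "summable (\<lambda>k. j_norm a * (1/2)^(k+2))"
      by (intro summable_mult summable_ignore_initial_segment summable_geometric) simp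
    have "\<bar>\<eta> k i\<bar> \<le> (1/2)^(k+2)" for k using J.abs_le_nrm[OF \<eta>_J, of k i] \<eta>_le[of k] by linarith
    then show "norm (a k * \<eta> k i) \<le> j_norm a * (1/2)^(k+2)" for k
      unfolding real_norm_def abs_mult
      by (intro mult_mono J.abs_le_nrm a J.nrm_nonneg) auto
  qed
  have E_le: "E a \<in> J_space \<and> j_norm (E a) \<le> j_norm a / 2" if a: "a \<in> J_space" for a
  proof -
    have lim: "(\<lambda>n. \<Sum>k<n. a k * \<eta> k i) \<longlonglongrightarrow> E a i" for i
      unfolding E_def by (rule summable_LIMSEQ[OF summ[OF a]])
    have "j_norm (\<lambda>i. \<Sum>k<n. a k * \<eta> k i) \<le> j_norm a / 2" for n
    proof -
      have "j_norm (\<lambda>i. \<Sum>k<n. a k * \<eta> k i) \<le> (\<Sum>k<n. \<bar>a k\<bar> * j_norm (\<eta> k))"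
        by (rule J.nrm_sum_le) (use \<eta>_J in auto)
      also have "\<dots> \<le> (\<Sum>k<n. j_norm a * (1/2)^(k+2))"
        by (intro sum_mono mult_mono J.abs_le_nrm a J.nrm_nonneg \<eta>_le \<eta>_J)
      also have "\<dots> = j_norm a / 4 * (\<Sum>k<n. (1/2)^k)"
        by (simp add: sum_distrib_left power_add mult_ac)
      also have "\<dots> \<le> j_norm a / 4 * 2"
        using J.nrm_nonneg[OF a] by (intro mult_left_mono) (auto simp: sum_gp_strict)
      finally show ?thesis by simp
    qed
    moreover have "(\<lambda>i. \<Sum>k<n. a k * \<eta> k i) \<in> J_space" for n
      by (rule J.sum_X) (use \<eta>_J in auto)
    ultimately show ?thesis
      using J.lim_X[of "\<lambda>n i. \<Sum>k<n. a k * \<eta> k i" "E a" "j_norm a / 2", OF lim]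
        J.nrm_lim_le[of "\<lambda>n i. \<Sum>k<n. a k * \<eta> k i" "E a" "j_norm a / 2", OF lim]
      by (simp add: always_eventually)
  qed
  obtain H where H_J: "\<And>b. b \<in> J_space \<Longrightarrow> H b \<in> J_space"
    and H_le: "\<And>b. b \<in> J_space \<Longrightarrow> j_norm (H b) \<le> 2 * j_norm b"
    and H_add: "\<And>a b. a \<in> J_space \<Longrightarrow> b \<in> J_space \<Longrightarrow> H (\<lambda>i. a i + b i) = (\<lambda>i. H a i + H b i)"
    and H_scale: "\<And>a c. a \<in> J_space \<Longrightarrow> H (\<lambda>i. c * a i) = (\<lambda>i. c * H a i)"
    and H_E: "\<And>b. b \<in> J_space \<Longrightarrow> H (\<lambda>i. b i + E b i) = b"
  proof (rule J.neumann_left_inverse[of E])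
    show "E (\<lambda>i. a i + b i) = (\<lambda>i. E a i + E b i)" if "a \<in> J_space" "b \<in> J_space" for a b
      unfolding E_def using suminf_add[OF summ summ, OF that] by (simp add: algebra_simps)
    show "E (\<lambda>i. c * a i) = (\<lambda>i. c * E a i)" if "a \<in> J_space" for a c
      unfolding E_def using suminf_mult[OF summ[OF that]] by (simp add: algebra_simps)
  qed (use E_le in auto)
  have "J_system y (\<lambda>x. H (G x)) C (2 * D)"
  proof
    show "j_norm (H (G x)) \<le> 2 * D * jt_norm x" if x: "x \<in> JT" for x
      using H_le[OF G_J[OF x]] G_le[OF x] by simp
    show "H (G (y k)) = (\<lambda>i. if i = k then 1 else 0)" for k
    proof -
      define e where "e = (\<lambda>i. if i = k then 1 else (0::real))"
      have "(\<lambda>j. e j * \<eta> j i) sums (\<Sum>j\<in>{k}. e j * \<eta> j i)" for i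
        by (rule sums_finite) (auto simp: e_def)
      then have "E e = \<eta> k" by (simp add: E_def e_def sums_iff fun_eq_iff)
      then have "G (y k) = (\<lambda>i. e i + E e i)" by (simp add: \<eta>_def e_def fun_eq_iff)
      moreover have "e \<in> J_space" unfolding e_def by (rule J.single_X)
      ultimately show ?thesis using H_E by (simp add: e_def)
    qed
  qed (use assms H_J H_add H_scale in auto)
  then show ?thesis by blast
qed

section \<open>Branches\<close>

definition nd :: "(nat \<Rightarrow> bool) \<Rightarrow> nat \<Rightarrow> bool list" where
  "nd \<gamma> k = map \<gamma> [0..<k]"

definition bsum :: "(nat \<Rightarrow> bool) \<Rightarrow> (bool list \<Rightarrow> real) \<Rightarrow> real" where
  "bsum \<gamma> y = (\<Sum>k. y (nd \<gamma> k))"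

section \<open>Nodes on a branch and segments of the tree\<close>

lemma nth_prefix: "prefix xs ys \<Longrightarrow> i < length xs \<Longrightarrow> xs ! i = ys ! i"
  by (auto simp: prefix_def nth_append)

lemma length_nd [simp]: "length (nd \<gamma> k) = k"
  by (simp add: nd_def)

lemma nd_Suc: "nd \<gamma> (Suc k) = nd \<gamma> k @ [\<gamma> k]"
  by (simp add: nd_def)

lemma take_nd: "i \<le> j \<Longrightarrow> take i (nd \<gamma> j) = nd \<gamma> i"
  by (simp add: nd_def take_map)

lemma prefix_nd: "i \<le> j \<Longrightarrow> prefix (nd \<gamma> i) (nd \<gamma> j)"
  by (metis take_nd take_is_prefix)

lemma prefix_nd_iff: "prefix t (nd \<gamma> k) \<longleftrightarrow> length t \<le> k \<and> t = nd \<gamma> (length t)"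
  by (metis length_nd prefix_length_le prefix_nd take_nd append_eq_conv_conj prefix_def)

lemma inj_nd: "inj (nd \<gamma>)"
  by (metis injI length_nd)

lemma nd_eq_mono: "nd \<gamma> j = nd \<gamma>' j \<Longrightarrow> i \<le> j \<Longrightarrow> nd \<gamma> i = nd \<gamma>' i"
  by (metis take_nd)

lemma nd_eqD: "nd \<gamma> j = nd \<gamma>' j \<Longrightarrow> i < j \<Longrightarrow> \<gamma> i = \<gamma>' i"
  by (simp add: nd_def)

lemma nd_extends: "\<exists>\<gamma>. nd \<gamma> (length t) = t"
  by (rule exI[of _ "\<lambda>k. t ! k"]) (simp add: nd_def map_nth)

text \<open>Beyond the largest first disagreement the branches run through different nodes, so their
  tails are disjoint segments. Square-sum bounds over finitely many branches rest on this.\<close>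

lemma nd_separated:
  assumes "finite S"
  shows "\<exists>L. \<forall>\<gamma>\<in>S. \<forall>\<gamma>'\<in>S. \<forall>l\<ge>L. nd \<gamma> l = nd \<gamma>' l \<longrightarrow> \<gamma> = \<gamma>'"
proof -
  define d where "d p = (LEAST i. fst p i \<noteq> snd p i)" for p :: "(nat \<Rightarrow> bool) \<times> (nat \<Rightarrow> bool)"
  have "finite (d ` (S \<times> S))" using assms by simp
  then obtain L where L: "\<And>p. p \<in> S \<times> S \<Longrightarrow> d p < L"
    by (metis finite_nat_set_iff_bounded imageI)
  have "\<gamma> = \<gamma>'" if "\<gamma> \<in> S" "\<gamma>' \<in> S" "L \<le> l" "nd \<gamma> l = nd \<gamma>' l" for \<gamma> \<gamma>' l
  proof (rule ccontr)
    assume "\<gamma> \<noteq> \<gamma>'"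
    then have "\<exists>i. \<gamma> i \<noteq> \<gamma>' i" by auto
    then have "\<gamma> (d (\<gamma>, \<gamma>')) \<noteq> \<gamma>' (d (\<gamma>, \<gamma>'))" unfolding d_def fst_conv snd_conv by (rule LeastI_ex)
    moreover have "d (\<gamma>, \<gamma>') < l" using L[of "(\<gamma>, \<gamma>')"] that by auto
    ultimately show False using nd_eqD[OF that(4)] by blast
  qed
  then show ?thesis by blast
qed

lemma jt_seg_nd: "jt_seg (nd \<gamma> ` {i..<j})"
  unfolding jt_seg_def tree_segment_def
proof (intro conjI ballI allI impI)
  fix u v assume "u \<in> nd \<gamma> ` {i..<j}" "v \<in> nd \<gamma> ` {i..<j}"
  then obtain k l where "u = nd \<gamma> k" "v = nd \<gamma> l" by blast
  then show "prefix u v \<or> prefix v u" using prefix_nd nat_le_linear by blast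
next
  fix u w v assume "u \<in> nd \<gamma> ` {i..<j}" "w \<in> nd \<gamma> ` {i..<j}" "prefix u v \<and> prefix v w"
  then obtain k l where kl: "u = nd \<gamma> k" "w = nd \<gamma> l" "i \<le> k" "l < j" "prefix u v" "prefix v w" by auto
  then have "v = nd \<gamma> (length v)" "length v \<le> l" "k \<le> length v"
    using prefix_nd_iff prefix_length_le length_nd by metis+
  then show "v \<in> nd \<gamma> ` {i..<j}" using kl by auto
qed simp

text \<open>All nodes of \<open>s\<close> are prefixes of a longest one, so any branch through that
  node contains \<open>s\<close>; convexity fills in the levels between the ends.\<close>

lemma jt_seg_obtain:
  assumes s: "jt_seg s" and ne: "s \<noteq> {}"
  obtains \<gamma> i j where "s = nd \<gamma> ` {i..<j}" "i < j"
proof -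
  have fin: "finite s" and comp: "\<And>u v. u \<in> s \<Longrightarrow> v \<in> s \<Longrightarrow> prefix u v \<or> prefix v u"
    and conv: "\<And>u v w. u \<in> s \<Longrightarrow> w \<in> s \<Longrightarrow> prefix u v \<Longrightarrow> prefix v w \<Longrightarrow> v \<in> s"
    using s unfolding jt_seg_def tree_segment_def by blast+
  have "Max (length ` s) \<in> length ` s" "Min (length ` s) \<in> length ` s" using fin ne by auto
  then obtain w u where w: "w \<in> s" "length w = Max (length ` s)" and u: "u \<in> s" "length u = Min (length ` s)"
    by auto
  obtain \<gamma> where \<gamma>: "nd \<gamma> (length w) = w" using nd_extends by blast
  have on: "v = nd \<gamma> (length v) \<and> length u \<le> length v \<and> length v \<le> length w" if v: "v \<in> s" for v
  proof -
    have le: "length v \<le> length w" "length u \<le> length v" using v fin w(2) u(2) by auto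
    have "prefix v w"
      using comp[OF v w(1)] le(1) by (metis prefix_length_le prefix_length_prefix prefix_order.refl)
    then show ?thesis using le \<gamma> prefix_nd_iff by metis
  qed
  have "s = nd \<gamma> ` {length u..<Suc (length w)}"
  proof
    show "s \<subseteq> nd \<gamma> ` {length u..<Suc (length w)}"
    proof
      fix v assume "v \<in> s"
      then show "v \<in> nd \<gamma> ` {length u..<Suc (length w)}"
        using on[of v] by (intro image_eqI[of _ _ "length v"]) auto
    qed
    show "nd \<gamma> ` {length u..<Suc (length w)} \<subseteq> s"
    proof
      fix v assume "v \<in> nd \<gamma> ` {length u..<Suc (length w)}"
      then obtain k where k: "v = nd \<gamma> k" "length u \<le> k" "k \<le> length w" by auto
      have "prefix u v" using on[OF u(1)] k by (metis prefix_nd)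
      moreover have "prefix v w" using k \<gamma> by (metis prefix_nd)
      ultimately show "v \<in> s" using conv u(1) w(1) by blast
    qed
  qed
  moreover have "length u < Suc (length w)" using on[OF u(1)] by simp
  ultimately show ?thesis using that by blast
qed

lemma sum_nd_image: "(\<Sum>t\<in>nd \<gamma> ` A. x t) = (\<Sum>k\<in>A. x (nd \<gamma> k))"
  by (rule sum.reindex_cong[OF inj_on_subset[OF inj_nd]]) auto

lemma abs_sum_nd_le: "x \<in> JT \<Longrightarrow> \<bar>\<Sum>k=i..<j. x (nd \<gamma> k)\<bar> \<le> jt_norm x"
  using JT.abs_seg_sum_le[OF _ jt_seg_nd[of \<gamma> i j], of x] by (simp add: sum_nd_image)

text \<open>A sum over levels from \<open>m\<close> on sees only the tail of \<open>x\<close>, whose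
  norm is small. The convergence need not be absolute.\<close>

lemma summable_nd: assumes x: "x \<in> JT" shows "summable (\<lambda>k. x (nd \<gamma> k))"
  unfolding summable_Cauchy
proof (intro allI impI)
  fix e :: real assume e: "0 < e"
  then obtain N where N: "\<And>m. N \<le> m \<Longrightarrow> jt_norm (JT.tail m x) \<le> e / 2"
    using JT.nrm_tail_small[OF x, of "e/2"] by auto
  have "norm (\<Sum>k=m..<n. x (nd \<gamma> k)) < e" if "N \<le> m" for m n
  proof -
    have "(\<Sum>k=m..<n. x (nd \<gamma> k)) = (\<Sum>k=m..<n. JT.tail m x (nd \<gamma> k))"
      by (rule sum.cong) (auto simp: JT.tail_def)
    then show ?thesis
      using abs_sum_nd_le[OF JT.tail_X[OF x], where \<gamma>=\<gamma> and i=m and j=n, of m] N[OF that] e by simp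
  qed
  then show "\<exists>N. \<forall>m\<ge>N. \<forall>n. norm (\<Sum>k=m..<n. x (nd \<gamma> k)) < e" by blast
qed

lemma bsum_LIMSEQ: "x \<in> JT \<Longrightarrow> (\<lambda>n. \<Sum>k<n. x (nd \<gamma> k)) \<longlonglongrightarrow> bsum \<gamma> x"
  unfolding bsum_def by (rule summable_LIMSEQ[OF summable_nd])

lemma abs_bsum_le: assumes "x \<in> JT" shows "\<bar>bsum \<gamma> x\<bar> \<le> jt_norm x"
proof (rule tendsto_upperbound[OF tendsto_rabs[OF bsum_LIMSEQ[OF assms]]])
  show "\<forall>\<^sub>F n in sequentially. \<bar>\<Sum>k<n. x (nd \<gamma> k)\<bar> \<le> jt_norm x"
    using abs_sum_nd_le[OF assms, where \<gamma>=\<gamma> and i=0] by (auto simp: atLeast0LessThan)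
qed simp

lemma bsum_add: "x \<in> JT \<Longrightarrow> y \<in> JT \<Longrightarrow> bsum \<gamma> (\<lambda>t. x t + y t) = bsum \<gamma> x + bsum \<gamma> y"
  unfolding bsum_def by (rule suminf_add[symmetric]) (rule summable_nd, assumption)+

lemma bsum_diff: "x \<in> JT \<Longrightarrow> y \<in> JT \<Longrightarrow> bsum \<gamma> (\<lambda>t. x t - y t) = bsum \<gamma> x - bsum \<gamma> y"
  unfolding bsum_def by (rule suminf_diff[symmetric]) (rule summable_nd, assumption)+

lemma bsum_scale: "x \<in> JT \<Longrightarrow> bsum \<gamma> (\<lambda>t. c * x t) = c * bsum \<gamma> x"
  unfolding bsum_def by (rule suminf_mult) (rule summable_nd)

lemma bsum_blk: "bsum \<gamma> (JT.blk l m x) = (\<Sum>k=l..<m. x (nd \<gamma> k))"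
proof -
  have "(\<lambda>k. JT.blk l m x (nd \<gamma> k)) sums (\<Sum>k=l..<m. JT.blk l m x (nd \<gamma> k))"
    by (rule sums_finite) (auto simp: JT.blk_def)
  moreover have "(\<Sum>k=l..<m. JT.blk l m x (nd \<gamma> k)) = (\<Sum>k=l..<m. x (nd \<gamma> k))"
    by (rule sum.cong) (auto simp: JT.blk_def)
  ultimately show ?thesis by (simp add: bsum_def sums_iff)
qed

text \<open>Branches through different nodes at level \<open>L\<close> never meet again, so their
  parts beyond \<open>L\<close> form a disjoint family of segments.\<close>

lemma sum_bsum_tail_le:
  assumes x: "x \<in> JT" and S: "finite S"
    and sep: "\<And>i j. i \<in> S \<Longrightarrow> j \<in> S \<Longrightarrow> nd (g i) L = nd (g j) L \<Longrightarrow> i = j"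
  shows "(\<Sum>i\<in>S. (bsum (g i) (JT.tail L x))\<^sup>2) \<le> (jt_norm x)\<^sup>2"
proof (rule tendsto_upperbound)
  show "(\<lambda>n. \<Sum>i\<in>S. (\<Sum>k<n. JT.tail L x (nd (g i) k))\<^sup>2) \<longlonglongrightarrow> (\<Sum>i\<in>S. (bsum (g i) (JT.tail L x))\<^sup>2)"
    by (intro tendsto_sum tendsto_power bsum_LIMSEQ JT.tail_X x)
  have "(\<Sum>i\<in>S. (\<Sum>k<n. JT.tail L x (nd (g i) k))\<^sup>2) \<le> (jt_norm x)\<^sup>2" for n
  proof -
    have "(\<Sum>k<n. JT.tail L x (nd (g i) k)) = (\<Sum>t\<in>nd (g i) ` {L..<n}. x t)" for i
      unfolding sum_nd_image by (rule sum.mono_neutral_cong_right) (auto simp: JT.tail_def)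
    moreover have "(\<Sum>i\<in>S. (\<Sum>t\<in>nd (g i) ` {L..<n}. x t)\<^sup>2) \<le> (jt_norm x)\<^sup>2"
    proof (rule JT.sum_family_le[OF S jt_seg_nd _ x])
      fix i j assume ij: "i \<in> S" "j \<in> S" "i \<noteq> j"
      show "nd (g i) ` {L..<n} \<inter> nd (g j) ` {L..<n} = {}"
      proof (rule ccontr)
        assume "nd (g i) ` {L..<n} \<inter> nd (g j) ` {L..<n} \<noteq> {}"
        then obtain k k' where k: "nd (g i) k = nd (g j) k'" "L \<le> k" by auto
        then have "k = k'" by (metis length_nd)
        then show False using sep[OF ij(1,2)] nd_eq_mono k ij(3) by metis
      qed
    qed
    ultimately show ?thesis by simp
  qed
  then show "\<forall>\<^sub>F n in sequentially. (\<Sum>i\<in>S. (\<Sum>k<n. JT.tail L x (nd (g i) k))\<^sup>2) \<le> (jt_norm x)\<^sup>2"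
    by simp
qed simp

lemma bsum_tail: "x \<in> JT \<Longrightarrow> bsum \<gamma> (JT.tail L x) = bsum \<gamma> x - bsum \<gamma> (JT.blk 0 L x)"
proof -
  assume x: "x \<in> JT"
  have "JT.tail L x = (\<lambda>t. x t - JT.blk 0 L x t)" by (auto simp: JT.tail_def JT.blk_def)
  then show ?thesis using bsum_diff[OF x JT.blk_X[OF x]] by simp
qed

section \<open>Subsequences with convergent branch sums\<close>

lemma diagonal_convergent:
  fixes f :: "nat \<Rightarrow> 'i::countable \<Rightarrow> real"
  assumes bd: "\<And>n i. \<bar>f n i\<bar> \<le> B i"
  obtains r where "strict_mono r" "\<And>i. convergent (\<lambda>n. f (r n) i)"
proof -
  define P where "P k s \<longleftrightarrow> convergent (\<lambda>n. f (s n) (from_nat k))" for k and s :: "nat \<Rightarrow> nat"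
  interpret subseqs P
  proof
    fix k and s :: "nat \<Rightarrow> nat" assume "strict_mono s"
    have "bounded (range (\<lambda>n. f (s n) (from_nat k)))"
      using bd by (auto simp: bounded_iff)
    then obtain l r where "strict_mono r" "((\<lambda>n. f (s n) (from_nat k)) \<circ> r) \<longlonglongrightarrow> l"
      using bounded_imp_convergent_subsequence by blast
    then show "\<exists>r'. strict_mono r' \<and> P k (s \<circ> r')"
      unfolding P_def by (auto simp: convergent_def o_def)
  qed
  have "convergent (\<lambda>n. f (diagseq n) i)" for i
  proof -
    have "P (to_nat i) (diagseq \<circ> ((+) (Suc (to_nat i))))"
    proof (rule diagseq_holds)
      fix r s :: "nat \<Rightarrow> nat" and n assume "strict_mono r" "P n s"
      then show "P n (s \<circ> r)"
        using convergent_subseq_convergent[of "\<lambda>m. f (s m) (from_nat n)" r] by (simp add: P_def o_def)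
    qed
    then show ?thesis
      using convergent_ignore_initial_segment[of "\<lambda>n. f (diagseq n) i" "Suc (to_nat i)"]
      unfolding P_def by (simp add: o_def add.commute)
  qed
  then show ?thesis using that subseq_diagseq by blast
qed

text \<open>Lets the diagonal argument settle countably many yes-no questions.\<close>

lemma convergent_zero_one_eventually_const:
  assumes "convergent (\<lambda>n. of_bool (p n) :: real)"
  shows "\<exists>b. \<forall>\<^sub>F n in sequentially. p n = b"
proof -
  obtain l where "(\<lambda>n. of_bool (p n) :: real) \<longlonglongrightarrow> l" using assms by (auto simp: convergent_def)
  from tendstoD[OF this, of "1/2"] have ev: "\<forall>\<^sub>F n in sequentially. dist (of_bool (p n)) l < 1/2" by simp
  show ?thesis
  proof (intro exI[of _ "l > 1/2"])
    show "\<forall>\<^sub>F n in sequentially. p n = (l > 1/2)"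
      using ev by eventually_elim (auto simp: dist_real_def of_bool_def abs_if split: if_splits)
  qed
qed

text \<open>Along a suitable subsequence the branches on which the sums are not small cluster, for every
  scale \<open>2\<^sup>-\<^sup>j\<close>, at finitely many branches only: at every level few nodes carry large sums,
  because such sums live on disjoint segments.\<close>

lemma big_branches:
  assumes u_JT: "\<And>n. u n \<in> JT" and u_le: "\<And>n. jt_norm (u n) \<le> M"
    and u_0: "\<And>t. (\<lambda>n. u n t) \<longlonglongrightarrow> 0"
  obtains r Br where "strict_mono (r :: nat \<Rightarrow> nat)" "\<And>j::nat. finite (Br j)"
    "\<And>j \<gamma>. \<gamma> \<notin> Br j \<Longrightarrow> \<forall>\<^sub>F n in sequentially. \<bar>bsum \<gamma> (u (r n))\<bar> < (1/2)^j"
    "\<And>j L. \<forall>\<^sub>F n in sequentially. \<forall>\<gamma>. (1/2)^j \<le> \<bar>bsum \<gamma> (u (r n))\<bar> \<longrightarrow> (\<exists>\<beta>\<in>Br j. nd \<gamma> L = nd \<beta> L)"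
proof -
  define big where "big n j t \<longleftrightarrow> (\<exists>\<gamma>. nd \<gamma> (length t) = t \<and> (1/2)^j \<le> \<bar>bsum \<gamma> (u n)\<bar>)" for n j t
  obtain r where r: "strict_mono r"
    and conv: "\<And>p. convergent (\<lambda>n. of_bool (big (r n) (fst p) (snd p)) :: real)"
    by (rule diagonal_convergent[of "\<lambda>n p. of_bool (big n (fst p) (snd p))" "\<lambda>_. 1"]) auto
  have "\<exists>b. \<forall>\<^sub>F n in sequentially. big (r n) j t = b" for j t
    using convergent_zero_one_eventually_const[OF conv[of "(j, t)"]] by simp
  then obtain A where A: "\<And>j t. \<forall>\<^sub>F n in sequentially. big (r n) j t = A j t" by metis
  \<comment> \<open>\<open>A j\<close> is a tree of nodes that are eventually always, or eventually
    never, on a branch with large sum; \<open>Br j\<close> consists of its infinite paths.\<close>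
  define Br where "Br j = {\<gamma>. \<forall>L. A j (nd \<gamma> L)}" for j
  have down: "A j (take i t)" if t: "A j t" for j t i
  proof -
    have "\<forall>\<^sub>F n in sequentially. A j (take i t)"
      using A[of j t] A[of j "take i t"]
    proof eventually_elim
      case (elim n)
      then obtain \<gamma> where "nd \<gamma> (length t) = t" "(1/2)^j \<le> \<bar>bsum \<gamma> (u (r n))\<bar>"
        using t by (auto simp: big_def)
      moreover from this have "nd \<gamma> (length (take i t)) = take i t"
        by (metis length_take min.cobounded1 take_nd take_take min.idem take_all_iff linorder_linear min_def)
      ultimately show ?case using elim unfolding big_def by blast
    qed
    then show ?thesis by simp
  qed
  \<comment> \<open>The branch witnessing \<open>big\<close> at \<open>t\<close> passes through a
    child of \<open>t\<close> and witnesses \<open>big\<close> there as well. So \<open>A j\<close>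
    has no dead ends, and each of its nodes lies on a path in \<open>Br j\<close>.\<close>
  have up: "\<exists>b. A j (t @ [b])" if t: "A j t" for j t
  proof -
    have "\<forall>\<^sub>F n in sequentially. \<exists>b. A j (t @ [b])"
      using A[of j t] A[of j "t @ [True]"] A[of j "t @ [False]"]
    proof eventually_elim
      case (elim n)
      then obtain \<gamma> where \<gamma>: "nd \<gamma> (length t) = t" "(1/2)^j \<le> \<bar>bsum \<gamma> (u (r n))\<bar>"
        using t by (auto simp: big_def)
      then have "nd \<gamma> (length (t @ [\<gamma> (length t)])) = t @ [\<gamma> (length t)]"
        by (simp add: nd_Suc)
      then have "big (r n) j (t @ [\<gamma> (length t)])" using \<gamma>(2) unfolding big_def by blast
      then show ?case using elim by (cases "\<gamma> (length t)") auto
    qed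
    then show ?thesis by simp
  qed
  have extend: "\<exists>\<beta>\<in>Br j. nd \<beta> (length t) = t" if t: "A j t" for j t
  proof -
    define f where "f = rec_nat t (\<lambda>_ s. s @ [SOME b. A j (s @ [b])])"
    have f0: "f 0 = t" and fS: "f (Suc k) = f k @ [SOME b. A j (f k @ [b])]" for k
      by (simp_all add: f_def)
    have fA: "A j (f k)" for k
    proof (induction k)
      case (Suc k) show ?case unfolding fS by (rule someI_ex[OF up[OF Suc]])
    qed (simp add: f0 t)
    have len: "length (f k) = length t + k" for k by (induction k) (auto simp: f0 fS)
    define \<beta> where "\<beta> i = f (Suc i) ! i" for i
    have pre: "prefix (f k) (f (k + l))" for k l
      by (induction l) (auto simp: fS intro: prefix_order.trans)
    have nth: "f k ! i = \<beta> i" if "i < length t + k" for k i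
    proof -
      have "prefix (f k) (f (k + Suc i))" "prefix (f (Suc i)) (f (k + Suc i))"
        using pre[of k "Suc i"] pre[of "Suc i" k] by (simp_all add: add.commute)
      then have "f k ! i = f (k + Suc i) ! i" "f (Suc i) ! i = f (k + Suc i) ! i"
        using that len by (simp_all add: nth_prefix)
      then show ?thesis by (simp add: \<beta>_def)
    qed
    have nd: "nd \<beta> (length t + k) = f k" for k
      by (rule nth_equalityI) (auto simp: len nd_def nth)
    have "A j (nd \<beta> L)" for L
    proof -
      have "take L (nd \<beta> (length t + L)) = nd \<beta> L" by (rule take_nd) simp
      then show ?thesis using down[OF fA[of L], of L] nd[of L] by simp
    qed
    then show ?thesis using nd[of 0] f0 by (auto simp: Br_def)
  qed
  have "finite (Br j)" for j
  proof (rule ccontr)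
    assume inf: "infinite (Br j)"
    \<comment> \<open>Each of \<open>K\<close> disjoint tails has a sum of at least half of
      \<open>(1/2)^j\<close>, the other half being granted to the head below \<open>L\<close>. Hence
      \<open>K\<close> times \<open>(1/4)^j / 4\<close> is at most \<open>M\<^sup>2\<close>, which
      this \<open>K\<close> violates.\<close>
    define K where "K = Suc (nat \<lceil>4 * 4^j * M\<^sup>2\<rceil>)"
    obtain S where S: "S \<subseteq> Br j" "finite S" "card S = K"
      using infinite_arbitrarily_large[OF inf] by blast
    obtain L where L: "\<And>\<gamma> \<gamma>'. \<gamma> \<in> S \<Longrightarrow> \<gamma>' \<in> S \<Longrightarrow> nd \<gamma> L = nd \<gamma>' L \<Longrightarrow> \<gamma> = \<gamma>'"
      using nd_separated[OF S(2)] by blast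
    have "\<forall>\<^sub>F n in sequentially. \<forall>\<gamma>\<in>S. big (r n) j (nd \<gamma> L) = A j (nd \<gamma> L)"
      using S(2) A by (simp add: eventually_ball_finite)
    moreover have "(\<lambda>n. jt_norm (JT.blk 0 L (u (r n)))) \<longlonglongrightarrow> 0"
      using LIMSEQ_subseq_LIMSEQ[OF JT.nrm_head_tendsto_0[of u L, OF u_0] r] by (simp add: o_def)
    then have "\<forall>\<^sub>F n in sequentially. jt_norm (JT.blk 0 L (u (r n))) < (1/2)^j / 2"
      by (rule order_tendstoD) simp
    ultimately have "\<forall>\<^sub>F n in sequentially. False"
    proof eventually_elim
      case (elim n)
      have "\<forall>\<gamma>\<in>S. \<exists>\<delta>. nd \<delta> L = nd \<gamma> L \<and> (1/2)^j \<le> \<bar>bsum \<delta> (u (r n))\<bar>"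
        using elim(1) S(1) by (auto simp: big_def Br_def)
      then obtain \<delta> where \<delta>: "\<And>\<gamma>. \<gamma> \<in> S \<Longrightarrow> nd (\<delta> \<gamma>) L = nd \<gamma> L"
        "\<And>\<gamma>. \<gamma> \<in> S \<Longrightarrow> (1/2)^j \<le> \<bar>bsum (\<delta> \<gamma>) (u (r n))\<bar>" by metis
      have ge: "(1/4)^j / 4 \<le> (bsum (\<delta> \<gamma>) (JT.tail L (u (r n))))\<^sup>2" if "\<gamma> \<in> S" for \<gamma>
      proof -
        have "\<bar>bsum (\<delta> \<gamma>) (JT.blk 0 L (u (r n)))\<bar> < (1/2)^j / 2"
          using abs_bsum_le[OF JT.blk_X[OF u_JT]] elim(2) by (meson le_less_trans)
        then have "(1/2)^j / 2 \<le> \<bar>bsum (\<delta> \<gamma>) (JT.tail L (u (r n)))\<bar>"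
          using \<delta>(2)[OF that] unfolding bsum_tail[OF u_JT] by linarith
        then have "((1/2)^j / 2)\<^sup>2 \<le> \<bar>bsum (\<delta> \<gamma>) (JT.tail L (u (r n)))\<bar>\<^sup>2"
          by (intro power_mono) auto
        moreover have "((1/2)^j / 2)\<^sup>2 = ((1/4)^j / 4 :: real)"
          by (simp add: power_divide power2_eq_square flip: power_mult_distrib)
        ultimately show ?thesis by simp
      qed
      have "real K * ((1/4)^j / 4) \<le> (\<Sum>\<gamma>\<in>S. (bsum (\<delta> \<gamma>) (JT.tail L (u (r n))))\<^sup>2)"
        using sum_mono[of S "\<lambda>_. (1/4)^j / 4", OF ge] S(3) by simp
      also have "\<dots> \<le> (jt_norm (u (r n)))\<^sup>2"
        by (rule sum_bsum_tail_le[OF u_JT S(2)]) (use L \<delta>(1) in metis)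
      also have "\<dots> \<le> M\<^sup>2" using u_le JT.nrm_nonneg[OF u_JT] by (intro power_mono) auto
      finally have "real K \<le> 4 * 4^j * M\<^sup>2" by (simp add: field_simps power_divide)
      moreover have "4 * 4^j * M\<^sup>2 < real K" unfolding K_def by linarith
      ultimately show False by linarith
    qed
    then show False by simp
  qed
  moreover have "\<forall>\<^sub>F n in sequentially. \<bar>bsum \<gamma> (u (r n))\<bar> < (1/2)^j" if out: "\<gamma> \<notin> Br j" for \<gamma> j
  proof -
    obtain L where L: "\<not> A j (nd \<gamma> L)" using out by (auto simp: Br_def)
    show ?thesis using A[of j "nd \<gamma> L"]
    proof eventually_elim
      case (elim n)
      then have "\<not> big (r n) j (nd \<gamma> L)" using L by simp
      then show ?case unfolding big_def by (auto simp: not_le)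
    qed
  qed
  moreover have "\<forall>\<^sub>F n in sequentially. \<forall>\<gamma>. (1/2)^j \<le> \<bar>bsum \<gamma> (u (r n))\<bar> \<longrightarrow> (\<exists>\<beta>\<in>Br j. nd \<gamma> L = nd \<beta> L)" for j L
  proof -
    have "finite {t::bool list. length t < Suc L}" by (rule JT.finite_lev)
    then have "\<forall>\<^sub>F n in sequentially. \<forall>t\<in>{t. length t < Suc L}. big (r n) j t = A j t"
      using A by (intro eventually_ball_finite ballI) auto
    then show ?thesis
    proof eventually_elim
      case (elim n)
      show ?case
      proof (intro allI impI)
        fix \<gamma> assume "(1/2)^j \<le> \<bar>bsum \<gamma> (u (r n))\<bar>"
        then have "big (r n) j (nd \<gamma> L)" unfolding big_def by auto
        then have "A j (nd \<gamma> L)" using elim by simp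
        from extend[OF this] show "\<exists>\<beta>\<in>Br j. nd \<gamma> L = nd \<beta> L" by (metis length_nd)
      qed
    qed
  qed
  ultimately show ?thesis using that r by blast
qed

lemma
  assumes z: "\<And>n. z n \<in> JT" "\<And>n. jt_norm (z n) \<le> M" and lim: "\<And>t. (\<lambda>n. z n t) \<longlonglongrightarrow> x t"
  shows limit_JT: "x \<in> JT" and limit_le: "jt_norm x \<le> M"
    and diff_limit_JT: "(\<lambda>t. z n t - x t) \<in> JT"
    and diff_limit_le: "jt_norm (\<lambda>t. z n t - x t) \<le> 2 * M"
    and diff_limit_tendsto: "(\<lambda>n. z n t - x t) \<longlonglongrightarrow> 0"
proof -
  show x: "x \<in> JT" "jt_norm x \<le> M"
    using JT.lim_X[of z x M, OF lim] JT.nrm_lim_le[of z x M, OF lim] z by auto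
  show "(\<lambda>t. z n t - x t) \<in> JT" by (rule JT.diff_X[OF z(1) x(1)])
  show "jt_norm (\<lambda>t. z n t - x t) \<le> 2 * M"
    using JT.nrm_diff_le[OF z(1) x(1), of n] z(2)[of n] x(2) by linarith
  show "(\<lambda>n. z n t - x t) \<longlonglongrightarrow> 0"
    using tendsto_diff[OF lim tendsto_const[of "x t"], of t] by simp
qed

text \<open>A diagonal argument reaches countably many branches only. Those outside the countable
  union of the \<open>Br j\<close> take care of themselves: along them the sums of
  \<open>z n - x\<close> tend to 0.\<close>

lemma bsum_convergent_subsequence:
  assumes z_JT: "\<And>n. z n \<in> JT" and z_le: "\<And>n. jt_norm (z n) \<le> M"
    and lim: "\<And>t. (\<lambda>n. z n t) \<longlonglongrightarrow> x t"
  obtains r where "strict_mono r" "\<And>\<gamma>. convergent (\<lambda>n. bsum \<gamma> (z (r n)))"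
proof -
  note x = limit_JT[OF z_JT z_le lim] limit_le[OF z_JT z_le lim]
  define u where "u n = (\<lambda>t. z n t - x t)" for n
  note u = diff_limit_JT[OF z_JT z_le lim, folded u_def] diff_limit_le[OF z_JT z_le lim, folded u_def]
  have u_0: "(\<lambda>n. u n t) \<longlonglongrightarrow> 0" for t
    unfolding u_def by (rule diff_limit_tendsto[OF z_JT z_le lim])
  obtain r Br where r: "strict_mono r" and fin: "\<And>j::nat. finite (Br j)"
    and out: "\<And>j \<gamma>. \<gamma> \<notin> Br j \<Longrightarrow> \<forall>\<^sub>F n in sequentially. \<bar>bsum \<gamma> (u (r n))\<bar> < (1/2)^j"
    and "\<And>j L. \<forall>\<^sub>F n in sequentially. \<forall>\<gamma>. (1/2)^j \<le> \<bar>bsum \<gamma> (u (r n))\<bar> \<longrightarrow> (\<exists>\<beta>\<in>Br j. nd \<gamma> L = nd \<beta> L)"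
    by (rule big_branches[of u "2 * M", OF u u_0]) blast
  define B where "B = (\<Union>j. Br j)"
  have "countable B" unfolding B_def using fin by (simp add: countable_finite)
  obtain r' where r': "strict_mono r'"
    and conv: "\<And>i::nat. convergent (\<lambda>n. bsum (from_nat_into B i) (u (r (r' n))))"
  proof (rule diagonal_convergent[of "\<lambda>n i. bsum (from_nat_into B i) (u (r n))" "\<lambda>_. 2 * M"])
    show "\<bar>bsum (from_nat_into B i) (u (r n))\<bar> \<le> 2 * M" for n i
      using abs_bsum_le[OF u(1)] u(2) order_trans by blast
  qed blast
  have "convergent (\<lambda>n. bsum \<gamma> (u (r (r' n))))" for \<gamma>
  proof (cases "\<gamma> \<in> B")
    case True
    then obtain i where "from_nat_into B i = \<gamma>"
      using from_nat_into_surj[OF \<open>countable B\<close>] by blast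
    then show ?thesis using conv[of i] by simp
  next
    case False
    have "(\<lambda>n. bsum \<gamma> (u (r n))) \<longlonglongrightarrow> 0"
    proof (rule tendstoI)
      fix e :: real assume "0 < e"
      then obtain j where j: "(1/2)^j < e" using real_arch_pow_inv[of e "1/2"] by auto
      have "\<gamma> \<notin> Br j" using False by (auto simp: B_def)
      from out[OF this] show "\<forall>\<^sub>F n in sequentially. dist (bsum \<gamma> (u (r n))) 0 < e"
        by eventually_elim (use j in auto)
    qed
    from LIMSEQ_subseq_LIMSEQ[OF this r'] show ?thesis by (auto simp: convergent_def o_def)
  qed
  moreover have "bsum \<gamma> (z n) = bsum \<gamma> (u n) + bsum \<gamma> x" for \<gamma> n
    unfolding u_def by (simp add: bsum_diff[OF z_JT x(1)])
  ultimately have "convergent (\<lambda>n. bsum \<gamma> (z (r (r' n))))" for \<gamma>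
    using convergent_add[of "\<lambda>n. bsum \<gamma> (u (r (r' n)))" "\<lambda>n. bsum \<gamma> x"] by (simp add: convergent_const)
  then show ?thesis using that[of "r \<circ> r'"] strict_mono_o[OF r r'] by simp
qed

section \<open>Upper estimates for block sequences\<close>

text \<open>Downward induction on \<open>p\<close>. If the new term reaches
  \<open>\<epsilon> p\<close>, it becomes the exceptional one; the former exceptional term is then
  below \<open>\<epsilon> p\<close> and is paid for by it.\<close>

lemma sum_le_one_big_term:
  fixes b \<epsilon> :: "nat \<Rightarrow> real"
  assumes "p \<le> q" and \<epsilon>: "\<And>j. 0 \<le> \<epsilon> j"
    and one: "\<And>j n m. p \<le> j \<Longrightarrow> j < n \<Longrightarrow> n < m \<Longrightarrow> \<not> (\<epsilon> j \<le> b n \<and> \<epsilon> j \<le> b m)"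
  shows "\<exists>n\<^sub>0. (\<Sum>n\<in>{p<..q} - {n\<^sub>0}. b n) \<le> (\<Sum>j=p..<q. \<epsilon> j)"
  using assms(1) one
proof (induction rule: inc_induct)
  case base show ?case by simp
next
  case (step p)
  from step.IH step.prems Suc_leD obtain n\<^sub>0 where
    n0: "(\<Sum>n\<in>{Suc p<..q} - {n\<^sub>0}. b n) \<le> (\<Sum>j=Suc p..<q. \<epsilon> j)" by meson
  have E: "(\<Sum>j=p..<q. \<epsilon> j) = \<epsilon> p + (\<Sum>j=Suc p..<q. \<epsilon> j)"
    using step(2) by (simp add: sum.atLeast_Suc_lessThan)
  have ins: "{p<..q} = insert (Suc p) {Suc p<..q}" using step(2) by auto
  show ?case
  proof (cases "b (Suc p) < \<epsilon> p \<and> n\<^sub>0 \<noteq> Suc p")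
    case True
    then have "{p<..q} - {n\<^sub>0} = insert (Suc p) ({Suc p<..q} - {n\<^sub>0})" using ins by auto
    then have "(\<Sum>n\<in>{p<..q} - {n\<^sub>0}. b n) = b (Suc p) + (\<Sum>n\<in>{Suc p<..q} - {n\<^sub>0}. b n)" by simp
    then show ?thesis using n0 E True by (intro exI[of _ n\<^sub>0]) linarith
  next
    case False
    have *: "{p<..q} - {Suc p} = {Suc p<..q}" using ins by auto
    have "(\<Sum>n\<in>{Suc p<..q}. b n) \<le> \<epsilon> p + (\<Sum>j=Suc p..<q. \<epsilon> j)"
    proof (cases "n\<^sub>0 \<in> {Suc p<..q}")
      case True
      then have "b n\<^sub>0 < \<epsilon> p" using False step.prems[of p "Suc p" n\<^sub>0] by auto
      moreover have "(\<Sum>n\<in>{Suc p<..q}. b n) = b n\<^sub>0 + (\<Sum>n\<in>{Suc p<..q} - {n\<^sub>0}. b n)"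
        using True by (simp add: sum.remove)
      ultimately show ?thesis using n0 by linarith
    next
      case False then show ?thesis using n0 \<epsilon>[of p] by simp
    qed
    then show ?thesis using * E by (intro exI[of _ "Suc p"]) simp
  qed
qed

text \<open>Level \<open>n\<close> has \<open>2^n\<close> nodes. The bound adds up squared errors
  \<open>(1/2)^i\<close> over disjoint segments, each charged to a node of its own at level
  \<open>i\<close>.\<close>

lemma sum_quarter_length_le:
  assumes "finite T" shows "(\<Sum>t\<in>T. (1/4::real) ^ length (t :: bool list)) \<le> 2"
proof -
  have fin: "finite {t :: bool list. length t < n}" for n by (rule JT.finite_lev)
  have eq: "(\<Sum>t | length (t :: bool list) < n. (1/4::real) ^ length t) = (\<Sum>k<n. (1/2)^k)" for n
  proof (induction n)
    case (Suc n)
    have "{t :: bool list. length t < Suc n} = {t. length t < n} \<union> {t. length t = n}" by auto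
    moreover have fn: "finite {t :: bool list. length t = n}"
      by (rule finite_subset[OF _ fin[of "Suc n"]]) auto
    moreover have "card {t :: bool list. length t = n} = 2 ^ n"
      using card_lists_length_eq[of "UNIV :: bool set" n] by simp
    moreover have "(\<Sum>t\<in>{t. length t < n} \<union> {t. length t = n}. (1/4::real) ^ length (t :: bool list))
        = (\<Sum>t | length (t :: bool list) < n. (1/4) ^ length t) + (\<Sum>t | length (t :: bool list) = n. (1/4) ^ length t)"
      by (rule sum.union_disjoint[OF fin fn]) auto
    ultimately have "(\<Sum>t | length (t :: bool list) < Suc n. (1/4::real) ^ length t)
        = (\<Sum>k<n. (1/2)^k) + 2 ^ n * (1/4) ^ n"
      using Suc by simp
    moreover have "(2::real) ^ n * (1/4) ^ n = (1/2) ^ n"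
      unfolding power_mult_distrib[symmetric] by simp
    ultimately show ?case by simp
  qed simp
  obtain n where n: "\<And>t. t \<in> T \<Longrightarrow> length t < n"
    using assms by (metis finite_imageI finite_nat_set_iff_bounded imageI)
  have "(\<Sum>t\<in>T. (1/4::real) ^ length t) \<le> (\<Sum>t | length (t :: bool list) < n. (1/4::real) ^ length t)"
    using n by (intro sum_mono2 fin) auto
  also have "\<dots> \<le> 2" unfolding eq by (simp add: sum_gp_strict)
  finally show ?thesis .
qed

lemma bsum_cong:
  assumes "\<And>t. L \<le> length t \<Longrightarrow> w t = 0" "nd \<gamma> L = nd \<beta> L"
  shows "bsum \<gamma> w = bsum \<beta> w"
proof -
  have "w (nd \<gamma> k) = w (nd \<beta> k)" for k
    using assms(1) nd_eq_mono[OF assms(2), of k] by (cases "k \<le> L") auto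
  then show ?thesis by (simp add: bsum_def)
qed

section \<open>The l2-estimate for level blocks\<close>

locale blocks =
  fixes w :: "nat \<Rightarrow> bool list \<Rightarrow> real" and l l' :: "nat \<Rightarrow> nat" and M :: real
  assumes w_JT: "w n \<in> JT" and w_le: "jt_norm (w n) \<le> M"
    and l_less: "l n < l' n" and l'_le: "l' n \<le> l (Suc n)"
    and supp: "w n t \<noteq> 0 \<Longrightarrow> l n \<le> length t \<and> length t < l' n"
begin

lemma l'_le_l: "n < m \<Longrightarrow> l' n \<le> l m"
proof (induction m)
  case (Suc m)
  then show ?case using l'_le[of m] l_less[of m] by (cases "n = m") (auto intro: order_trans)
qed simp

lemma l_strict_mono: "strict_mono l"
  by (rule strict_monoI) (meson l'_le_l l_less less_le_trans)

lemma l'_mono: "n \<le> m \<Longrightarrow> l' n \<le> l' m"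
  using l'_le_l[of n m] l_less[of m] by (cases "n = m") auto

lemma le_l: "n \<le> l n"
  using strict_mono_imp_increasing[OF l_strict_mono] .

lemma less_l': "n < l' n"
  using le_l[of n] l_less[of n] by simp

lemma w_tendsto_0: "(\<lambda>n. w n t) \<longlonglongrightarrow> 0"
proof (rule tendsto_eventually)
  show "\<forall>\<^sub>F n in sequentially. w n t = 0"
    using eventually_gt_at_top[of "length t"]
    by eventually_elim (metis le_l le_trans not_le supp)
qed

text \<open>Gaps between consecutive bands are allowed, so a subsequence is a block sequence
  again.\<close>

lemma subseq_blocks: "strict_mono r \<Longrightarrow> blocks (w \<circ> r) (l \<circ> r) (l' \<circ> r) M"
  using w_JT w_le l_less supp l'_le_l by unfold_locales (auto simp: strict_mono_Suc_iff)

lemma bsum_eq_sum_nd: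
  assumes "i \<le> l n" "l' n \<le> e" shows "bsum \<gamma> (w n) = (\<Sum>k=i..<e. w n (nd \<gamma> k))"
proof -
  have "(\<lambda>k. w n (nd \<gamma> k)) sums (\<Sum>k=i..<e. w n (nd \<gamma> k))"
  proof (rule sums_finite)
    fix k assume "k \<notin> {i..<e}"
    then have "\<not> (l n \<le> k \<and> k < l' n)" using assms by auto
    then show "w n (nd \<gamma> k) = 0" using supp[of n "nd \<gamma> k"] by auto
  qed simp
  then show ?thesis by (simp add: bsum_def sums_iff)
qed

text \<open>On a segment all but the first and the last block it meets are crossed completely, so there
  the partial sums are branch sums, at most one of which is not negligible.\<close>

lemma segment_sum_le:
  assumes one: "\<And>j n m \<gamma>. j < n \<Longrightarrow> n < m \<Longrightarrow>
      \<not> ((1/2)^(l' j + j) \<le> \<bar>bsum \<gamma> (w n)\<bar> \<and> (1/2)^(l' j + j) \<le> \<bar>bsum \<gamma> (w m)\<bar>)"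
    and s: "jt_seg s" "s \<noteq> {}"
  shows "\<exists>v\<in>s. (\<Sum>t\<in>s. \<Sum>k<N. c k * w k t)\<^sup>2 \<le>
      6 * (\<Sum>k<N. (c k)\<^sup>2 * (\<Sum>t\<in>s. w k t)\<^sup>2) + 2 * ((\<Sum>k<N. (c k)\<^sup>2) * (1/4) ^ length v)"
proof -
  obtain \<gamma> i e where se: "s = nd \<gamma> ` {i..<e}" and ie: "i < e"
    using jt_seg_obtain[OF s] by blast
  define f where "f n = (\<Sum>t\<in>s. w n t)" for n
  have f: "f n = (\<Sum>k=i..<e. w n (nd \<gamma> k))" for n by (simp add: f_def se sum_nd_image)
  \<comment> \<open>\<open>s\<close> occupies the levels from \<open>i\<close> to
    \<open>e - 1\<close>. Blocks before \<open>p\<close> end by level \<open>i\<close>, blocks after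
    \<open>q\<close> start at level \<open>e\<close> or later, and those strictly in between are
    crossed completely.\<close>
  define p where "p = (LEAST n. i < l' n)"
  define q where "q = (LEAST n. e \<le> l' n)"
  have p: "i < l' p" unfolding p_def by (rule LeastI[of _ i]) (rule less_l')
  have q: "e \<le> l' q" unfolding q_def by (rule LeastI[of _ e]) (rule less_imp_le[OF less_l'])
  have pn: "l' n \<le> i" if "n < p" for n using not_less_Least that unfolding p_def by (metis not_le)
  have qn: "l' n < e" if "n < q" for n using not_less_Least that unfolding q_def by (metis not_le)
  have pq: "p \<le> q" using q ie unfolding p_def by (intro Least_le) simp
  have zero: "f n = 0" if "n < p \<or> q < n" for n
    unfolding f
  proof (rule sum.neutral, rule ballI)
    fix k assume k: "k \<in> {i..<e}"
    have "\<not> (l n \<le> k \<and> k < l' n)"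
      using that pn[of n] l'_le_l[of q n] q k by auto
    then show "w n (nd \<gamma> k) = 0" using supp[of n "nd \<gamma> k"] by auto
  qed
  have nz: "p \<le> n \<and> n \<le> q" if "f n \<noteq> 0" for n
    using zero[of n] that by (meson not_le)
  have mid: "f n = bsum \<gamma> (w n)" if "p < n" "n < q" for n
    unfolding f using that p l'_le_l[of p n] qn[of n] by (intro bsum_eq_sum_nd[symmetric]) auto
  define b where "b n = \<bar>bsum \<gamma> (w n)\<bar>" for n
  define \<epsilon> where "\<epsilon> j = (1/2::real)^(l' j + j)" for j
  obtain n\<^sub>0 where n0: "(\<Sum>n\<in>{p<..q} - {n\<^sub>0}. b n) \<le> (\<Sum>j=p..<q. \<epsilon> j)"
    using sum_le_one_big_term[OF pq, of \<epsilon> b] one by (auto simp: \<epsilon>_def b_def)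
  \<comment> \<open>Here the exponent \<open>l' j + j\<close> is spent: \<open>l' j > i\<close> ties
    the error to the level at which \<open>s\<close> starts, and the extra \<open>j\<close> makes
    the series converge.\<close>
  have "(\<Sum>j=p..<q. \<epsilon> j) \<le> (1/2)^i"
  proof -
    have "(\<Sum>j=p..<q. \<epsilon> j) \<le> (\<Sum>j=p..<q. (1/2)^(Suc i) * (1/2)^j)"
      unfolding \<epsilon>_def power_add
    proof (intro sum_mono mult_right_mono)
      fix j assume "j \<in> {p..<q}"
      then have "Suc i \<le> l' j" using p l'_mono[of p j] by auto
      then show "(1/2::real)^l' j \<le> (1/2)^Suc i" by (rule power_decreasing) auto
    qed simp
    also have "\<dots> \<le> (\<Sum>j<q. (1/2)^(Suc i) * (1/2)^j)" by (rule sum_mono2) auto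
    also have "\<dots> = (1/2)^(Suc i) * (\<Sum>j<q. (1/2)^j)" by (simp add: sum_distrib_left)
    also have "\<dots> \<le> (1/2)^(Suc i) * 2" by (intro mult_left_mono) (auto simp: sum_gp_strict)
    finally show ?thesis by simp
  qed
  with n0 have n0': "(\<Sum>n\<in>{p<..q} - {n\<^sub>0}. b n) \<le> (1/2)^i" by simp
  define cm where "cm = sqrt (\<Sum>k<N. (c k)\<^sup>2)"
  have cm: "\<bar>c k\<bar> \<le> cm" if "k < N" for k
    unfolding cm_def using that
    by (intro real_le_rsqrt) (auto intro!: member_le_sum[of k _ "\<lambda>k. (c k)\<^sup>2"])
  have cm0: "0 \<le> cm" by (simp add: cm_def sum_nonneg)
  \<comment> \<open>Only the two end blocks and the exceptional block \<open>n\<^sub>0\<close> are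
    kept. Cauchy-Schwarz on three terms gives 3, and splitting off the error \<open>d\<close>
    doubles this to 6.\<close>
  define A where "A = {..<N} \<inter> {p, q, n\<^sub>0}"
  have "(\<Sum>t\<in>s. \<Sum>k<N. c k * w k t) = (\<Sum>k<N. c k * f k)"
    unfolding f_def by (subst sum.swap) (simp add: sum_distrib_left)
  also have "\<bar>\<dots>\<bar> \<le> (\<Sum>k<N. \<bar>c k * f k\<bar>)" by (rule sum_abs)
  also have "\<dots> = (\<Sum>k\<in>A. \<bar>c k * f k\<bar>) + (\<Sum>k\<in>{..<N} - {p, q, n\<^sub>0}. \<bar>c k * f k\<bar>)"
    unfolding A_def by (subst sum.union_disjoint[symmetric]) (auto intro!: sum.cong)
  also have "(\<Sum>k\<in>{..<N} - {p, q, n\<^sub>0}. \<bar>c k * f k\<bar>) \<le> cm * (1/2)^i"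
  proof -
    have "(\<Sum>k\<in>{..<N} - {p, q, n\<^sub>0}. \<bar>c k * f k\<bar>) \<le> (\<Sum>k\<in>{p<..q} - {n\<^sub>0}. cm * b k)"
    proof (rule order_trans)
      show "(\<Sum>k\<in>{..<N} - {p, q, n\<^sub>0}. \<bar>c k * f k\<bar>) \<le> (\<Sum>k\<in>({..<N} - {p, q, n\<^sub>0}) \<inter> {p<..q}. cm * b k)"
      proof -
        have "(\<Sum>k\<in>{..<N} - {p, q, n\<^sub>0}. \<bar>c k * f k\<bar>)
            = (\<Sum>k\<in>({..<N} - {p, q, n\<^sub>0}) \<inter> {p<..q}. \<bar>c k * f k\<bar>)"
          by (intro sum.mono_neutral_right) (auto dest!: nz)
        also have "\<dots> \<le> (\<Sum>k\<in>({..<N} - {p, q, n\<^sub>0}) \<inter> {p<..q}. cm * b k)"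
          using mid cm cm0 by (intro sum_mono) (auto simp: abs_mult b_def intro!: mult_mono)
        finally show ?thesis .
      qed
      show "(\<Sum>k\<in>({..<N} - {p, q, n\<^sub>0}) \<inter> {p<..q}. cm * b k) \<le> (\<Sum>k\<in>{p<..q} - {n\<^sub>0}. cm * b k)"
        using cm0 by (intro sum_mono2) (auto simp: b_def)
    qed
    also have "\<dots> \<le> cm * (1/2)^i"
      unfolding sum_distrib_left[symmetric] by (rule mult_left_mono[OF n0' cm0])
    finally show ?thesis .
  qed
  finally have le: "\<bar>\<Sum>t\<in>s. \<Sum>k<N. c k * w k t\<bar> \<le> (\<Sum>k\<in>A. \<bar>c k * f k\<bar>) + cm * (1/2)^i" by simp
  define a where "a = (\<Sum>k\<in>A. \<bar>c k * f k\<bar>)"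
  define d where "d = cm * (1/2)^i"
  have "card A \<le> card {p, q, n\<^sub>0}" unfolding A_def by (intro card_mono) auto
  also have "\<dots> \<le> 3" by (simp add: card_insert_if)
  finally have cA: "real (card A) \<le> 3" by simp
  have "a\<^sup>2 \<le> (\<Sum>k\<in>A. \<bar>c k * f k\<bar>\<^sup>2) * card A"
    unfolding a_def by (rule sum_squared_le_sum_of_squares)
  also have "\<dots> \<le> (\<Sum>k<N. (c k)\<^sup>2 * (f k)\<^sup>2) * 3"
    using cA by (intro mult_mono) (auto simp: A_def power_mult_distrib sum_nonneg intro!: sum_mono2)
  finally have a2: "a\<^sup>2 \<le> 3 * (\<Sum>k<N. (c k)\<^sup>2 * (f k)\<^sup>2)" by simp
  have "((1/2::real)^i)\<^sup>2 = (1/4)^i"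
    unfolding power2_eq_square power_mult_distrib[symmetric] by simp
  then have d2: "d\<^sup>2 = (\<Sum>k<N. (c k)\<^sup>2) * (1/4)^i"
    unfolding d_def cm_def by (simp add: power_mult_distrib sum_nonneg)
  have "(\<Sum>t\<in>s. \<Sum>k<N. c k * w k t)\<^sup>2 \<le> (a + d)\<^sup>2"
    using power_mono[OF le abs_ge_zero, of 2] unfolding a_def d_def by simp
  also have "\<dots> \<le> 2 * a\<^sup>2 + 2 * d\<^sup>2" using sum_squares_bound[of a d] by (simp add: power2_sum)
  also have "\<dots> \<le> 6 * (\<Sum>k<N. (c k)\<^sup>2 * (f k)\<^sup>2) + 2 * ((\<Sum>k<N. (c k)\<^sup>2) * (1/4)^i)"
    using a2 d2 by simp
  finally show ?thesis using se ie unfolding f_def by (intro bexI[of _ "nd \<gamma> i"]) auto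
qed

text \<open>\<open>segment_sum_le\<close> is summed over a disjoint family. In the first term
  disjointness bounds the sums of each \<open>w k\<close> by \<open>M\<^sup>2\<close>; in the second
  the nodes \<open>v s\<close> are distinct, so \<open>sum_quarter_length_le\<close> turns the
  factor 2 into 4.\<close>

lemma l2_upper_estimate:
  assumes one: "\<And>j n m \<gamma>. j < n \<Longrightarrow> n < m \<Longrightarrow>
      \<not> ((1/2)^(l' j + j) \<le> \<bar>bsum \<gamma> (w n)\<bar> \<and> (1/2)^(l' j + j) \<le> \<bar>bsum \<gamma> (w m)\<bar>)"
  shows "jt_norm (\<lambda>t. \<Sum>k<N. c k * w k t) \<le> sqrt (6 * M\<^sup>2 + 4) * sqrt (\<Sum>k<N. (c k)\<^sup>2)"
proof (rule JT.nrm_leI)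
  fix F assume F: "JT.adm F"
  define cc where "cc = (\<Sum>k<N. (c k)\<^sup>2)"
  \<comment> \<open>An empty segment has no node to be charged to.\<close>
  define F' where "F' = F - {{}}"
  have "finite F" "\<forall>s\<in>F. jt_seg s" "\<forall>s\<in>F. \<forall>s'\<in>F. s \<noteq> s' \<longrightarrow> s \<inter> s' = {}"
    using F unfolding JT.adm_def pairwise_def disjnt_def by auto
  then have F': "finite F'" "\<And>s. s \<in> F' \<Longrightarrow> jt_seg s \<and> s \<noteq> {}"
    "\<And>s s'. s \<in> F' \<Longrightarrow> s' \<in> F' \<Longrightarrow> s \<noteq> s' \<Longrightarrow> s \<inter> s' = {}"
    unfolding F'_def by (simp, blast, blast)
  have "\<exists>v. \<forall>s\<in>F'. v s \<in> s \<and> (\<Sum>t\<in>s. \<Sum>k<N. c k * w k t)\<^sup>2 \<le>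
      6 * (\<Sum>k<N. (c k)\<^sup>2 * (\<Sum>t\<in>s. w k t)\<^sup>2) + 2 * (cc * (1/4) ^ length (v s))"
  proof (rule bchoice, rule ballI)
    fix s assume "s \<in> F'"
    then have "jt_seg s" "s \<noteq> {}" using F'(2) by auto
    from segment_sum_le[OF one this, where N=N and c=c]
    show "\<exists>v. v \<in> s \<and> (\<Sum>t\<in>s. \<Sum>k<N. c k * w k t)\<^sup>2 \<le>
      6 * (\<Sum>k<N. (c k)\<^sup>2 * (\<Sum>t\<in>s. w k t)\<^sup>2) + 2 * (cc * (1/4) ^ length v)"
      unfolding cc_def Bex_def .
  qed
  then obtain v where v: "\<And>s. s \<in> F' \<Longrightarrow> v s \<in> s"
    and le: "\<And>s. s \<in> F' \<Longrightarrow> (\<Sum>t\<in>s. \<Sum>k<N. c k * w k t)\<^sup>2 \<le>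
      6 * (\<Sum>k<N. (c k)\<^sup>2 * (\<Sum>t\<in>s. w k t)\<^sup>2) + 2 * (cc * (1/4) ^ length (v s))"
    by auto
  have inj: "inj_on v F'"
  proof (rule inj_onI, rule ccontr)
    fix s s' assume "s \<in> F'" "s' \<in> F'" "v s = v s'" "s \<noteq> s'"
    then show False using v[of s] v[of s'] F'(3)[of s s'] by auto
  qed
  have "JT.Q F (\<lambda>t. \<Sum>k<N. c k * w k t) = (\<Sum>s\<in>F'. (\<Sum>t\<in>s. \<Sum>k<N. c k * w k t)\<^sup>2)"
    unfolding JT.Q_def F'_def using F by (intro sum.mono_neutral_right) (auto simp: JT.adm_def)
  also have "\<dots> \<le> (\<Sum>s\<in>F'. 6 * (\<Sum>k<N. (c k)\<^sup>2 * (\<Sum>t\<in>s. w k t)\<^sup>2) + 2 * (cc * (1/4) ^ length (v s)))"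
    by (rule sum_mono) (rule le)
  also have "\<dots> = 6 * (\<Sum>s\<in>F'. \<Sum>k<N. (c k)\<^sup>2 * (\<Sum>t\<in>s. w k t)\<^sup>2) + 2 * (cc * (\<Sum>s\<in>F'. (1/4) ^ length (v s)))"
    by (simp add: sum.distrib sum_distrib_left)
  also have "(\<Sum>s\<in>F'. (1/4::real) ^ length (v s)) = (\<Sum>t\<in>v ` F'. (1/4) ^ length t)"
    by (simp add: sum.reindex[OF inj])
  also have "(\<Sum>s\<in>F'. \<Sum>k<N. (c k)\<^sup>2 * (\<Sum>t\<in>s. w k t)\<^sup>2) = (\<Sum>k<N. (c k)\<^sup>2 * (\<Sum>s\<in>F'. (\<Sum>t\<in>s. w k t)\<^sup>2))"
    by (subst sum.swap) (simp add: sum_distrib_left)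
  also have "6 * (\<Sum>k<N. (c k)\<^sup>2 * (\<Sum>s\<in>F'. (\<Sum>t\<in>s. w k t)\<^sup>2)) + 2 * (cc * (\<Sum>t\<in>v ` F'. (1/4) ^ length t))
      \<le> 6 * (\<Sum>k<N. (c k)\<^sup>2 * M\<^sup>2) + 2 * (cc * 2)"
  proof (intro add_mono mult_left_mono sum_mono)
    fix k
    have "(\<Sum>s\<in>F'. (\<Sum>t\<in>s. w k t)\<^sup>2) \<le> (jt_norm (w k))\<^sup>2"
      using F' by (intro JT.sum_family_le[OF _ _ _ w_JT]) auto
    also have "\<dots> \<le> M\<^sup>2" by (intro power_mono w_le JT.nrm_nonneg w_JT)
    finally show "(\<Sum>s\<in>F'. (\<Sum>t\<in>s. w k t)\<^sup>2) \<le> M\<^sup>2" .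
    show "(\<Sum>t\<in>v ` F'. (1/4::real) ^ length t) \<le> 2"
      using F'(1) by (intro sum_quarter_length_le) simp
  qed (auto simp: cc_def sum_nonneg)
  also have "\<dots> = (6 * M\<^sup>2 + 4) * cc"
    unfolding sum_distrib_right[symmetric] cc_def[symmetric] by (simp add: algebra_simps)
  also have "\<dots> = (sqrt (6 * M\<^sup>2 + 4) * sqrt (\<Sum>k<N. (c k)\<^sup>2))\<^sup>2"
    by (simp add: power_mult_distrib cc_def sum_nonneg)
  finally show "JT.Q F (\<lambda>t. \<Sum>k<N. c k * w k t) \<le> (sqrt (6 * M\<^sup>2 + 4) * sqrt (\<Sum>k<N. (c k)\<^sup>2))\<^sup>2" .
qed (auto simp: sum_nonneg)

text \<open>Suppose \<gamma> carries much of block \<open>m\<close>. If \<open>m\<close> was chosen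
  late enough after \<open>n\<close>, then \<gamma> agrees with some \<beta> in the relevant finite
  set \<open>Br\<close> up to the end of block \<open>n\<close>, so both have the same sum on block
  \<open>n\<close>. That sum is small, since \<open>n\<close> was chosen late enough for all members
  of this set.\<close>

lemma l2_subsequence:
  assumes bsum_0: "\<And>\<gamma>. (\<lambda>n. bsum \<gamma> (w n)) \<longlonglongrightarrow> 0"
  obtains \<psi> where "strict_mono (\<psi> :: nat \<Rightarrow> nat)"
    "\<And>N c. jt_norm (\<lambda>t. \<Sum>k<N. c k * w (\<psi> k) t) \<le> sqrt (6 * M\<^sup>2 + 4) * sqrt (\<Sum>k<N. (c k)\<^sup>2)"
proof -
  obtain r Br where r: "strict_mono r" and fin: "\<And>j::nat. finite (Br j)"
    and "\<And>j \<gamma>. \<gamma> \<notin> Br j \<Longrightarrow> \<forall>\<^sub>F n in sequentially. \<bar>bsum \<gamma> (w (r n))\<bar> < (1/2)^j"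
    and near: "\<And>j L. \<forall>\<^sub>F n in sequentially. \<forall>\<gamma>. (1/2)^j \<le> \<bar>bsum \<gamma> (w (r n))\<bar> \<longrightarrow> (\<exists>\<beta>\<in>Br j. nd \<gamma> L = nd \<beta> L)"
    by (rule big_branches[of w M, OF w_JT w_le w_tendsto_0]) blast
  \<comment> \<open>Finitely many thresholds are treated at a time. As
    \<open>j \<le> \<xi> j\<close>, the exponent \<open>J (\<xi> j)\<close> is at least the one
    required by \<open>l2_upper_estimate\<close>; as \<open>J\<close> grows along
    \<open>\<xi>\<close>, thresholds of earlier blocks remain covered.\<close>
  define J where "J q = l' (r q) + q" for q
  define P where "P q n \<longleftrightarrow> (\<forall>j\<le>J q. (\<forall>\<gamma>. (1/2)^j \<le> \<bar>bsum \<gamma> (w (r n))\<bar> \<longrightarrow>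
      (\<exists>\<beta>\<in>Br j. nd \<gamma> (l' (r q)) = nd \<beta> (l' (r q)))) \<and> (\<forall>\<beta>\<in>Br j. \<bar>bsum \<beta> (w (r n))\<bar> < (1/2)^j))" for q n
  have "\<forall>\<^sub>F n in sequentially. P q n" for q
  proof -
    have "\<forall>\<^sub>F n in sequentially. \<bar>bsum \<beta> (w (r n))\<bar> < (1/2)^j" for \<beta> j
    proof -
      have "(\<lambda>n. \<bar>bsum \<beta> (w (r n))\<bar>) \<longlonglongrightarrow> \<bar>0\<bar>"
        using LIMSEQ_subseq_LIMSEQ[OF bsum_0 r, of \<beta>] by (intro tendsto_rabs) (simp add: o_def)
      then show ?thesis by (intro order_tendstoD(2)) auto
    qed
    then have ev: "\<forall>\<^sub>F n in sequentially. \<forall>\<beta>\<in>Br j. \<bar>bsum \<beta> (w (r n))\<bar> < (1/2)^j" for j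
      using fin by (simp add: eventually_ball_finite)
    have "\<forall>\<^sub>F n in sequentially. \<forall>j\<in>{..J q}. (\<forall>\<gamma>. (1/2)^j \<le> \<bar>bsum \<gamma> (w (r n))\<bar> \<longrightarrow>
      (\<exists>\<beta>\<in>Br j. nd \<gamma> (l' (r q)) = nd \<beta> (l' (r q)))) \<and> (\<forall>\<beta>\<in>Br j. \<bar>bsum \<beta> (w (r n))\<bar> < (1/2)^j)"
      by (rule eventually_ball_finite[OF finite_atMost]) (use near ev in \<open>auto intro: eventually_conj\<close>)
    then show ?thesis unfolding P_def by (simp add: Ball_def)
  qed
  then obtain g where g: "\<And>q n. g q \<le> n \<Longrightarrow> P q n"
    unfolding eventually_sequentially by metis
  define \<xi> where "\<xi> = rec_nat 0 (\<lambda>_ q. max (g q) (Suc q))"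
  have \<xi>S: "\<xi> (Suc k) = max (g (\<xi> k)) (Suc (\<xi> k))" for k by (simp add: \<xi>_def)
  have \<xi>: "strict_mono \<xi>" by (simp add: strict_mono_Suc_iff \<xi>S less_max_iff_disj)
  have P: "P (\<xi> k) (\<xi> m)" if "k < m" for k m
  proof (rule g)
    have "\<xi> (Suc k) \<le> \<xi> m" using \<xi> that by (simp add: strict_mono_less_eq)
    then show "g (\<xi> k) \<le> \<xi> m" by (simp add: \<xi>S)
  qed
  have Jmono: "J (\<xi> j) \<le> J (\<xi> n)" if "j \<le> n" for j n
  proof -
    have "\<xi> j \<le> \<xi> n" using \<xi> that by (simp add: strict_mono_less_eq)
    moreover from this have "r (\<xi> j) \<le> r (\<xi> n)" using r by (simp add: strict_mono_less_eq)
    ultimately show ?thesis unfolding J_def using l'_mono by (simp add: add_mono)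
  qed
  define \<psi> where "\<psi> = r \<circ> \<xi>"
  have \<psi>: "strict_mono \<psi>" unfolding \<psi>_def by (rule strict_mono_o[OF r \<xi>])
  interpret sub: blocks "w \<circ> \<psi>" "l \<circ> \<psi>" "l' \<circ> \<psi>" M by (rule subseq_blocks[OF \<psi>])
  have one: "\<not> ((1/2)^((l' \<circ> \<psi>) j + j) \<le> \<bar>bsum \<gamma> ((w \<circ> \<psi>) n)\<bar> \<and>
      (1/2)^((l' \<circ> \<psi>) j + j) \<le> \<bar>bsum \<gamma> ((w \<circ> \<psi>) m)\<bar>)" if jn: "j < n" and nm: "n < m" for j n m \<gamma>
  proof
    assume as: "(1/2)^((l' \<circ> \<psi>) j + j) \<le> \<bar>bsum \<gamma> ((w \<circ> \<psi>) n)\<bar> \<and>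
      (1/2)^((l' \<circ> \<psi>) j + j) \<le> \<bar>bsum \<gamma> ((w \<circ> \<psi>) m)\<bar>"
    have "(l' \<circ> \<psi>) j + j \<le> J (\<xi> j)"
      using strict_mono_imp_increasing[OF \<xi>, of j] by (simp add: J_def \<psi>_def)
    then have "(1/2::real)^J (\<xi> j) \<le> (1/2)^((l' \<circ> \<psi>) j + j)" by (rule power_decreasing) auto
    then have n: "(1/2)^J (\<xi> j) \<le> \<bar>bsum \<gamma> (w (r (\<xi> n)))\<bar>"
      and m: "(1/2)^J (\<xi> j) \<le> \<bar>bsum \<gamma> (w (r (\<xi> m)))\<bar>" using as unfolding \<psi>_def comp_def by linarith+
    obtain \<beta> where \<beta>: "\<beta> \<in> Br (J (\<xi> j))" "nd \<gamma> (l' (r (\<xi> n))) = nd \<beta> (l' (r (\<xi> n)))"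
      using P[OF nm] m Jmono[OF less_imp_le[OF jn]] unfolding P_def by blast
    have "bsum \<gamma> (w (r (\<xi> n))) = bsum \<beta> (w (r (\<xi> n)))"
      by (rule bsum_cong[OF _ \<beta>(2)]) (metis supp not_le)
    moreover have "\<bar>bsum \<beta> (w (r (\<xi> n)))\<bar> < (1/2)^J (\<xi> j)"
      using P[OF jn] \<beta>(1) unfolding P_def by auto
    ultimately show False using n by simp
  qed
  show ?thesis
    by (rule that[OF \<psi>]) (use sub.l2_upper_estimate[OF one] in simp)
qed

end

lemma sum_mult_indicator:
  assumes "finite s" shows "(\<Sum>t\<in>s. a * (if t = v then 1 else 0)) = (if v \<in> s then a else (0::real))"
proof -
  have "(\<Sum>t\<in>s. a * (if t = v then 1 else 0)) = (\<Sum>t\<in>s. if t = v then a else 0)"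
    by (rule sum.cong) auto
  then show ?thesis using assms by simp
qed

text \<open>A segment that meets the tail of \<open>\<beta> k\<close> either contains its first node, which
  happens for at most one segment of a disjoint family, or starts inside this tail, which
  happens for at most one \<open>k\<close>.\<close>

lemma j_upper_estimate:
  fixes \<beta> :: "nat \<Rightarrow> nat \<Rightarrow> bool" and a c :: "nat \<Rightarrow> real" and \<kappa> lv :: "nat \<Rightarrow> nat"
  assumes \<kappa>: "mono \<kappa>" and lv: "strict_mono lv"
    and sep: "\<And>n k k'. k < \<kappa> n \<Longrightarrow> k' < \<kappa> n \<Longrightarrow> nd (\<beta> k) (lv n) = nd (\<beta> k') (lv n) \<Longrightarrow> k = k'"
    and a: "\<And>K. (\<Sum>k<K. (a k)\<^sup>2) \<le> A\<^sup>2" and A: "0 \<le> A"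
  shows "jt_norm (\<lambda>t. \<Sum>n<N. c n * (\<Sum>k<\<kappa> n. a k * (if t = nd (\<beta> k) (lv n) then 1 else 0)))
    \<le> 2 * A * j_norm (J.blk 0 N c)"
proof -
  define cc where "cc = J.blk 0 N c"
  define B where "B = j_norm cc"
  have cc: "cc \<in> J_space" unfolding cc_def by (rule J_blk_in_J)
  have B: "0 \<le> B" unfolding B_def by (rule J.nrm_nonneg[OF cc])
  define K where "K = \<kappa> N"
  define node where "node k n = nd (\<beta> k) (lv n)" for k n
  \<comment> \<open>The indices whose node on \<open>\<beta> k\<close> lies in \<open>s\<close>.
    They form an interval (\<open>I_seg\<close>), so the norm of \<open>c\<close> in
    \<open>J\<close> controls the sums \<open>cI\<close>, over different \<open>k\<close> for fixed
    \<open>s\<close> and over different \<open>s\<close> for fixed \<open>k\<close>.\<close>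
  define I where "I s k = {n. n < N \<and> k < \<kappa> n \<and> node k n \<in> s}" for s k
  define cI where "cI s k = (\<Sum>n\<in>I s k. cc n)" for s k
  define m where "m k = (LEAST n. k < \<kappa> n)" for k
  define \<theta> where "\<theta> k = node k (m k)" for k
  let ?x = "\<lambda>t. \<Sum>n<N. c n * (\<Sum>k<\<kappa> n. a k * (if t = node k n then 1 else 0))"
  have prefix_node: "prefix (node k n) (node k n')" if "n \<le> n'" for k n n'
    unfolding node_def using lv that by (intro prefix_nd) (simp add: strict_mono_less_eq)
  have I_fin: "finite (I s k)" for s k by (simp add: I_def)
  have m_le: "m k \<le> n" "k < \<kappa> (m k)" if "n \<in> I s k" for n s k
    using that unfolding m_def I_def by (auto intro: Least_le LeastI)
  have prefix_node_eq: "k = k'"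
    if "prefix (node k n) (node k' n')" "k < \<kappa> n" "k' < \<kappa> n" for k k' n n'
  proof -
    have "node k n = nd (\<beta> k') (lv n)"
      using that(1) unfolding node_def by (metis length_nd prefix_nd_iff)
    then show ?thesis using that sep unfolding node_def by blast
  qed
  have seg: "(\<Sum>t\<in>s. ?x t)
      = (\<Sum>k<K. a k * cI s k)" if s: "finite s" for s
  proof -
    have "(\<Sum>t\<in>s. ?x t)
        = (\<Sum>n<N. \<Sum>t\<in>s. c n * (\<Sum>k<\<kappa> n. a k * (if t = node k n then 1 else 0)))"
      by (rule sum.swap)
    also have "\<dots> = (\<Sum>n<N. c n * (\<Sum>t\<in>s. \<Sum>k<\<kappa> n. a k * (if t = node k n then 1 else 0)))"
      unfolding sum_distrib_left[symmetric] ..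
    also have "\<dots> = (\<Sum>n<N. c n * (\<Sum>k<\<kappa> n. \<Sum>t\<in>s. a k * (if t = node k n then 1 else 0)))"
    proof -
      have "(\<Sum>t\<in>s. \<Sum>k<\<kappa> n. a k * (if t = node k n then 1 else 0))
          = (\<Sum>k<\<kappa> n. \<Sum>t\<in>s. a k * (if t = node k n then 1 else 0))" for n by (rule sum.swap)
      then show ?thesis by (simp only:)
    qed
    also have "\<dots> = (\<Sum>n<N. \<Sum>k<\<kappa> n. c n * (if node k n \<in> s then a k else 0))"
      unfolding sum_mult_indicator[OF s] by (simp only: sum_distrib_left)
    also have "\<dots> = (\<Sum>n<N. \<Sum>k<K. if n \<in> I s k then a k * cc n else 0)"
    proof (rule sum.cong[OF refl])
      fix n assume n: "n \<in> {..<N}"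
      then have "\<kappa> n \<le> K" unfolding K_def by (intro monoD[OF \<kappa>]) simp
      then have "{..<\<kappa> n} \<subseteq> {..<K}" by auto
      then show "(\<Sum>k<\<kappa> n. c n * (if node k n \<in> s then a k else 0)) = (\<Sum>k<K. if n \<in> I s k then a k * cc n else 0)"
        using n by (intro sum.mono_neutral_cong_left) (auto simp: I_def cc_def J.blk_def)
    qed
    also have "\<dots> = (\<Sum>k<K. \<Sum>n<N. if n \<in> I s k then a k * cc n else 0)" by (rule sum.swap)
    also have "\<dots> = (\<Sum>k<K. a k * cI s k)"
    proof (rule sum.cong[OF refl])
      fix k
      have "I s k \<subseteq> {..<N}" by (auto simp: I_def)
      then have "(\<Sum>n<N. if n \<in> I s k then a k * cc n else 0) = (\<Sum>n\<in>I s k. a k * cc n)"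
        by (subst sum.inter_restrict[symmetric]) (auto simp: Int_absorb1)
      then show "(\<Sum>n<N. if n \<in> I s k then a k * cc n else 0) = a k * cI s k"
        by (simp add: cI_def sum_distrib_left)
    qed
    finally show ?thesis .
  qed
  have I_seg: "j_seg (I s k)" if s: "jt_seg s" for s k
  proof (rule j_seg_convex[OF I_fin])
    fix i j l assume ij: "i \<in> I s k" "l \<in> I s k" "i \<le> j" "j \<le> l"
    have "prefix (node k i) (node k j)" "prefix (node k j) (node k l)" using ij prefix_node by auto
    then have "node k j \<in> s" using s ij unfolding jt_seg_def tree_segment_def I_def by blast
    moreover have "\<kappa> i \<le> \<kappa> j" using \<kappa> ij(3) by (rule monoD)
    ultimately show "j \<in> I s k" using ij by (auto simp: I_def)
  qed
  have one: "(\<Sum>k<K. a k * cI s k)\<^sup>2 \<le> 2 * (\<Sum>k<K. (a k)\<^sup>2 * (cI s k)\<^sup>2) + 2 * (B\<^sup>2 * (\<Sum>k | k < K \<and> \<theta> k \<in> s. (a k)\<^sup>2))"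
    if s: "jt_seg s" for s
  proof -
    \<comment> \<open>For \<open>k\<close> in \<open>E\<close> the segment contains the node
      \<open>\<theta> k\<close> where the \<open>k\<close>-th mass first appears. Many
      \<open>k\<close> may occur, but each \<open>\<theta> k\<close> belongs to at most one segment
      of a disjoint family. \<open>O'\<close> collects the other \<open>k\<close> met by
      \<open>s\<close>.\<close>
    define E where "E = {k. k < K \<and> \<theta> k \<in> s}"
    define O' where "O' = {k. k < K \<and> I s k \<noteq> {} \<and> \<theta> k \<notin> s}"
    have comp: "prefix u v \<or> prefix v u" if "u \<in> s" "v \<in> s" for u v
      using s that unfolding jt_seg_def tree_segment_def by blast
    have conv: "v \<in> s" if "u \<in> s" "w \<in> s" "prefix u v" "prefix v w" for u v w
      using s that unfolding jt_seg_def tree_segment_def by blast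
    \<comment> \<open>If \<open>s\<close> meets \<open>\<beta> k\<close> before mass
      \<open>k'\<close> appears and later meets \<open>\<beta> k'\<close>, convexity puts
      \<open>\<theta> k'\<close> into \<open>s\<close>. Otherwise both masses are present at both
      meeting levels, and comparable nodes on separated branches force
      \<open>k = k'\<close>.\<close>
    have aux: "k = k'" if k: "k \<in> O'" and k': "k' \<in> O'" and mm: "m k \<le> m k'" for k k'
    proof (rule ccontr)
      assume ne: "k \<noteq> k'"
      obtain n n' where n: "n \<in> I s k" and n': "n' \<in> I s k'" using k k' by (auto simp: O'_def)
      have ns: "node k n \<in> s" "k < \<kappa> n" "node k' n' \<in> s" "k' < \<kappa> n'" using n n' by (auto simp: I_def)
      have k_n': "k < \<kappa> n'" using m_le[OF n] m_le(1)[OF n'] mm \<kappa> by (meson le_trans less_le_trans monoD)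
      show False
      proof (cases "n < m k'")
        case True
        then have le: "n \<le> n'" using m_le(1)[OF n'] by simp
        have "prefix (node k n) (node k' n')"
        proof (rule ccontr)
          assume "\<not> ?thesis"
          then have *: "prefix (node k' n') (node k n)" using comp ns by blast
          then have "lv n' \<le> lv n" using prefix_length_le unfolding node_def by fastforce
          then have "n' \<le> n" using lv by (simp add: strict_mono_less_eq)
          then show False using True m_le(1)[OF n'] by simp
        qed
        then have "node k n = nd (\<beta> k') (lv n)" unfolding node_def by (metis length_nd prefix_nd_iff)
        then have "prefix (node k n) (\<theta> k')"
          unfolding \<theta>_def node_def using True lv by (auto intro!: prefix_nd simp: strict_mono_less_eq)
        moreover have "prefix (\<theta> k') (node k' n')" unfolding \<theta>_def by (rule prefix_node[OF m_le(1)[OF n']])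
        ultimately have "\<theta> k' \<in> s" using conv ns by blast
        then show False using k' by (simp add: O'_def)
      next
        case False
        then have k'_n: "k' < \<kappa> n" using m_le(2)[OF n'] \<kappa> by (meson not_le less_le_trans monoD not_less)
        then show False using comp[OF ns(1,3)] prefix_node_eq ns k_n' ne by metis
      qed
    qed
    have O_one: "k = k'" if "k \<in> O'" "k' \<in> O'" for k k'
      using aux[of k k'] aux[of k' k] that nat_le_linear[of "m k" "m k'"] by metis
    have "O' = {} \<or> (\<exists>k. O' = {k})" using O_one by blast
    then have O_sq: "(\<Sum>k\<in>O'. a k * cI s k)\<^sup>2 \<le> (\<Sum>k<K. (a k)\<^sup>2 * (cI s k)\<^sup>2)"
    proof
      assume "\<exists>k. O' = {k}"
      then obtain k where k: "O' = {k}" by blast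
      then have "k < K" by (auto simp: O'_def)
      then have "(a k)\<^sup>2 * (cI s k)\<^sup>2 \<le> (\<Sum>k<K. (a k)\<^sup>2 * (cI s k)\<^sup>2)"
        by (intro member_le_sum[of k _ "\<lambda>k. (a k)\<^sup>2 * (cI s k)\<^sup>2"]) auto
      then show ?thesis using k by (simp add: power_mult_distrib)
    qed (simp add: sum_nonneg)
    have "(\<Sum>k\<in>E. a k * cI s k)\<^sup>2 \<le> (\<Sum>k\<in>E. (a k)\<^sup>2) * (\<Sum>k\<in>E. (cI s k)\<^sup>2)"
      by (rule Cauchy_Schwarz_ineq_sum)
    also have "\<dots> \<le> (\<Sum>k\<in>E. (a k)\<^sup>2) * B\<^sup>2"
    proof (rule mult_left_mono)
      show "(\<Sum>k\<in>E. (cI s k)\<^sup>2) \<le> B\<^sup>2"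
        unfolding cI_def B_def
      proof (rule J.sum_family_le[OF _ I_seg[OF s] _ cc])
        fix i j assume "i \<in> E" "j \<in> E" "i \<noteq> j"
        show "I s i \<inter> I s j = {}"
        proof (rule ccontr)
          assume "I s i \<inter> I s j \<noteq> {}"
          then obtain n where "n \<in> I s i" "n \<in> I s j" by blast
          then have n: "node i n \<in> s" "node j n \<in> s" "i < \<kappa> n" "j < \<kappa> n" by (auto simp: I_def)
          then show False using comp[OF n(1,2)] prefix_node_eq \<open>i \<noteq> j\<close> by metis
        qed
      qed (simp add: E_def)
    qed (simp add: sum_nonneg)
    finally have E_sq: "(\<Sum>k\<in>E. a k * cI s k)\<^sup>2 \<le> B\<^sup>2 * (\<Sum>k\<in>E. (a k)\<^sup>2)" by (simp add: mult.commute)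
    have "(\<Sum>k<K. a k * cI s k) = (\<Sum>k\<in>O' \<union> E. a k * cI s k)"
      by (rule sum.mono_neutral_right) (auto simp: O'_def E_def cI_def)
    also have "\<dots> = (\<Sum>k\<in>O'. a k * cI s k) + (\<Sum>k\<in>E. a k * cI s k)"
      by (rule sum.union_disjoint) (auto simp: O'_def E_def)
    finally have "(\<Sum>k<K. a k * cI s k)\<^sup>2 \<le> 2 * (\<Sum>k\<in>O'. a k * cI s k)\<^sup>2 + 2 * (\<Sum>k\<in>E. a k * cI s k)\<^sup>2"
      using sum_squares_bound[of "\<Sum>k\<in>O'. a k * cI s k" "\<Sum>k\<in>E. a k * cI s k"] by (simp add: power2_sum)
    then show ?thesis using O_sq E_sq unfolding E_def by linarith
  qed
  show ?thesis
    unfolding node_def[symmetric] cc_def[symmetric] B_def[symmetric]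
  proof (rule JT.nrm_leI)
    fix F assume F: "JT.adm F"
    then have F': "finite F" "\<And>s. s \<in> F \<Longrightarrow> jt_seg s"
      "\<And>s s'. s \<in> F \<Longrightarrow> s' \<in> F \<Longrightarrow> s \<noteq> s' \<Longrightarrow> s \<inter> s' = {}"
      unfolding JT.adm_def pairwise_def disjnt_def by auto
    have "JT.Q F ?x
        = (\<Sum>s\<in>F. (\<Sum>k<K. a k * cI s k)\<^sup>2)"
      unfolding JT.Q_def using seg F'(2) by (intro sum.cong) (auto simp: jt_seg_def)
    also have "\<dots> \<le> (\<Sum>s\<in>F. 2 * (\<Sum>k<K. (a k)\<^sup>2 * (cI s k)\<^sup>2) + 2 * (B\<^sup>2 * (\<Sum>k | k < K \<and> \<theta> k \<in> s. (a k)\<^sup>2)))"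
      by (intro sum_mono one F'(2))
    also have "\<dots> = 2 * (\<Sum>s\<in>F. \<Sum>k<K. (a k)\<^sup>2 * (cI s k)\<^sup>2) + 2 * (B\<^sup>2 * (\<Sum>s\<in>F. \<Sum>k | k < K \<and> \<theta> k \<in> s. (a k)\<^sup>2))"
      by (simp add: sum.distrib sum_distrib_left)
    also have "(\<Sum>s\<in>F. \<Sum>k<K. (a k)\<^sup>2 * (cI s k)\<^sup>2) = (\<Sum>k<K. (a k)\<^sup>2 * (\<Sum>s\<in>F. (cI s k)\<^sup>2))"
      by (subst sum.swap) (simp add: sum_distrib_left)
    \<comment> \<open>Exchanging the sums counts the segments that contain
      \<open>\<theta> k\<close>; there is at most one.\<close>
    also have "(\<Sum>s\<in>F. \<Sum>k | k < K \<and> \<theta> k \<in> s. (a k)\<^sup>2) = (\<Sum>k<K. (a k)\<^sup>2 * real (card {s\<in>F. \<theta> k \<in> s}))"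
    proof -
      have "(\<Sum>s\<in>F. \<Sum>k | k < K \<and> \<theta> k \<in> s. (a k)\<^sup>2) = (\<Sum>s\<in>F. \<Sum>k<K. if \<theta> k \<in> s then (a k)\<^sup>2 else 0)"
        by (intro sum.cong refl sum.mono_neutral_cong_left) auto
      also have "\<dots> = (\<Sum>k<K. \<Sum>s\<in>F. if \<theta> k \<in> s then (a k)\<^sup>2 else 0)" by (rule sum.swap)
      also have "\<dots> = (\<Sum>k<K. (a k)\<^sup>2 * real (card {s\<in>F. \<theta> k \<in> s}))"
        using F'(1) by (intro sum.cong refl) (simp add: sum.If_cases Int_def)
      finally show ?thesis .
    qed
    also have "2 * (\<Sum>k<K. (a k)\<^sup>2 * (\<Sum>s\<in>F. (cI s k)\<^sup>2)) + 2 * (B\<^sup>2 * (\<Sum>k<K. (a k)\<^sup>2 * real (card {s\<in>F. \<theta> k \<in> s})))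
        \<le> 2 * (\<Sum>k<K. (a k)\<^sup>2 * B\<^sup>2) + 2 * (B\<^sup>2 * (\<Sum>k<K. (a k)\<^sup>2 * 1))"
    proof (intro add_mono mult_left_mono sum_mono)
      fix k
      show "(\<Sum>s\<in>F. (cI s k)\<^sup>2) \<le> B\<^sup>2"
        unfolding cI_def B_def
        using F' I_seg by (intro J.sum_family_le[OF _ _ _ cc]) (auto simp: I_def)
      have "card {s\<in>F. \<theta> k \<in> s} \<le> Suc 0"
        using F' by (subst card_le_Suc0_iff_eq) auto
      then show "real (card {s\<in>F. \<theta> k \<in> s}) \<le> 1" by simp
    qed auto
    also have "\<dots> = 4 * B\<^sup>2 * (\<Sum>k<K. (a k)\<^sup>2)"
      by (simp flip: sum_distrib_right)
    also have "\<dots> \<le> 4 * B\<^sup>2 * A\<^sup>2" by (intro mult_left_mono a) auto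
    also have "\<dots> = (2 * A * B)\<^sup>2" by (simp add: power_mult_distrib)
    finally show "JT.Q F ?x \<le> (2 * A * B)\<^sup>2" .
  qed (use A B in auto)
qed

text \<open>The order of choice is: start level \<open>l\<close>, then an index whose head below
  \<open>l\<close> is small, then \<open>l'\<close> cutting off the tail of that vector.
  \<open>\<sigma>\<close> prescribes start levels, later used to wait until the first
  \<open>n\<close> branches are separated.\<close>

lemma gliding_hump:
  assumes u_JT: "\<And>n. u n \<in> JT" and u_0: "\<And>t. (\<lambda>n. u n t) \<longlonglongrightarrow> 0" and e: "0 < e"
  obtains \<phi> l l' where "strict_mono (\<phi> :: nat \<Rightarrow> nat)"
    "\<And>n. l n < l' n" "\<And>n. l' n \<le> l (Suc n)" "\<And>n. (\<sigma> n :: nat) \<le> l n"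
    "\<And>n. jt_norm (\<lambda>t. u (\<phi> n) t - JT.blk (l n) (l' n) (u (\<phi> n)) t) \<le> e * (1/2)^n"
proof -
  define P where "P n x \<longleftrightarrow> (case x of (p, l, l') \<Rightarrow> l < l' \<and> \<sigma> n \<le> l \<and>
      jt_norm (\<lambda>t. u p t - JT.blk l l' (u p) t) \<le> e * (1/2)^n)" for n and x :: "nat \<times> nat \<times> nat"
  define R where "R x y \<longleftrightarrow> (case x of (p, l, l') \<Rightarrow> case y of (q, k, k') \<Rightarrow> p < q \<and> l' \<le> k)"
    for x y :: "nat \<times> nat \<times> nat"
  have ex: "\<exists>p l l'. P n (p, l, l') \<and> p0 < p \<and> l0 \<le> l" for n p0 l0
  proof -
    define d where "d = e * (1/2)^n / 2"
    have d: "0 < d" using e by (simp add: d_def)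
    define l where "l = max (\<sigma> n) l0"
    have "\<forall>\<^sub>F p in sequentially. jt_norm (JT.blk 0 l (u p)) < d"
      using JT.nrm_head_tendsto_0[of u l, OF u_0] d by (rule order_tendstoD)
    then have "\<forall>\<^sub>F p in sequentially. jt_norm (JT.blk 0 l (u p)) < d \<and> p0 < p"
      using eventually_gt_at_top[of p0] by eventually_elim simp
    then obtain p where p: "jt_norm (JT.blk 0 l (u p)) < d" "p0 < p"
      using eventually_happens by force
    obtain k where k: "\<And>m. k \<le> m \<Longrightarrow> jt_norm (JT.tail m (u p)) \<le> d"
      using JT.nrm_tail_small[OF u_JT d] by blast
    define l' where "l' = max k (Suc l)"
    have "(\<lambda>t. u p t - JT.blk l l' (u p) t) = (\<lambda>t. JT.blk 0 l (u p) t + JT.tail l' (u p) t)"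
      unfolding l'_def by (rule ext) (auto simp: JT.blk_def JT.tail_def)
    then have "jt_norm (\<lambda>t. u p t - JT.blk l l' (u p) t) \<le> jt_norm (JT.blk 0 l (u p)) + jt_norm (JT.tail l' (u p))"
      using JT.nrm_triangle[OF JT.blk_X[OF u_JT] JT.tail_X[OF u_JT]] by simp
    also have "\<dots> \<le> d + d" using p(1) k[of l'] by (simp add: l'_def)
    finally show ?thesis using p(2)
      by (intro exI[of _ p] exI[of _ l] exI[of _ l']) (auto simp: P_def d_def l_def l'_def)
  qed
  have "\<exists>f. \<forall>n. P n (f n) \<and> R (f n) (f (Suc n))"
  proof (rule dependent_nat_choice)
    show "\<exists>x. P 0 x" using ex by blast
    show "\<exists>y. P (Suc n) y \<and> R x y" for x n
    proof -
      obtain p l l' where x: "x = (p, l, l')" by (cases x)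
      obtain q k k' where "P (Suc n) (q, k, k')" "p < q" "l' \<le> k" using ex by blast
      then show ?thesis unfolding x R_def by (intro exI[of _ "(q, k, k')"]) simp
    qed
  qed
  then obtain f where f: "\<And>n. P n (f n)" "\<And>n. R (f n) (f (Suc n))" by blast
  note f' = f[unfolded P_def R_def case_prod_unfold]
  show ?thesis
  proof (rule that[of "\<lambda>n. fst (f n)" "\<lambda>n. fst (snd (f n))" "\<lambda>n. snd (snd (f n))"])
    show "strict_mono (\<lambda>n. fst (f n))"
      unfolding strict_mono_Suc_iff using f'(2) by simp
  qed (use f' in auto)
qed

text \<open>The \<open>J\<close>-term carries the factor \<open>A\<close>, so with zero masses and
  \<open>A = 0\<close> a pure l2-estimate remains. Both cases are used below.\<close>

lemma upper_estimate_subsequence: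
  assumes u_JT: "\<And>n. u n \<in> JT" and u_le: "\<And>n. jt_norm (u n) \<le> M"
    and u_0: "\<And>t. (\<lambda>n. u n t) \<longlonglongrightarrow> 0"
    and lim: "\<And>\<gamma>. (\<lambda>n. bsum \<gamma> (u n)) \<longlonglongrightarrow> a \<gamma>"
    and sq: "\<And>S. finite S \<Longrightarrow> (\<Sum>\<gamma>\<in>S. (a \<gamma>)\<^sup>2) \<le> A\<^sup>2" and A: "0 \<le> A"
    and e: "0 < e"
  obtains \<phi> l l' C where "strict_mono (\<phi> :: nat \<Rightarrow> nat)" "\<And>n. l n < l' n" "\<And>n. l' n \<le> l (Suc n)"
    "\<And>n. jt_norm (\<lambda>t. u (\<phi> n) t - JT.blk (l n) (l' n) (u (\<phi> n)) t) \<le> e * (1/2)^n" "0 \<le> C"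
    "\<And>N c. jt_norm (\<lambda>t. \<Sum>k<N. c k * JT.blk (l k) (l' k) (u (\<phi> k)) t)
        \<le> C * sqrt (\<Sum>k<N. (c k)\<^sup>2) + 2 * A * j_norm (J.blk 0 N c)"
proof -
  \<comment> \<open>The branches with exactly one bit \<open>True\<close> are added to make the set
    infinite, so that the naturals enumerate it bijectively.\<close>
  define \<Gamma> where "\<Gamma> = {\<gamma>. a \<gamma> \<noteq> 0} \<union> range (\<lambda>(k::nat) i. i = k)"
  have "countable {\<gamma>. a \<gamma> \<noteq> 0}"
  proof -
    have "finite {\<gamma>. 1 / real (Suc j) \<le> \<bar>a \<gamma>\<bar>}" for j
    proof (rule ccontr)
      assume inf: "infinite {\<gamma>. 1 / real (Suc j) \<le> \<bar>a \<gamma>\<bar>}"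
      define K where "K = Suc (nat \<lceil>(real (Suc j))\<^sup>2 * A\<^sup>2\<rceil>)"
      obtain S where S: "S \<subseteq> {\<gamma>. 1 / real (Suc j) \<le> \<bar>a \<gamma>\<bar>}" "finite S" "card S = K"
        using infinite_arbitrarily_large[OF inf] by blast
      have "(1 / real (Suc j))\<^sup>2 \<le> (a \<gamma>)\<^sup>2" if "\<gamma> \<in> S" for \<gamma>
        using S(1) that power_mono[of "1 / real (Suc j)" "\<bar>a \<gamma>\<bar>" 2] by auto
      from sum_mono[of S "\<lambda>_. (1 / real (Suc j))\<^sup>2", OF this]
      have "real K * (1 / real (Suc j))\<^sup>2 \<le> (\<Sum>\<gamma>\<in>S. (a \<gamma>)\<^sup>2)" using S(3) by simp
      also have "\<dots> \<le> A\<^sup>2" by (rule sq[OF S(2)])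
      finally have "real K \<le> (real (Suc j))\<^sup>2 * A\<^sup>2" by (simp add: field_simps)
      moreover have "(real (Suc j))\<^sup>2 * A\<^sup>2 < real K" unfolding K_def by linarith
      ultimately show False by linarith
    qed
    then have "countable (\<Union>j. {\<gamma>. 1 / real (Suc j) \<le> \<bar>a \<gamma>\<bar>})" by (simp add: countable_finite)
    moreover have "{\<gamma>. a \<gamma> \<noteq> 0} \<subseteq> (\<Union>j. {\<gamma>. 1 / real (Suc j) \<le> \<bar>a \<gamma>\<bar>})"
    proof
      fix \<gamma> assume "\<gamma> \<in> {\<gamma>. a \<gamma> \<noteq> 0}"
      then obtain j where "inverse (real (Suc j)) < \<bar>a \<gamma>\<bar>" using reals_Archimedean[of "\<bar>a \<gamma>\<bar>"] by auto
      then show "\<gamma> \<in> (\<Union>j. {\<gamma>. 1 / real (Suc j) \<le> \<bar>a \<gamma>\<bar>})"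
        by (auto intro!: exI[of _ j] simp: inverse_eq_divide)
    qed
    ultimately show ?thesis using countable_subset by blast
  qed
  then have "countable \<Gamma>" by (simp add: \<Gamma>_def)
  moreover have "inj (\<lambda>(k::nat) i. i = k)" by (rule injI) metis
  then have "infinite \<Gamma>" using finite_imageD by (auto simp: \<Gamma>_def)
  ultimately have bij: "bij_betw (from_nat_into \<Gamma>) UNIV \<Gamma>" by (rule bij_betw_from_nat_into)
  define \<beta> where "\<beta> = from_nat_into \<Gamma>"
  have \<beta>_inj: "inj \<beta>" and \<beta>_range: "range \<beta> = \<Gamma>" using bij by (auto simp: \<beta>_def bij_betw_def)
  define b where "b k = a (\<beta> k)" for k
  have b_sq: "(\<Sum>k<K. (b k)\<^sup>2) \<le> A\<^sup>2" for K
    using sq[of "\<beta> ` {..<K}"] sum.reindex[OF inj_on_subset[OF \<beta>_inj], of "{..<K}" "\<lambda>\<gamma>. (a \<gamma>)\<^sup>2"]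
    by (simp add: b_def)
  have "summable (\<lambda>k. (b k)\<^sup>2)" by (rule summableI_nonneg_bounded[of _ "A\<^sup>2"]) (auto simp: b_sq)
  then have b_lim: "(\<lambda>k. (b k)\<^sup>2) \<longlonglongrightarrow> 0" by (rule summable_LIMSEQ_zero)
  have b_0: "\<forall>\<^sub>F k in sequentially. \<bar>b k\<bar> < d" if d: "0 < d" for d
  proof -
    have "\<forall>\<^sub>F k in sequentially. (b k)\<^sup>2 < d\<^sup>2" using d by (intro order_tendstoD(2)[OF b_lim]) simp
    then show ?thesis
      by eventually_elim (use d power_less_imp_less_base[of "\<bar>_\<bar>" 2 d] in auto)
  qed
  have "\<exists>L. \<forall>l\<ge>L. \<forall>k<n. \<forall>k'<n. nd (\<beta> k) l = nd (\<beta> k') l \<longrightarrow> k = k'" for n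
  proof -
    obtain L where "\<forall>\<gamma>\<in>\<beta> ` {..<n}. \<forall>\<gamma>'\<in>\<beta> ` {..<n}. \<forall>l\<ge>L. nd \<gamma> l = nd \<gamma>' l \<longrightarrow> \<gamma> = \<gamma>'"
      using nd_separated[of "\<beta> ` {..<n}"] by auto
    then show ?thesis using \<beta>_inj by (intro exI[of _ L]) (auto dest: injD)
  qed
  then obtain \<sigma> where \<sigma>: "\<And>n l k k'. \<sigma> n \<le> l \<Longrightarrow> k < n \<Longrightarrow> k' < n \<Longrightarrow> nd (\<beta> k) l = nd (\<beta> k') l \<Longrightarrow> k = k'"
    by metis
  obtain \<phi> l l' where \<phi>: "strict_mono \<phi>" and ll': "\<And>n. l n < l' n" and l'l: "\<And>n. l' n \<le> l (Suc n)"
    and l\<sigma>: "\<And>n. \<sigma> n \<le> l n"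
    and err: "\<And>n. jt_norm (\<lambda>t. u (\<phi> n) t - JT.blk (l n) (l' n) (u (\<phi> n)) t) \<le> e * (1/2)^n"
    by (rule gliding_hump[of u e \<sigma>, OF u_JT u_0 e]) blast
  define v where "v n = JT.blk (l n) (l' n) (u (\<phi> n))" for n
  have v_JT: "v n \<in> JT" and v_le: "jt_norm (v n) \<le> M" for n
    unfolding v_def using JT.blk_X[OF u_JT] JT.nrm_blk_le[OF u_JT] u_le order_trans by blast+
  have l_mono: "strict_mono l"
    unfolding strict_mono_Suc_iff using ll' l'l less_le_trans by blast
  have sep: "k = k'" if "k < n" "k' < n" "nd (\<beta> k) (l n) = nd (\<beta> k') (l n)" for n k k'
    using \<sigma>[OF l\<sigma>] that by blast
  \<comment> \<open>Only the first \<open>n\<close> masses are placed, because the choice of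
    \<open>\<sigma> n\<close> guarantees separation at level \<open>l n\<close> for just these
    branches.\<close>
  define D where "D n = (\<lambda>t. \<Sum>k<n. b k * (if t = nd (\<beta> k) (l n) then 1 else 0))" for n
  have D_JT: "D n \<in> JT" for n unfolding D_def by (rule JT.sum_X) (auto simp: JT.single_X)
  \<comment> \<open>Stated for every subsequence, since the one produced by
    \<open>l2_subsequence\<close> is found only after \<open>w\<close> is known.\<close>
  have D_upper: "jt_norm (\<lambda>t. \<Sum>n<N. c n * D (\<psi> n) t) \<le> 2 * A * j_norm (J.blk 0 N c)"
    if \<psi>: "strict_mono \<psi>" for \<psi> N c
    unfolding D_def
  proof (rule j_upper_estimate[OF _ _ _ b_sq A])
    show "mono \<psi>" using \<psi> by (rule strict_mono_mono)
    show "strict_mono (\<lambda>n. l (\<psi> n))" using strict_mono_o[OF l_mono \<psi>] by (simp add: o_def)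
    show "k = k'" if "k < \<psi> n" "k' < \<psi> n" "nd (\<beta> k) (l (\<psi> n)) = nd (\<beta> k') (l (\<psi> n))" for n k k'
      using sep that by blast
  qed
  have D_le: "jt_norm (D n) \<le> 2 * A" for n
  proof -
    define c where "c k = (if k = n then 1 else 0::real)" for k
    have "(\<lambda>t. \<Sum>k<Suc n. c k * D k t) = D n" by (simp add: c_def fun_eq_iff)
    moreover have "J.blk 0 (Suc n) c = c" by (auto simp: J.blk_def c_def)
    moreover have "j_norm c \<le> 1" unfolding c_def by (rule J.nrm_single)
    ultimately show ?thesis
      using D_upper[of id c "Suc n"] mult_left_mono[of "j_norm c" 1 "2 * A"] A
      by (simp add: strict_mono_def)
  qed
  define w where "w n = (\<lambda>t. v n t - D n t)" for n
  interpret blocks w l l' "M + 2 * A"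
  proof
    show "w n \<in> JT" for n unfolding w_def by (rule JT.diff_X[OF v_JT D_JT])
    show "jt_norm (w n) \<le> M + 2 * A" for n
      unfolding w_def using JT.nrm_diff_le[OF v_JT D_JT] v_le[of n] D_le[of n] by (meson add_mono order_trans)
    show "l n \<le> length t \<and> length t < l' n" if "w n t \<noteq> 0" for n t
    proof (rule ccontr)
      assume out: "\<not> ?thesis"
      have "D n t = 0" unfolding D_def
        by (rule sum.neutral) (use out ll'[of n] in auto)
      moreover have "v n t = 0" using out by (auto simp: v_def JT.blk_def)
      ultimately show False using that by (simp add: w_def)
    qed
  qed (use ll' l'l in auto)
  have bsum_D: "bsum \<gamma> (D n) = (\<Sum>k<n. b k * (if nd \<gamma> (l n) = nd (\<beta> k) (l n) then 1 else 0))" for \<gamma> n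
  proof -
    have "(\<lambda>k. D n (nd \<gamma> k)) sums (\<Sum>k\<in>{l n}. D n (nd \<gamma> k))"
    proof (rule sums_finite)
      fix k assume "k \<notin> {l n}"
      then show "D n (nd \<gamma> k) = 0" unfolding D_def by (intro sum.neutral) (auto dest: arg_cong[of _ _ length])
    qed simp
    then show ?thesis by (simp add: bsum_def sums_iff D_def)
  qed
  have bsum_D_match: "bsum \<gamma> (D n) = b k" if "k < n" "nd \<gamma> (l n) = nd (\<beta> k) (l n)" for \<gamma> n k
  proof -
    have "(\<Sum>i<n. b i * (if nd \<gamma> (l n) = nd (\<beta> i) (l n) then 1 else 0))
        = (\<Sum>i\<in>{k}. b i * (if nd \<gamma> (l n) = nd (\<beta> i) (l n) then 1 else 0))"
      using that sep by (intro sum.mono_neutral_right) auto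
    then show ?thesis using that by (simp add: bsum_D)
  qed
  have bsum_D_lim: "(\<lambda>n. bsum \<gamma> (D n)) \<longlonglongrightarrow> a \<gamma>" for \<gamma>
  proof (cases "\<gamma> \<in> range \<beta>")
    case True
    then obtain k where k: "\<gamma> = \<beta> k" by blast
    have "\<forall>\<^sub>F n in sequentially. bsum \<gamma> (D n) = a \<gamma>"
      using eventually_gt_at_top[of k] by eventually_elim (simp add: bsum_D_match k b_def)
    then show ?thesis by (rule tendsto_eventually)
  next
    case False
    then have "a \<gamma> = 0" using \<beta>_range by (auto simp: \<Gamma>_def)
    moreover have "(\<lambda>n. bsum \<gamma> (D n)) \<longlonglongrightarrow> 0"
    proof (rule tendstoI)
      fix d :: real assume d: "0 < d"
      obtain k0 where k0: "\<And>k. k0 \<le> k \<Longrightarrow> \<bar>b k\<bar> < d"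
        using b_0[OF d] by (auto simp: eventually_sequentially)
      \<comment> \<open>From level \<open>L\<close> on, \<gamma> avoids the first \<open>k0\<close>
        branches, so any mass it meets in \<open>D n\<close> has index at least \<open>k0\<close>
        and is smaller than \<open>d\<close>.\<close>
      obtain L where L: "\<forall>\<gamma>1\<in>insert \<gamma> (\<beta> ` {..<k0}). \<forall>\<gamma>2\<in>insert \<gamma> (\<beta> ` {..<k0}). \<forall>l\<ge>L. nd \<gamma>1 l = nd \<gamma>2 l \<longrightarrow> \<gamma>1 = \<gamma>2"
        using nd_separated[of "insert \<gamma> (\<beta> ` {..<k0})"] by auto
      have "dist (bsum \<gamma> (D n)) 0 < d" if n: "L \<le> n" for n
      proof (cases "\<exists>k<n. nd \<gamma> (l n) = nd (\<beta> k) (l n)")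
        case True
        then obtain k where k: "k < n" "nd \<gamma> (l n) = nd (\<beta> k) (l n)" by blast
        have "L \<le> l n" using n le_l[of n] by simp
        then have "k0 \<le> k" using L k(2) False by (metis imageI insertCI lessThan_iff not_le rangeI)
        then show ?thesis using k0 bsum_D_match[OF k] by simp
      next
        case False
        then have "bsum \<gamma> (D n) = 0" unfolding bsum_D by (intro sum.neutral) auto
        then show ?thesis using d by simp
      qed
      then show "\<forall>\<^sub>F n in sequentially. dist (bsum \<gamma> (D n)) 0 < d"
        by (auto simp: eventually_sequentially)
    qed
    ultimately show ?thesis by simp
  qed
  have w_lim: "(\<lambda>n. bsum \<gamma> (w n)) \<longlonglongrightarrow> 0" for \<gamma>
  proof -
    have "(\<lambda>n. bsum \<gamma> (u (\<phi> n)) - bsum \<gamma> (v n)) \<longlonglongrightarrow> 0"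
    proof (rule Lim_null_comparison)
      show "\<forall>\<^sub>F n in sequentially. norm (bsum \<gamma> (u (\<phi> n)) - bsum \<gamma> (v n)) \<le> e * (1/2)^n"
      proof (rule always_eventually, rule allI)
        fix n
        show "norm (bsum \<gamma> (u (\<phi> n)) - bsum \<gamma> (v n)) \<le> e * (1/2)^n"
          using abs_bsum_le[OF JT.diff_X[OF u_JT v_JT], of \<gamma> "\<phi> n" n] err[of n]
            bsum_diff[OF u_JT v_JT, of \<gamma> "\<phi> n" n] by (simp add: v_def)
      qed
      have "(\<lambda>n. e * (1/2::real)^n) \<longlonglongrightarrow> e * 0" by (intro tendsto_mult tendsto_const LIMSEQ_power_zero) simp
      then show "(\<lambda>n. e * (1/2::real)^n) \<longlonglongrightarrow> 0" by simp
    qed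
    moreover have "(\<lambda>n. bsum \<gamma> (u (\<phi> n))) \<longlonglongrightarrow> a \<gamma>"
      using LIMSEQ_subseq_LIMSEQ[OF lim \<phi>] by (simp add: o_def)
    ultimately have "(\<lambda>n. bsum \<gamma> (u (\<phi> n)) - (bsum \<gamma> (u (\<phi> n)) - bsum \<gamma> (v n)) - bsum \<gamma> (D n)) \<longlonglongrightarrow> a \<gamma> - 0 - a \<gamma>"
      using bsum_D_lim by (intro tendsto_diff)
    then show ?thesis unfolding w_def by (simp add: bsum_diff[OF v_JT D_JT])
  qed
  show ?thesis
  proof (rule l2_subsequence[OF w_lim])
    fix \<psi> :: "nat \<Rightarrow> nat" assume \<psi>: "strict_mono \<psi>"
      and l2: "\<And>N c. jt_norm (\<lambda>t. \<Sum>k<N. c k * w (\<psi> k) t) \<le> sqrt (6 * (M + 2 * A)\<^sup>2 + 4) * sqrt (\<Sum>k<N. (c k)\<^sup>2)"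
    show ?thesis
    proof (rule that[of "\<phi> \<circ> \<psi>" "l \<circ> \<psi>" "l' \<circ> \<psi>" "sqrt (6 * (M + 2 * A)\<^sup>2 + 4)"])
      show "strict_mono (\<phi> \<circ> \<psi>)" by (rule strict_mono_o[OF \<phi> \<psi>])
      show "(l' \<circ> \<psi>) n \<le> (l \<circ> \<psi>) (Suc n)" for n
        using l'_le_l \<psi> by (simp add: strict_mono_Suc_iff)
      show "jt_norm (\<lambda>t. u ((\<phi> \<circ> \<psi>) n) t - JT.blk ((l \<circ> \<psi>) n) ((l' \<circ> \<psi>) n) (u ((\<phi> \<circ> \<psi>) n)) t) \<le> e * (1/2)^n" for n
      proof -
        have "e * (1/2::real)^\<psi> n \<le> e * (1/2)^n"
          using e strict_mono_imp_increasing[OF \<psi>, of n] by (intro mult_left_mono power_decreasing) auto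
        then show ?thesis using err[of "\<psi> n"] by simp
      qed
      fix N c
      have w_JT': "(\<lambda>t. \<Sum>k<N. c k * w (\<psi> k) t) \<in> JT" and D_JT': "(\<lambda>t. \<Sum>k<N. c k * D (\<psi> k) t) \<in> JT"
        by (rule JT.sum_X[OF finite_lessThan], rule w_JT D_JT)+
      have "(\<Sum>k<N. c k * v (\<psi> k) t) = (\<Sum>k<N. c k * w (\<psi> k) t) + (\<Sum>k<N. c k * D (\<psi> k) t)" for t
        unfolding sum.distrib[symmetric] by (rule sum.cong) (simp_all add: w_def algebra_simps)
      then have "jt_norm (\<lambda>t. \<Sum>k<N. c k * v (\<psi> k) t)
          \<le> jt_norm (\<lambda>t. \<Sum>k<N. c k * w (\<psi> k) t) + jt_norm (\<lambda>t. \<Sum>k<N. c k * D (\<psi> k) t)"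
        using JT.nrm_triangle[OF w_JT' D_JT'] by simp
      then show "jt_norm (\<lambda>t. \<Sum>k<N. c k * JT.blk ((l \<circ> \<psi>) k) ((l' \<circ> \<psi>) k) (u ((\<phi> \<circ> \<psi>) k)) t)
          \<le> sqrt (6 * (M + 2 * A)\<^sup>2 + 4) * sqrt (\<Sum>k<N. (c k)\<^sup>2) + 2 * A * j_norm (J.blk 0 N c)"
        using l2[where N=N and c=c] D_upper[OF \<psi>, where N=N and c=c] unfolding v_def by simp
    qed (use ll' in auto)
  qed
qed

section \<open>The two alternatives\<close>

text \<open>Limit form of \<open>sum_bsum_tail_le\<close>: the heads below a separating level tend
  to 0 in norm, so cutting them off leaves the limits of the branch sums unchanged.\<close>

lemma sum_branch_limits_sq_le:
  assumes u_JT: "\<And>n. u n \<in> JT" and u_le: "\<And>n. jt_norm (u n) \<le> M"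
    and u_0: "\<And>t. (\<lambda>n. u n t) \<longlonglongrightarrow> 0"
    and lim: "\<And>\<gamma>. (\<lambda>n. bsum \<gamma> (u n)) \<longlonglongrightarrow> a \<gamma>" and S: "finite S"
  shows "(\<Sum>\<gamma>\<in>S. (a \<gamma>)\<^sup>2) \<le> M\<^sup>2"
proof -
  obtain L where L: "\<forall>\<gamma>\<in>S. \<forall>\<gamma>'\<in>S. \<forall>l\<ge>L. nd \<gamma> l = nd \<gamma>' l \<longrightarrow> \<gamma> = \<gamma>'"
    using nd_separated[OF S] by blast
  show ?thesis
  proof (rule tendsto_upperbound)
    have "(\<lambda>n. bsum \<gamma> (JT.tail L (u n))) \<longlonglongrightarrow> a \<gamma>" for \<gamma>
    proof -
      have "(\<lambda>n. bsum \<gamma> (JT.blk 0 L (u n))) \<longlonglongrightarrow> 0"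
        by (rule Lim_null_comparison[OF _ JT.nrm_head_tendsto_0[of u L, OF u_0]])
          (use abs_bsum_le[OF JT.blk_X[OF u_JT]] in auto)
      from tendsto_diff[OF lim this] show ?thesis by (simp add: bsum_tail[OF u_JT])
    qed
    then show "(\<lambda>n. \<Sum>\<gamma>\<in>S. (bsum \<gamma> (JT.tail L (u n)))\<^sup>2) \<longlonglongrightarrow> (\<Sum>\<gamma>\<in>S. (a \<gamma>)\<^sup>2)"
      by (intro tendsto_sum tendsto_power)
    have "(\<Sum>\<gamma>\<in>S. (bsum \<gamma> (JT.tail L (u n)))\<^sup>2) \<le> M\<^sup>2" for n
    proof -
      have "(\<Sum>\<gamma>\<in>S. (bsum \<gamma> (JT.tail L (u n)))\<^sup>2) \<le> (jt_norm (u n))\<^sup>2"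
        by (rule sum_bsum_tail_le[OF u_JT S]) (use L in auto)
      also have "\<dots> \<le> M\<^sup>2" using u_le JT.nrm_nonneg[OF u_JT] by (intro power_mono) auto
      finally show ?thesis .
    qed
    then show "\<forall>\<^sub>F n in sequentially. (\<Sum>\<gamma>\<in>S. (bsum \<gamma> (JT.tail L (u n)))\<^sup>2) \<le> M\<^sup>2" by simp
  qed simp
qed

lemma rapid_subsequence:
  fixes E :: "nat \<Rightarrow> real"
  assumes "E \<longlonglongrightarrow> 0" "0 < d"
  obtains r where "strict_mono (r :: nat \<Rightarrow> nat)" "\<And>n. E (r n) \<le> d * (1/2)^n"
proof -
  have ex: "\<exists>k>p. E k \<le> d * (1/2)^n" for n p
  proof -
    have "\<forall>\<^sub>F k in sequentially. E k < d * (1/2)^n" using assms by (intro order_tendstoD(2)[OF assms(1)]) simp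
    then have "\<forall>\<^sub>F k in sequentially. E k < d * (1/2)^n \<and> p < k"
      using eventually_gt_at_top[of p] by eventually_elim simp
    then obtain k where "E k < d * (1/2)^n \<and> p < k" using eventually_happens by force
    then show ?thesis by (auto intro: less_imp_le)
  qed
  have "\<exists>r. \<forall>n. E (r n) \<le> d * (1/2)^n \<and> r n < r (Suc n)"
    by (rule dependent_nat_choice) (use ex in blast)+
  then show ?thesis using that unfolding strict_mono_Suc_iff by blast
qed

text \<open>Adjacent bands from \<open>l k\<close> to \<open>l (Suc k)\<close> have no gaps, so an
  interval of indices corresponds to a segment of \<gamma>, and disjoint intervals to disjoint
  segments. With bands ending at \<open>l' k\<close> the unions could fail to be convex.\<close>

lemma
  assumes l: "strict_mono l" and x: "x \<in> JT"
  shows block_sums_J: "(\<lambda>k. \<Sum>i=l k..<l (Suc k). x (nd \<gamma> i)) \<in> J_space"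
    and j_norm_block_sums_le: "j_norm (\<lambda>k. \<Sum>i=l k..<l (Suc k). x (nd \<gamma> i)) \<le> jt_norm x"
proof -
  define T where "T I = nd \<gamma> ` (\<Union>k\<in>I. {l k..<l (Suc k)})" for I
  have l_le: "l i \<le> l j" if "i \<le> j" for i j using l that by (simp add: strict_mono_less_eq)
  have same: "k = k'" if i: "i \<in> {l k..<l (Suc k)}" "i \<in> {l k'..<l (Suc k')}" for i k k'
  proof (rule ccontr)
    assume "k \<noteq> k'"
    then consider "Suc k \<le> k'" | "Suc k' \<le> k" by linarith
    then show False using l_le[of "Suc k" k'] l_le[of "Suc k'" k] i by cases auto
  qed
  have T_sum: "(\<Sum>t\<in>T I. x t) = (\<Sum>k\<in>I. \<Sum>i=l k..<l (Suc k). x (nd \<gamma> i))" if "finite I" for I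
    unfolding T_def sum_nd_image
  proof (rule sum.UNION_disjoint)
    show "\<forall>k\<in>I. \<forall>k'\<in>I. k \<noteq> k' \<longrightarrow> {l k..<l (Suc k)} \<inter> {l k'..<l (Suc k')} = {}"
      using same by blast
  qed (use that in auto)
  have T_seg: "jt_seg (T I)" if j: "j_seg I" for I
  proof -
    obtain m n where I: "I = {m..n}" using j by (auto simp: j_seg_def)
    have "\<exists>i j. (\<Union>k\<in>I. {l k..<l (Suc k)}) = {i..<j}"
    proof (cases "m \<le> n")
      case True
      have "(\<Union>k\<in>{m..n}. {l k..<l (Suc k)}) = {l m..<l (Suc n)}"
        using True
      proof (induction rule: dec_induct)
        case (step n)
        have "{m..Suc n} = insert (Suc n) {m..n}" using step by auto
        then have "(\<Union>k\<in>{m..Suc n}. {l k..<l (Suc k)}) = {l (Suc n)..<l (Suc (Suc n))} \<union> {l m..<l (Suc n)}"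
          using step.IH by simp
        also have "\<dots> = {l m..<l (Suc (Suc n))}"
          using l_le[of "Suc n" "Suc (Suc n)"] l_le[of m "Suc n"] step(1) by auto
        finally show ?case .
      qed simp
      then show ?thesis unfolding I by blast
    next
      case False
      then have "(\<Union>k\<in>I. {l k..<l (Suc k)}) = {0..<0}" unfolding I by simp
      then show ?thesis by blast
    qed
    then show ?thesis unfolding T_def using jt_seg_nd by auto
  qed
  have le: "J.Q F (\<lambda>k. \<Sum>i=l k..<l (Suc k). x (nd \<gamma> i)) \<le> (jt_norm x)\<^sup>2" if F: "J.adm F" for F
  proof -
    have "J.Q F (\<lambda>k. \<Sum>i=l k..<l (Suc k). x (nd \<gamma> i)) = (\<Sum>I\<in>F. (\<Sum>t\<in>T I. x t)\<^sup>2)"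
      unfolding J.Q_def using F T_sum J.seg_finite by (intro sum.cong) (auto simp: J.adm_def)
    also have "\<dots> \<le> (jt_norm x)\<^sup>2"
    proof (rule JT.sum_family_le[OF _ _ _ x])
      show "finite F" "\<And>I. I \<in> F \<Longrightarrow> jt_seg (T I)" using F T_seg by (auto simp: J.adm_def)
      fix I I' assume II: "I \<in> F" "I' \<in> F" "I \<noteq> I'"
      then have disj: "I \<inter> I' = {}" using F unfolding J.adm_def pairwise_def disjnt_def by blast
      show "T I \<inter> T I' = {}"
      proof (rule ccontr)
        assume "T I \<inter> T I' \<noteq> {}"
        then obtain k k' i i' where k: "k \<in> I" "k' \<in> I'" "i \<in> {l k..<l (Suc k)}" "i' \<in> {l k'..<l (Suc k')}"
          "nd \<gamma> i = nd \<gamma> i'" unfolding T_def by blast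
        then have "i = i'" by (metis length_nd)
        then have "k = k'" using k same by blast
        then show False using k disj by auto
      qed
    qed
    finally show ?thesis .
  qed
  show "(\<lambda>k. \<Sum>i=l k..<l (Suc k). x (nd \<gamma> i)) \<in> J_space"
    "j_norm (\<lambda>k. \<Sum>i=l k..<l (Suc k). x (nd \<gamma> i)) \<le> jt_norm x"
    by (rule J.X_I J.nrm_leI, erule le, rule JT.nrm_nonneg[OF x])+
qed

text \<open>Block sums along \<gamma> are applied to \<open>y - h y * x\<close>; otherwise the block
  sums of \<open>x\<close> would be added to every unit vector. The first thinning makes the branch
  sums and \<open>h\<close> converge rapidly, the second yields the upper estimate and preserves
  this rate because \<open>k \<le> \<phi> k\<close>.\<close>

lemma J_system_subsequence:
  assumes z_JT: "\<And>n. z n \<in> JT" and z_le: "\<And>n. jt_norm (z n) \<le> M"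
    and lim: "\<And>t. (\<lambda>n. z n t) \<longlonglongrightarrow> x t"
    and blim: "\<And>\<gamma>. (\<lambda>n. bsum \<gamma> (z n)) \<longlonglongrightarrow> b \<gamma>" and ne: "b \<gamma> \<noteq> bsum \<gamma> x"
  obtains \<phi> R C D where "strict_mono (\<phi> :: nat \<Rightarrow> nat)" "J_system (z \<circ> \<phi>) R C D"
proof -
  note x = limit_JT[OF z_JT z_le lim] limit_le[OF z_JT z_le lim]
  have M: "0 \<le> M" using JT.nrm_nonneg[OF x(1)] x(2) by simp
  define u0 where "u0 n = (\<lambda>t. z n t - x t)" for n
  note u0_JT = diff_limit_JT[OF z_JT z_le lim, folded u0_def]
    and u0_le = diff_limit_le[OF z_JT z_le lim, folded u0_def]
  have u0_0: "(\<lambda>n. u0 n t) \<longlonglongrightarrow> 0" for t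
    unfolding u0_def by (rule diff_limit_tendsto[OF z_JT z_le lim])
  define a where "a \<delta> = b \<delta> - bsum \<delta> x" for \<delta>
  have u0_a: "(\<lambda>n. bsum \<delta> (u0 n)) \<longlonglongrightarrow> a \<delta>" for \<delta>
    unfolding u0_def a_def bsum_diff[OF z_JT x(1)] by (intro tendsto_diff blim tendsto_const)
  define a0 where "a0 = a \<gamma>"
  have a0: "a0 \<noteq> 0" using ne by (simp add: a0_def a_def)
  obtain t0 where t0: "\<And>t. x t \<noteq> 0 \<Longrightarrow> x t0 \<noteq> 0" by (cases "\<exists>t. x t \<noteq> 0") auto
  \<comment> \<open>If \<open>x = 0\<close>, then \<open>h = 0\<close> because of \<open>inverse 0 = 0\<close>; in any case \<open>h x * x = x\<close>.\<close>
  define h where "h y = y t0 * inverse (x t0)" for y :: "bool list \<Rightarrow> real"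
  have hx: "h x * x t = x t" for t using t0[of t] by (cases "x t = 0") (auto simp: h_def)
  define H where "H = \<bar>inverse (x t0)\<bar>"
  have h_le: "\<bar>h y\<bar> \<le> H * jt_norm y" if "y \<in> JT" for y
    using mult_right_mono[OF JT.abs_le_nrm[OF that, of t0], of H]
    by (simp add: h_def H_def abs_mult mult.commute)
  have H: "0 \<le> H" by (simp add: H_def)
  \<comment> \<open>The error at the \<open>k\<close>-th unit vector contains
    \<open>d * (1/2)^k\<close> once from the branch sum, twice from \<open>q k\<close> and
    \<open>M\<close> times from \<open>h\<close>, in total \<open>(3 + M) * d * (1/2)^k\<close>.
    Division by \<open>a0\<close> leaves the \<open>(1/2)^(k+2)\<close> demanded by
    \<open>J_system_perturbation\<close>.\<close>
  define d where "d = \<bar>a0\<bar> / (4 * (3 + M))"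
  have d: "0 < d" using a0 M by (simp add: d_def)
  define E where "E n = \<bar>bsum \<gamma> (u0 n) - a0\<bar> + \<bar>h (u0 n)\<bar>" for n
  have "E \<longlonglongrightarrow> \<bar>a0 - a0\<bar> + \<bar>0 * inverse (x t0)\<bar>"
    unfolding E_def h_def a0_def
    by (intro tendsto_add tendsto_rabs tendsto_diff tendsto_mult tendsto_const u0_a u0_0)
  then have "E \<longlonglongrightarrow> 0" by simp
  then obtain r where r: "strict_mono r" and Er: "\<And>n. E (r n) \<le> d * (1/2)^n"
    using rapid_subsequence[OF _ d] by blast
  define u where "u n = u0 (r n)" for n
  have u_JT: "u n \<in> JT" and u_le: "jt_norm (u n) \<le> 2 * M" for n by (auto simp: u_def u0_JT u0_le)
  have u_0: "(\<lambda>n. u n t) \<longlonglongrightarrow> 0" for t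
    unfolding u_def using LIMSEQ_subseq_LIMSEQ[OF u0_0 r] by (simp add: o_def)
  have u_a: "(\<lambda>n. bsum \<delta> (u n)) \<longlonglongrightarrow> a \<delta>" for \<delta>
    unfolding u_def using LIMSEQ_subseq_LIMSEQ[OF u0_a r] by (simp add: o_def)
  have sq: "(\<Sum>\<delta>\<in>S. (a \<delta>)\<^sup>2) \<le> (2 * M)\<^sup>2" if "finite S" for S
    by (rule sum_branch_limits_sq_le[of u, OF u_JT u_le u_0 u_a that])
  have M2: "0 \<le> 2 * M" using M by simp
  show ?thesis
  proof (rule upper_estimate_subsequence[of u "2 * M" a "2 * M" d, OF u_JT u_le u_0 u_a sq M2 d])
    fix \<phi> l l' C
    assume \<phi>: "strict_mono (\<phi> :: nat \<Rightarrow> nat)" and ll': "\<And>n. l n < l' n" and l'l: "\<And>n. l' n \<le> l (Suc n)"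
      and err: "\<And>n. jt_norm (\<lambda>t. u (\<phi> n) t - JT.blk (l n) (l' n) (u (\<phi> n)) t) \<le> d * (1/2)^n"
      and C: "0 \<le> (C::real)"
      and up: "\<And>N c. jt_norm (\<lambda>t. \<Sum>k<N. c k * JT.blk (l k) (l' k) (u (\<phi> k)) t)
        \<le> C * sqrt (\<Sum>k<N. (c k)\<^sup>2) + 2 * (2 * M) * j_norm (J.blk 0 N c)"
    have l: "strict_mono l" unfolding strict_mono_Suc_iff using ll' l'l less_le_trans by blast
    define y where "y k = z (r (\<phi> k))" for k
    define v where "v k = JT.blk (l k) (l' k) (u (\<phi> k))" for k
    define q where "q k = (\<lambda>t. u (\<phi> k) t - v k t)" for k
    have y_eq: "y k t = x t + v k t + q k t" for k t
      by (simp add: y_def q_def u_def u0_def)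
    have y_JT: "y k \<in> JT" for k by (simp add: y_def z_JT)
    have v_JT: "v k \<in> JT" for k unfolding v_def by (rule JT.blk_X[OF u_JT])
    have q_JT: "q k \<in> JT" for k unfolding q_def by (rule JT.diff_X[OF u_JT v_JT])
    have q_le: "jt_norm (q k) \<le> d * (1/2)^k" for k using err by (simp add: q_def v_def)
    have small: "\<bar>bsum \<gamma> (u (\<phi> k)) - a0\<bar> + \<bar>h (u (\<phi> k))\<bar> \<le> d * (1/2)^k" for k
    proof -
      have "E (r (\<phi> k)) \<le> d * (1/2)^\<phi> k" by (rule Er)
      also have "\<dots> \<le> d * (1/2)^k"
        using d strict_mono_imp_increasing[OF \<phi>, of k] by (intro mult_left_mono power_decreasing) auto
      finally show ?thesis by (simp add: E_def u_def)
    qed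
    have upper: "jt_norm (\<lambda>t. \<Sum>k<m. c k * y k t) \<le> (M + C + 4 * M + 2 * d) * j_norm (J.blk 0 m c)" for m c
    proof -
      define B where "B = j_norm (J.blk 0 m c)"
      have c_le: "\<bar>c k\<bar> \<le> B" if "k < m" for k
        using J.abs_le_nrm[OF J_blk_in_J, of m c k] that by (simp add: B_def J.blk_def)
      have B: "0 \<le> B" unfolding B_def by (rule J.nrm_nonneg[OF J_blk_in_J])
      have X1: "(\<lambda>t. (\<Sum>k<m. c k) * x t) \<in> JT" by (rule JT.scale_X[OF x(1)])
      have X2: "(\<lambda>t. \<Sum>k<m. c k * v k t) \<in> JT" by (rule JT.sum_X[OF finite_lessThan v_JT])
      have X3: "(\<lambda>t. \<Sum>k<m. c k * q k t) \<in> JT" by (rule JT.sum_X[OF finite_lessThan q_JT])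
      have "jt_norm (\<lambda>t. \<Sum>k<m. c k * v k t) \<le> C * sqrt (\<Sum>k<m. (c k)\<^sup>2) + 2 * (2 * M) * B"
        using up[where N=m and c=c] by (simp add: v_def B_def)
      also have "\<dots> \<le> C * B + 2 * (2 * M) * B"
        using mult_left_mono[OF l2_le_j_norm[of c m] C] by (simp add: B_def)
      finally have 2: "jt_norm (\<lambda>t. \<Sum>k<m. c k * v k t) \<le> C * B + 4 * M * B" by simp
      have "jt_norm (\<lambda>t. \<Sum>k<m. c k * q k t) \<le> (\<Sum>k<m. \<bar>c k\<bar> * jt_norm (q k))"
        by (rule JT.nrm_sum_le[OF finite_lessThan q_JT])
      also have "\<dots> \<le> (\<Sum>k<m. B * (d * (1/2)^k))"
        using c_le q_le B by (intro sum_mono mult_mono) (auto intro: JT.nrm_nonneg q_JT)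
      also have "\<dots> = B * d * (\<Sum>k<m. (1/2)^k)" by (simp add: sum_distrib_left mult.assoc)
      also have "\<dots> \<le> B * d * 2" using B d by (intro mult_left_mono) (auto simp: sum_gp_strict)
      finally have 3: "jt_norm (\<lambda>t. \<Sum>k<m. c k * q k t) \<le> B * d * 2" .
      have "jt_norm (\<lambda>t. (\<Sum>k<m. c k) * x t) = \<bar>\<Sum>k<m. c k\<bar> * jt_norm x" by (rule JT.nrm_scale[OF x(1)])
      also have "\<dots> \<le> B * M"
        using abs_sum_le_j_norm[of c m] x B by (intro mult_mono) (auto simp: B_def intro: JT.nrm_nonneg)
      finally have 1: "jt_norm (\<lambda>t. (\<Sum>k<m. c k) * x t) \<le> B * M" .
      have eq: "(\<Sum>k<m. c k * y k t) = (\<Sum>k<m. c k) * x t + (\<Sum>k<m. c k * v k t) + (\<Sum>k<m. c k * q k t)" for t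
        unfolding y_eq by (simp add: sum.distrib sum_distrib_right distrib_left)
      have "jt_norm (\<lambda>t. \<Sum>k<m. c k * y k t) \<le> B * M + (C * B + 4 * M * B) + B * d * 2"
        unfolding eq
        using JT.nrm_triangle[OF JT.add_X[OF X1 X2] X3] JT.nrm_triangle[OF X1 X2] 1 2 3 by linarith
      also have "\<dots> = (M + C + 4 * M + 2 * d) * B" by (simp add: algebra_simps)
      finally show ?thesis by (simp add: B_def)
    qed
    define bs where "bs y = (\<lambda>k. \<Sum>i=l k..<l (Suc k). y (nd \<gamma> i))" for y :: "bool list \<Rightarrow> real"
    have bs_J: "bs y \<in> J_space" and bs_le: "j_norm (bs y) \<le> jt_norm y" if "y \<in> JT" for y
      unfolding bs_def using block_sums_J[OF l that] j_norm_block_sums_le[OF l that] by auto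
    \<comment> \<open>By \<open>hx\<close>, this map annihilates \<open>x\<close>.\<close>
    define p where "p y = (\<lambda>t. y t - h y * x t)" for y
    have p_JT: "p y \<in> JT" if "y \<in> JT" for y unfolding p_def by (rule JT.diff_X[OF that JT.scale_X[OF x(1)]])
    have p_le: "jt_norm (p y) \<le> (1 + H * M) * jt_norm y" if "y \<in> JT" for y
    proof -
      have "jt_norm (p y) \<le> jt_norm y + \<bar>h y\<bar> * jt_norm x"
        unfolding p_def using JT.nrm_diff_le[OF that JT.scale_X[OF x(1)]] JT.nrm_scale[OF x(1)] by simp
      also have "\<dots> \<le> jt_norm y + (H * jt_norm y) * M"
        using h_le[OF that] x H JT.nrm_nonneg that by (intro add_left_mono mult_mono) auto
      finally show ?thesis by (simp add: algebra_simps)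
    qed
    define G where "G y = (\<lambda>k. inverse a0 * bs (p y) k)" for y
    have "\<exists>R C D. J_system y R C D"
    proof (rule J_system_perturbation[of y _ _ G, OF y_JT _ _ upper])
      show "0 < M + C + 4 * M + 2 * d" using M C d by simp
      show "0 < \<bar>inverse a0\<bar> * (1 + H * M)" using a0 H M by (simp add: add_pos_nonneg)
      show "G y \<in> J_space" if "y \<in> JT" for y
        unfolding G_def by (rule J.scale_X[OF bs_J[OF p_JT[OF that]]])
      show "j_norm (G y) \<le> \<bar>inverse a0\<bar> * (1 + H * M) * jt_norm y" if "y \<in> JT" for y
      proof -
        have "j_norm (G y) = \<bar>inverse a0\<bar> * j_norm (bs (p y))"
          unfolding G_def by (rule J.nrm_scale[OF bs_J[OF p_JT[OF that]]])
        also have "\<dots> \<le> \<bar>inverse a0\<bar> * ((1 + H * M) * jt_norm y)"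
          using bs_le[OF p_JT[OF that]] p_le[OF that] by (intro mult_left_mono) auto
        finally show ?thesis by (simp add: mult.assoc)
      qed
      show "G (\<lambda>t. y t + y' t) = (\<lambda>k. G y k + G y' k)" for y y'
        unfolding G_def bs_def p_def h_def by (simp add: algebra_simps sum.distrib sum_subtractf)
      show "G (\<lambda>t. c * y t) = (\<lambda>k. c * G y k)" for y c
        unfolding G_def bs_def p_def h_def by (simp add: algebra_simps sum_distrib_left sum_subtractf)
      show "j_norm (\<lambda>i. G (y k) i - (if i = k then 1 else 0)) \<le> (1/2)^(k+2)" for k
      proof -
        define e where "e = (\<lambda>i. if i = k then 1 else (0::real))"
        define s where "s = (\<lambda>t. q k t - h (u (\<phi> k)) * x t)"
        have s_JT: "s \<in> JT" unfolding s_def by (rule JT.diff_X[OF q_JT JT.scale_X[OF x(1)]])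
        have s_le: "jt_norm s \<le> jt_norm (q k) + \<bar>h (u (\<phi> k))\<bar> * jt_norm x"
          unfolding s_def using JT.nrm_diff_le[OF q_JT JT.scale_X[OF x(1)]] JT.nrm_scale[OF x(1)] by metis
        have "h (y k) = h x + h (u (\<phi> k))"
          by (simp add: h_def y_def u_def u0_def distrib_right[symmetric])
        then have "p (y k) = (\<lambda>t. v k t + s t)"
          using hx by (simp add: p_def s_def y_eq fun_eq_iff algebra_simps)
        then have bs_p: "bs (p (y k)) i = bs (v k) i + bs s i" for i
          by (simp add: bs_def sum.distrib)
        have bs_v: "bs (v k) i = bsum \<gamma> (v k) * e i" for i
        proof (cases "i = k")
          case True
          have "(\<Sum>j=l k..<l (Suc k). v k (nd \<gamma> j)) = (\<Sum>j=l k..<l' k. v k (nd \<gamma> j))"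
            using l'l[of k] by (intro sum.mono_neutral_right) (auto simp: v_def JT.blk_def)
          also have "\<dots> = bsum \<gamma> (v k)" unfolding v_def bsum_blk by (rule sum.cong) (auto simp: JT.blk_def)
          finally show ?thesis using True by (simp add: bs_def e_def)
        next
          case False
          have "v k (nd \<gamma> j) = 0" if j: "j \<in> {l i..<l (Suc i)}" for j
          proof -
            consider "Suc i \<le> k" | "Suc k \<le> i" using False by linarith
            then have "\<not> (l k \<le> j \<and> j < l' k)"
            proof cases
              case 1 then have "l (Suc i) \<le> l k" using l by (simp add: strict_mono_less_eq)
              then show ?thesis using j by auto
            next
              case 2 then have "l (Suc k) \<le> l i" using l by (simp add: strict_mono_less_eq)
              then show ?thesis using j l'l[of k] by auto
            qed
            then show ?thesis by (auto simp: v_def JT.blk_def)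
          qed
          then show ?thesis using False by (simp add: bs_def e_def)
        qed
        have eq: "G (y k) i - (if i = k then 1 else 0) = inverse a0 * ((bsum \<gamma> (v k) - a0) * e i + bs s i)" for i
          unfolding G_def bs_p bs_v using a0 by (simp add: e_def field_simps)
        have e_J: "e \<in> J_space" "j_norm e \<le> 1" unfolding e_def by (rule J.single_X, rule J.nrm_single)
        have X: "(\<lambda>i. (bsum \<gamma> (v k) - a0) * e i) \<in> J_space" by (rule J.scale_X[OF e_J(1)])
        have "j_norm (\<lambda>i. (bsum \<gamma> (v k) - a0) * e i + bs s i)
            \<le> \<bar>bsum \<gamma> (v k) - a0\<bar> * j_norm e + j_norm (bs s)"
          using J.nrm_triangle[OF X bs_J[OF s_JT]] J.nrm_scale[OF e_J(1)] by simp
        also have "\<dots> \<le> \<bar>bsum \<gamma> (v k) - a0\<bar> * 1 + jt_norm s"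
          by (intro add_mono mult_left_mono e_J bs_le[OF s_JT]) auto
        also have "\<dots> \<le> (\<bar>bsum \<gamma> (u (\<phi> k)) - a0\<bar> + jt_norm (q k)) + (jt_norm (q k) + \<bar>h (u (\<phi> k))\<bar> * M)"
        proof -
          have "\<bar>bsum \<gamma> (u (\<phi> k)) - bsum \<gamma> (v k)\<bar> \<le> jt_norm (q k)"
            using abs_bsum_le[OF q_JT, of \<gamma> k] bsum_diff[OF u_JT v_JT] by (simp add: q_def)
          moreover have "\<bar>h (u (\<phi> k))\<bar> * jt_norm x \<le> \<bar>h (u (\<phi> k))\<bar> * M"
            by (rule mult_left_mono[OF x(2)]) simp
          moreover from calculation(1) have "\<bar>bsum \<gamma> (v k) - a0\<bar> \<le> \<bar>bsum \<gamma> (u (\<phi> k)) - a0\<bar> + jt_norm (q k)"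
            by linarith
          ultimately show ?thesis using s_le unfolding mult_1_right by linarith
        qed
        also have "\<dots> \<le> (d * (1/2)^k + d * (1/2)^k) + (d * (1/2)^k + d * (1/2)^k * M)"
        proof (intro add_mono q_le mult_right_mono M)
          show "\<bar>bsum \<gamma> (u (\<phi> k)) - a0\<bar> \<le> d * (1/2)^k" "\<bar>h (u (\<phi> k))\<bar> \<le> d * (1/2)^k"
            using small[of k] by linarith+
        qed
        also have "\<dots> = (3 + M) * d * (1/2)^k" by (simp add: algebra_simps)
        also have "(3 + M) * d = \<bar>a0\<bar> / 4" using M by (simp add: d_def field_simps)
        finally have le: "j_norm (\<lambda>i. (bsum \<gamma> (v k) - a0) * e i + bs s i) \<le> \<bar>a0\<bar> / 4 * (1/2)^k" .
        have "j_norm (\<lambda>i. G (y k) i - (if i = k then 1 else 0))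
            = \<bar>inverse a0\<bar> * j_norm (\<lambda>i. (bsum \<gamma> (v k) - a0) * e i + bs s i)"
          unfolding eq by (rule J.nrm_scale[OF J.add_X[OF X bs_J[OF s_JT]]])
        also have "\<dots> \<le> \<bar>inverse a0\<bar> * (\<bar>a0\<bar> / 4 * (1/2)^k)" by (rule mult_left_mono[OF le]) simp
        also have "\<dots> = (1/2)^(k+2)" using a0 by (simp add: power_add power2_eq_square field_simps)
        finally show ?thesis .
      qed
    qed
    moreover have "y = z \<circ> (r \<circ> \<phi>)" by (auto simp: y_def)
    ultimately show ?thesis using that strict_mono_o[OF r \<phi>] by metis
  qed
qed

text \<open>Here \<open>A = 0\<close>, so \<open>m\<close> coefficients \<open>1 / m\<close> cost
  only a multiple of \<open>1 / sqrt m\<close>. The window may start at any \<open>N\<close>, where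
  a functional that converges along the sequence is already close to its limit.\<close>

lemma averages_subsequence:
  assumes z_JT: "\<And>n. z n \<in> JT" and z_le: "\<And>n. jt_norm (z n) \<le> M"
    and lim: "\<And>t. (\<lambda>n. z n t) \<longlonglongrightarrow> x t"
    and blim: "\<And>\<gamma>. (\<lambda>n. bsum \<gamma> (z n)) \<longlonglongrightarrow> bsum \<gamma> x"
  obtains \<phi> where "strict_mono (\<phi> :: nat \<Rightarrow> nat)"
    "\<And>N e. 0 < e \<Longrightarrow> \<exists>m>0. jt_norm (\<lambda>t. (\<Sum>k=N..<N+m. 1 / real m * z (\<phi> k) t) - x t) < e"
proof -
  note x = limit_JT[OF z_JT z_le lim] limit_le[OF z_JT z_le lim]
  define u where "u n = (\<lambda>t. z n t - x t)" for n
  note u_JT = diff_limit_JT[OF z_JT z_le lim, folded u_def]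
    and u_le = diff_limit_le[OF z_JT z_le lim, folded u_def]
  have u_0: "(\<lambda>n. u n t) \<longlonglongrightarrow> 0" for t
    unfolding u_def by (rule diff_limit_tendsto[OF z_JT z_le lim])
  have u_a: "(\<lambda>n. bsum \<delta> (u n)) \<longlonglongrightarrow> 0" for \<delta>
    unfolding u_def bsum_diff[OF z_JT x(1)]
    using tendsto_diff[OF blim tendsto_const[of "bsum \<delta> x"], of \<delta>] by simp
  show ?thesis
  proof (rule upper_estimate_subsequence[of u "2 * M" "\<lambda>_. 0" 0 1, OF u_JT u_le u_0 u_a])
    fix \<phi> l l' C
    assume \<phi>: "strict_mono (\<phi> :: nat \<Rightarrow> nat)"
      and err: "\<And>n. jt_norm (\<lambda>t. u (\<phi> n) t - JT.blk (l n) (l' n) (u (\<phi> n)) t) \<le> 1 * (1/2)^n"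
      and C: "0 \<le> (C::real)"
      and up: "\<And>N c. jt_norm (\<lambda>t. \<Sum>k<N. c k * JT.blk (l k) (l' k) (u (\<phi> k)) t)
        \<le> C * sqrt (\<Sum>k<N. (c k)\<^sup>2) + 2 * 0 * j_norm (J.blk 0 N c)"
    define v where "v k = JT.blk (l k) (l' k) (u (\<phi> k))" for k
    define q where "q k = (\<lambda>t. u (\<phi> k) t - v k t)" for k
    have v_JT: "v k \<in> JT" for k unfolding v_def by (rule JT.blk_X[OF u_JT])
    have q_JT: "q k \<in> JT" for k unfolding q_def by (rule JT.diff_X[OF u_JT v_JT])
    have q_le: "jt_norm (q k) \<le> (1/2)^k" for k using err by (simp add: q_def v_def)
    show ?thesis
    proof (rule that[OF \<phi>])
      fix N :: nat and e :: real assume e: "0 < e"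
      \<comment> \<open>The blocks contribute \<open>C / sqrt m\<close> and the cut-off errors at
        most \<open>2 / m \<le> 2 / sqrt m\<close>; hence \<open>C + 2\<close>.\<close>
      obtain m :: nat where m: "((C + 2) / e)\<^sup>2 < real m" using reals_Archimedean2 by blast
      have m0: "0 < m" using m by (metis of_nat_0_less_iff le_less_trans zero_le_power2)
      define c where "c k = (if N \<le> k then 1 / real m else 0)" for k
      have restr: "(\<Sum>k<N+m. c k * g k) = (\<Sum>k=N..<N+m. 1 / real m * g k)" for g
        by (rule sum.mono_neutral_cong_right) (auto simp: c_def)
      have cs: "(\<Sum>k<N+m. (c k)\<^sup>2) = 1 / real m"
      proof -
        have "(\<Sum>k<N+m. (c k)\<^sup>2) = (\<Sum>k=N..<N+m. 1 / real m * (1 / real m))"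
          using restr[of c] by (simp add: power2_eq_square c_def)
        then show ?thesis by simp
      qed
      have X1: "(\<lambda>t. \<Sum>k<N+m. c k * v k t) \<in> JT" by (rule JT.sum_X[OF finite_lessThan v_JT])
      have X2: "(\<lambda>t. \<Sum>k<N+m. c k * q k t) \<in> JT" by (rule JT.sum_X[OF finite_lessThan q_JT])
      have 1: "jt_norm (\<lambda>t. \<Sum>k<N+m. c k * v k t) \<le> C * sqrt (1 / real m)"
        using up[where N="N+m" and c=c] by (simp add: v_def cs)
      have "jt_norm (\<lambda>t. \<Sum>k<N+m. c k * q k t) \<le> (\<Sum>k<N+m. \<bar>c k\<bar> * jt_norm (q k))"
        by (rule JT.nrm_sum_le[OF finite_lessThan q_JT])
      also have "\<dots> \<le> (\<Sum>k<N+m. 1 / real m * (1/2)^k)"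
        using q_le by (intro sum_mono mult_mono) (auto simp: c_def intro: JT.nrm_nonneg q_JT)
      also have "\<dots> = 1 / real m * (\<Sum>k<N+m. (1/2)^k)" by (simp add: sum_distrib_left)
      also have "\<dots> \<le> 1 / real m * 2" by (intro mult_left_mono) (auto simp: sum_gp_strict)
      also have "\<dots> \<le> 2 * sqrt (1 / real m)"
      proof -
        have "1 / real m \<le> sqrt (1 / real m)"
          using m0 by (intro real_le_rsqrt) (simp add: power2_eq_square field_simps)
        then show ?thesis by simp
      qed
      finally have 2: "jt_norm (\<lambda>t. \<Sum>k<N+m. c k * q k t) \<le> 2 * sqrt (1 / real m)" .
      have eq: "(\<Sum>k=N..<N+m. 1 / real m * z (\<phi> k) t) - x t = (\<Sum>k<N+m. c k * v k t) + (\<Sum>k<N+m. c k * q k t)" for t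
      proof -
        have "(\<Sum>k<N+m. c k * v k t) + (\<Sum>k<N+m. c k * q k t) = (\<Sum>k<N+m. c k * u (\<phi> k) t)"
          by (simp add: q_def sum.distrib[symmetric] algebra_simps)
        also have "\<dots> = (\<Sum>k=N..<N+m. 1 / real m * u (\<phi> k) t)" by (rule restr)
        also have "\<dots> = (\<Sum>k=N..<N+m. 1 / real m * z (\<phi> k) t) - (\<Sum>k=N..<N+m. 1 / real m * x t)"
          unfolding sum_subtractf[symmetric] by (simp add: u_def right_diff_distrib)
        also have "(\<Sum>k=N..<N+m. 1 / real m * x t) = x t" using m0 by simp
        finally show ?thesis by simp
      qed
      have "jt_norm (\<lambda>t. (\<Sum>k=N..<N+m. 1 / real m * z (\<phi> k) t) - x t) \<le> C * sqrt (1 / real m) + 2 * sqrt (1 / real m)"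
        unfolding eq using JT.nrm_triangle[OF X1 X2] 1 2 by linarith
      also have "\<dots> = (C + 2) / sqrt (real m)" by (simp add: real_sqrt_divide add_divide_distrib)
      also have "\<dots> < e"
      proof -
        have "(C + 2) / e < sqrt (real m)" using m by (rule real_less_rsqrt)
        then show ?thesis using e m0 by (simp add: field_simps)
      qed
      finally show "\<exists>m>0. jt_norm (\<lambda>t. (\<Sum>k=N..<N+m. 1 / real m * z (\<phi> k) t) - x t) < e"
        using m0 by blast
    qed
  qed auto
qed

section \<open>Duality\<close>

lemma lin_functional_add:
  "lin_functional_on V f \<Longrightarrow> x \<in> V \<Longrightarrow> y \<in> V \<Longrightarrow> f (\<lambda>t. x t + y t) = f x + f y"
  by (simp add: lin_functional_on_def)

lemma lin_functional_scale:
  "lin_functional_on V f \<Longrightarrow> x \<in> V \<Longrightarrow> f (\<lambda>t. c * x t) = c * f x"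
  by (simp add: lin_functional_on_def)

lemma bidual_add:
  "\<Phi> \<in> bidual_sp V N \<Longrightarrow> f \<in> dual_sp V N \<Longrightarrow> g \<in> dual_sp V N \<Longrightarrow> \<Phi> (\<lambda>x. f x + g x) = \<Phi> f + \<Phi> g"
  by (simp add: bidual_sp_def)

lemma bidual_scale:
  "\<Phi> \<in> bidual_sp V N \<Longrightarrow> f \<in> dual_sp V N \<Longrightarrow> \<Phi> (\<lambda>x. c * f x) = c * \<Phi> f"
  by (simp add: bidual_sp_def)

lemma lin_subspace_sum:
  assumes Z: "lin_subspace Z" and z: "\<And>k. k \<in> K \<Longrightarrow> z k \<in> Z" and K: "finite K"
  shows "(\<lambda>t. \<Sum>k\<in>K. c k * z k t) \<in> Z"
  using K z
proof (induction K rule: finite_induct)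
  case empty then show ?case using Z by (simp add: lin_subspace_def)
next
  case (insert k K)
  then have "(\<lambda>t. c k * z k t) \<in> Z" "(\<lambda>t. \<Sum>k\<in>K. c k * z k t) \<in> Z"
    using Z by (auto simp: lin_subspace_def)
  then have "(\<lambda>t. c k * z k t + (\<Sum>k\<in>K. c k * z k t)) \<in> Z" using Z by (auto simp: lin_subspace_def)
  then show ?case using insert by simp
qed

lemma lin_functional_sum:
  assumes f: "lin_functional_on Z f" and Z: "lin_subspace Z"
    and z: "\<And>k. k \<in> K \<Longrightarrow> z k \<in> Z" and K: "finite K"
  shows "f (\<lambda>t. \<Sum>k\<in>K. c k * z k t) = (\<Sum>k\<in>K. c k * f (z k))"
  using K z
proof (induction K rule: finite_induct)
  case empty
  have "(\<lambda>t. 0) \<in> Z" using Z by (simp add: lin_subspace_def)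
  from lin_functional_scale[OF f this, of 0] show ?case by simp
next
  case (insert k K)
  have "(\<lambda>t. \<Sum>k\<in>K. c k * z k t) \<in> Z" using insert by (intro lin_subspace_sum[OF Z]) auto
  moreover have "(\<lambda>t. c k * z k t) \<in> Z" using insert Z by (auto simp: lin_subspace_def)
  ultimately have "f (\<lambda>t. c k * z k t + (\<Sum>k\<in>K. c k * z k t)) = f (\<lambda>t. c k * z k t) + f (\<lambda>t. \<Sum>k\<in>K. c k * z k t)"
    using f by (auto simp: lin_functional_on_def)
  moreover have "f (\<lambda>t. c k * z k t) = c k * f (z k)" using f insert by (auto simp: lin_functional_on_def)
  ultimately show ?case using insert by simp
qed

lemma lin_functional_diff:
  assumes f: "lin_functional_on Z f" and Z: "lin_subspace Z" and "x \<in> Z" "y \<in> Z"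
  shows "f (\<lambda>t. x t - y t) = f x - f y"
proof -
  have "(\<lambda>t. -1 * y t) \<in> Z" using Z assms(4) unfolding lin_subspace_def by blast
  from lin_functional_add[OF f assms(3) this] lin_functional_scale[OF f assms(4), of "-1"]
  show ?thesis by simp
qed

text \<open>Averages of late terms stay in \<open>Z\<close> and converge to \<open>x\<close> in
  norm, while \<open>f\<close> takes values near \<open>L\<close> on them; so
  \<open>f x = L\<close>.\<close>

lemma averages_limit:
  assumes Z: "closed_subspace JT jt_norm Z" and z: "\<And>n. z n \<in> Z" and x: "x \<in> JT"
    and \<phi>: "strict_mono (\<phi> :: nat \<Rightarrow> nat)"
    and av: "\<And>N e. 0 < e \<Longrightarrow> \<exists>m>0. jt_norm (\<lambda>t. (\<Sum>k=N..<N+m. 1 / real m * z (\<phi> k) t) - x t) < e"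
  shows "x \<in> Z"
    and "f \<in> dual_sp Z jt_norm \<Longrightarrow> (\<lambda>n. f (z n)) \<longlonglongrightarrow> L \<Longrightarrow> f x = L"
proof -
  have sub: "Z \<subseteq> JT" and lin: "lin_subspace Z" and cl: "norm_closed_in JT jt_norm Z"
    using Z by (auto simp: closed_subspace_def)
  have avZ: "(\<lambda>t. \<Sum>k=N..<N+m. 1 / real m * z (\<phi> k) t) \<in> Z" for N m
    by (rule lin_subspace_sum[OF lin z]) simp
  have "\<exists>y\<in>Z. jt_norm (\<lambda>t. x t - y t) < e" if "0 < e" for e
    using av[OF that, of 0] avZ JT.nrm_minus_commute[OF x] sub by (metis subsetD)
  then show xZ: "x \<in> Z" using cl x unfolding norm_closed_in_def by blast
  assume f: "f \<in> dual_sp Z jt_norm" and L: "(\<lambda>n. f (z n)) \<longlonglongrightarrow> L"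
  obtain C where C: "\<And>y. y \<in> Z \<Longrightarrow> \<bar>f y\<bar> \<le> C * jt_norm y" and fl: "lin_functional_on Z f"
    using f by (auto simp: dual_sp_def)
  have "\<bar>f x - L\<bar> \<le> e" if e: "0 < e" for e
  proof -
    have "(\<lambda>k. f (z (\<phi> k))) \<longlonglongrightarrow> L" using LIMSEQ_subseq_LIMSEQ[OF L \<phi>] by (simp add: o_def)
    from tendstoD[OF this, of "e/2"] obtain N where N: "\<And>k. N \<le> k \<Longrightarrow> \<bar>f (z (\<phi> k)) - L\<bar> < e/2"
      using e by (auto simp: eventually_sequentially dist_real_def)
    \<comment> \<open>The bound \<open>C\<close> of a functional may be zero or negative;
      \<open>c\<close> is a positive majorant to divide by.\<close>
    define c where "c = \<bar>C\<bar> + 1"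
    have c: "0 < c" by (simp add: c_def add_nonneg_pos)
    define d where "d = e / 2 / c"
    have d: "0 < d" using e c by (simp add: d_def)
    obtain m where m: "0 < m" and le: "jt_norm (\<lambda>t. (\<Sum>k=N..<N+m. 1 / real m * z (\<phi> k) t) - x t) < d"
      using av[OF d] by blast
    define y where "y = (\<lambda>t. \<Sum>k=N..<N+m. 1 / real m * z (\<phi> k) t)"
    have y: "y \<in> Z" using avZ by (simp add: y_def)
    have yx: "(\<lambda>t. y t - x t) \<in> Z"
      using lin_subspace_sum[OF lin, of "{True, False}" "\<lambda>b. if b then y else x" "\<lambda>b. if b then 1 else -1"] y xZ
      by simp
    have "\<bar>f y - f x\<bar> \<le> C * jt_norm (\<lambda>t. y t - x t)"
      using C[OF yx] lin_functional_diff[OF fl lin y xZ] by simp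
    also have "\<dots> \<le> c * d"
    proof (rule mult_mono)
      show "jt_norm (\<lambda>t. y t - x t) \<le> d" using le unfolding y_def by (rule less_imp_le)
      show "0 \<le> jt_norm (\<lambda>t. y t - x t)" by (rule JT.nrm_nonneg[OF subsetD[OF sub yx]])
    qed (use c in \<open>auto simp: c_def\<close>)
    also have "\<dots> = e / 2" using c by (simp add: d_def)
    finally have 1: "\<bar>f y - f x\<bar> \<le> e / 2" .
    have "f y = (\<Sum>k=N..<N+m. 1 / real m * f (z (\<phi> k)))"
      unfolding y_def by (rule lin_functional_sum[OF fl lin z]) simp
    then have "f y - L = (\<Sum>k=N..<N+m. 1 / real m * f (z (\<phi> k))) - (\<Sum>k=N..<N+m. 1 / real m * L)"
      using m by simp
    also have "\<dots> = (\<Sum>k=N..<N+m. 1 / real m * (f (z (\<phi> k)) - L))"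
      unfolding sum_subtractf[symmetric] by (simp add: right_diff_distrib)
    also have "\<bar>\<dots>\<bar> \<le> (\<Sum>k=N..<N+m. \<bar>1 / real m * (f (z (\<phi> k)) - L)\<bar>)" by (rule sum_abs)
    also have "\<dots> \<le> (\<Sum>k=N..<N+m. 1 / real m * (e / 2))"
      unfolding abs_mult using N by (intro sum_mono mult_mono) (auto intro: less_imp_le)
    also have "\<dots> = e / 2" using m by simp
    finally show ?thesis using 1 by linarith
  qed
  then have "\<bar>f x - L\<bar> \<le> 0" by (rule field_le_epsilon[of _ 0, simplified])
  then show "f x = L" by simp
qed

lemma dual_sp_restrict:
  assumes f: "lin_functional_on V f" "\<And>x. x \<in> V \<Longrightarrow> \<bar>f x\<bar> \<le> C * N x" and Z: "Z \<subseteq> V" "lin_subspace Z"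
  shows "(\<lambda>x. if x \<in> Z then f x else 0) \<in> dual_sp Z N"
proof -
  have V: "x \<in> V" if "x \<in> Z" for x using that Z(1) by blast
  show ?thesis
    using lin_functional_add[OF f(1) V V] lin_functional_scale[OF f(1) V] f(2)[OF V] Z(2)
    unfolding dual_sp_def lin_functional_on_def lin_subspace_def by (auto intro!: exI[of _ C])
qed

lemma dual_sp_sum:
  fixes k :: nat
  assumes "\<And>i. i < k \<Longrightarrow> f i \<in> dual_sp Z N"
  shows "(\<lambda>x. \<Sum>i<k. r i * f i x) \<in> dual_sp Z N"
proof -
  have "\<forall>i. \<exists>C. i < k \<longrightarrow> (\<forall>x\<in>Z. \<bar>f i x\<bar> \<le> C * N x)"
    using assms unfolding dual_sp_def by blast
  then obtain C where C: "\<And>i x. i < k \<Longrightarrow> x \<in> Z \<Longrightarrow> \<bar>f i x\<bar> \<le> C i * N x" by metis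
  have "\<bar>\<Sum>i<k. r i * f i x\<bar> \<le> (\<Sum>i<k. \<bar>r i\<bar> * C i) * N x" if x: "x \<in> Z" for x
  proof -
    have "\<bar>\<Sum>i<k. r i * f i x\<bar> \<le> (\<Sum>i<k. \<bar>r i * f i x\<bar>)" by (rule sum_abs)
    also have "\<dots> \<le> (\<Sum>i<k. \<bar>r i\<bar> * (C i * N x))"
      unfolding abs_mult using C x by (intro sum_mono mult_left_mono) auto
    finally show ?thesis by (simp add: sum_distrib_right mult.assoc)
  qed
  then show ?thesis
    using assms unfolding dual_sp_def lin_functional_on_def
    by (auto simp: sum.distrib[symmetric] distrib_left sum_distrib_left mult.left_commute intro!: sum.cong)
qed

lemma bidual_sum:
  fixes k :: nat
  assumes \<Phi>: "\<Phi> \<in> bidual_sp Z N" and f: "\<And>i. i < k \<Longrightarrow> f i \<in> dual_sp Z N"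
  shows "\<Phi> (\<lambda>x. \<Sum>i<k. r i * f i x) = (\<Sum>i<k. r i * \<Phi> (f i))"
  using f
proof (induction k)
  case 0
  have "(\<lambda>x. 0) \<in> dual_sp Z N" using dual_sp_sum[of 0 _ Z N] by simp
  from bidual_scale[OF \<Phi> this, of 0] show ?case by simp
next
  case (Suc k)
  have 1: "(\<lambda>x. \<Sum>i<k. r i * f i x) \<in> dual_sp Z N" using Suc by (intro dual_sp_sum) auto
  have 2: "(\<lambda>x. r k * f k x) \<in> dual_sp Z N"
    using dual_sp_sum[of 1 "\<lambda>_. f k" Z N "\<lambda>_. r k"] Suc by simp
  have "\<Phi> (\<lambda>x. (\<Sum>i<k. r i * f i x) + r k * f k x) = \<Phi> (\<lambda>x. \<Sum>i<k. r i * f i x) + \<Phi> (\<lambda>x. r k * f k x)"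
    by (rule bidual_add[OF \<Phi> 1 2])
  moreover have "\<Phi> (\<lambda>x. r k * f k x) = r k * \<Phi> (f k)" by (rule bidual_scale[OF \<Phi> Suc.prems]) simp
  ultimately show ?case using Suc by simp
qed

text \<open>Goldstine's theorem for finitely many functionals: a near minimiser of the quadratic
  distance to the prescribed values yields a functional violating the norm bound of \<open>\<Phi>\<close>
  unless the distance is zero.\<close>

lemma goldstine:
  assumes Z: "Z \<subseteq> JT" "lin_subspace Z" and \<Phi>: "\<Phi> \<in> bidual_sp Z jt_norm"
  obtains M where "\<And>(k::nat) f e. (\<And>i. i < k \<Longrightarrow> f i \<in> dual_sp Z jt_norm) \<Longrightarrow> 0 < e \<Longrightarrow>
    \<exists>z\<in>Z. jt_norm z \<le> M \<and> (\<forall>i<k. \<bar>f i z - \<Phi> (f i)\<bar> < e)"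
proof -
  obtain C where C: "\<And>f. f \<in> dual_sp Z jt_norm \<Longrightarrow> \<bar>\<Phi> f\<bar> \<le> C * dual_norm Z jt_norm f"
    using \<Phi> unfolding bidual_sp_def by blast
  define M where "M = max C 0 + 1"
  have M: "0 < M" "C \<le> M" by (auto simp: M_def)
  have Z0: "(\<lambda>t. 0) \<in> Z" using Z(2) by (simp add: lin_subspace_def)
  have scaleZ: "(\<lambda>t. c * x t) \<in> Z" if "x \<in> Z" for c x using Z(2) that by (simp add: lin_subspace_def)
  \<comment> \<open>The ball is symmetric: a lower bound for \<open>g\<close>, taken at
    \<open>M * x\<close> and at \<open>- M * x\<close>, bounds the absolute value of
    \<open>g x\<close>.\<close>
  have dn: "0 \<le> dual_norm Z jt_norm g"
    "\<And>B. (\<And>y. y \<in> Z \<Longrightarrow> jt_norm y \<le> M \<Longrightarrow> - B \<le> g y) \<Longrightarrow> M * dual_norm Z jt_norm g \<le> B"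
    if g: "g \<in> dual_sp Z jt_norm" for g
  proof -
    obtain C' where C': "\<And>y. y \<in> Z \<Longrightarrow> \<bar>g y\<bar> \<le> C' * jt_norm y" and gl: "lin_functional_on Z g"
      using g by (auto simp: dual_sp_def)
    have mem: "\<bar>g (\<lambda>t. 0)\<bar> \<in> {\<bar>g x\<bar> |x. x \<in> Z \<and> jt_norm x \<le> 1}"
      using Z0 JT.nrm_zero by force
    have "\<bar>g x\<bar> \<le> \<bar>C'\<bar>" if "x \<in> Z" "jt_norm x \<le> 1" for x
    proof -
      have "0 \<le> jt_norm x" using that(1) Z(1) JT.nrm_nonneg by blast
      then have "C' * jt_norm x \<le> \<bar>C'\<bar> * 1" using that(2) by (intro mult_mono) auto
      then show ?thesis using C'[OF that(1)] by simp
    qed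
    then have "bdd_above {\<bar>g x\<bar> |x. x \<in> Z \<and> jt_norm x \<le> 1}" by (auto intro!: bdd_aboveI[of _ "\<bar>C'\<bar>"])
    from cSup_upper[OF mem this] show "0 \<le> dual_norm Z jt_norm g" unfolding dual_norm_def by linarith
    fix B assume B: "\<And>y. y \<in> Z \<Longrightarrow> jt_norm y \<le> M \<Longrightarrow> - B \<le> g y"
    have "dual_norm Z jt_norm g \<le> B / M"
      unfolding dual_norm_def
    proof (rule cSup_least)
      show "{\<bar>g x\<bar> |x. x \<in> Z \<and> jt_norm x \<le> 1} \<noteq> {}" using mem by blast
      fix a assume "a \<in> {\<bar>g x\<bar> |x. x \<in> Z \<and> jt_norm x \<le> 1}"
      then obtain x where x: "a = \<bar>g x\<bar>" "x \<in> Z" "jt_norm x \<le> 1" by blast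
      have "- B \<le> c * g x" if "\<bar>c\<bar> = M" for c
      proof -
        have "jt_norm (\<lambda>t. c * x t) \<le> M"
          using JT.nrm_scale[of x c] x Z(1) M mult_left_mono[OF x(3), of M] that by auto
        from B[OF scaleZ[OF x(2)] this] show ?thesis
          using gl x(2) by (simp add: lin_functional_on_def)
      qed
      from this[of M] this[of "- M"] have "M * \<bar>g x\<bar> \<le> B" using M by (auto simp: abs_if)
      then show "a \<le> B / M" using M x by (simp add: field_simps)
    qed
    then show "M * dual_norm Z jt_norm g \<le> B" using M by (simp add: field_simps)
  qed
  show ?thesis
  proof (rule that[of M])
    fix k and f :: "nat \<Rightarrow> (bool list \<Rightarrow> real) \<Rightarrow> real" and e :: real
    assume f: "\<And>i. i < k \<Longrightarrow> f i \<in> dual_sp Z jt_norm" and e: "0 < e"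
    have fl: "lin_functional_on Z (f i)" if "i < k" for i using f[OF that] by (simp add: dual_sp_def)
    have "\<forall>i. \<exists>C. i < k \<longrightarrow> (\<forall>x\<in>Z. \<bar>f i x\<bar> \<le> C * jt_norm x)" using f unfolding dual_sp_def by blast
    then obtain A where A: "\<And>i x. i < k \<Longrightarrow> x \<in> Z \<Longrightarrow> \<bar>f i x\<bar> \<le> A i * jt_norm x" by metis
    define K where "K = {z \<in> Z. jt_norm z \<le> M}"
    define q where "q z = (\<Sum>i<k. (f i z - \<Phi> (f i))\<^sup>2)" for z
    have q0: "0 \<le> q z" for z by (simp add: q_def sum_nonneg)
    have K0: "(\<lambda>t. 0) \<in> K" using Z0 M JT.nrm_zero by (simp add: K_def)
    define d where "d = Inf (q ` K)"
    have bdd: "bdd_below (q ` K)" by (rule bdd_belowI[of _ 0]) (use q0 in auto)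
    have d_le: "d \<le> q z" if "z \<in> K" for z unfolding d_def by (rule cInf_lower[OF imageI[OF that] bdd])
    have near: "\<exists>z\<in>K. q z < c" if "d < c" for c
      using that K0 bdd unfolding d_def by (subst (asm) cInf_less_iff) auto
    have "d \<le> 0"
    proof (rule ccontr)
      assume "\<not> d \<le> 0"
      then have d: "0 < d" by simp
      define Bd where "Bd = (\<Sum>i<k. (2 * (\<bar>A i\<bar> * M))\<^sup>2)"
      have Bd0: "0 \<le> Bd" by (simp add: Bd_def sum_nonneg)
      \<comment> \<open>Moving from the near minimiser \<open>z\<close> by the fraction \<theta>
        towards \<open>y\<close> changes \<open>q\<close> by
        \<open>2 * \<theta> * (g y - g z)\<close> plus at most \<open>\<theta>\<^sup>2 * Bd\<close>.
        The latter and the defect of \<open>z\<close> are each at most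
        \<open>\<theta> * d / 2\<close>, whence \<open>g y \<ge> g z - d / 2\<close>.\<close>
      define \<theta> where "\<theta> = min 1 (d / (2 * (Bd + 1)))"
      have \<theta>: "0 < \<theta>" "\<theta> \<le> 1" using d Bd0 by (auto simp: \<theta>_def)
      have "\<theta> * Bd \<le> d / (2 * (Bd + 1)) * (Bd + 1)"
        using \<theta> Bd0 d by (intro mult_mono) (auto simp: \<theta>_def)
      also have "\<dots> = d / 2" using Bd0 by (simp add: field_simps)
      finally have \<theta>Bd: "\<theta> * Bd \<le> d / 2" .
      obtain z where z: "z \<in> K" "q z < d + \<theta> * d / 2" using near[of "d + \<theta> * d / 2"] \<theta> d by auto
      have zZ: "z \<in> Z" "jt_norm z \<le> M" using z(1) by (auto simp: K_def)
      define r where "r i = f i z - \<Phi> (f i)" for i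
      define g where "g = (\<lambda>x. \<Sum>i<k. r i * f i x)"
      have g: "g \<in> dual_sp Z jt_norm" unfolding g_def by (rule dual_sp_sum[OF f])
      have g_ge: "g z - d / 2 \<le> g y" if y: "y \<in> Z" "jt_norm y \<le> M" for y
      proof -
        define w where "w = (\<lambda>t. (1 - \<theta>) * z t + \<theta> * y t)"
        have zy: "(\<lambda>t. (1 - \<theta>) * z t) \<in> Z" "(\<lambda>t. \<theta> * y t) \<in> Z" using scaleZ zZ y by auto
        have wZ: "w \<in> Z" unfolding w_def using Z(2) zy by (auto simp: lin_subspace_def)
        have "jt_norm w \<le> \<bar>1 - \<theta>\<bar> * jt_norm z + \<bar>\<theta>\<bar> * jt_norm y"
          unfolding w_def
          using JT.nrm_triangle[OF subsetD[OF Z(1) zy(1)] subsetD[OF Z(1) zy(2)]]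
            JT.nrm_scale[OF subsetD[OF Z(1) zZ(1)], of "1 - \<theta>"] JT.nrm_scale[OF subsetD[OF Z(1) y(1)], of \<theta>] by simp
        also have "\<dots> \<le> (1 - \<theta>) * M + \<theta> * M"
          using \<theta> zZ y by (intro add_mono mult_mono) (auto intro: JT.nrm_nonneg subsetD[OF Z(1)])
        finally have "w \<in> K" using wZ by (simp add: K_def algebra_simps)
        have fw: "f i w - \<Phi> (f i) = r i + \<theta> * (f i y - f i z)" if "i < k" for i
        proof -
          have "f i w = f i (\<lambda>t. (1 - \<theta>) * z t) + f i (\<lambda>t. \<theta> * y t)"
            unfolding w_def using fl[OF that] zy by (auto simp: lin_functional_on_def)
          moreover have "f i (\<lambda>t. (1 - \<theta>) * z t) = (1 - \<theta>) * f i z" "f i (\<lambda>t. \<theta> * y t) = \<theta> * f i y"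
            using fl[OF that] zZ y by (auto simp: lin_functional_on_def)
          ultimately show ?thesis by (simp add: r_def algebra_simps)
        qed
        have le: "(f i y - f i z)\<^sup>2 \<le> (2 * (\<bar>A i\<bar> * M))\<^sup>2" if "i < k" for i
        proof -
          have *: "\<bar>f i x\<bar> \<le> \<bar>A i\<bar> * M" if "x \<in> Z" "jt_norm x \<le> M" for x
          proof -
            have "A i * jt_norm x \<le> \<bar>A i\<bar> * M"
              using that JT.nrm_nonneg[of x] Z(1) by (intro mult_mono) auto
            then show ?thesis using A[OF \<open>i < k\<close> that(1)] by linarith
          qed
          have "\<bar>f i y - f i z\<bar> \<le> 2 * (\<bar>A i\<bar> * M)" using *[OF y] *[OF zZ] by linarith
          from power_mono[OF this, of 2] show ?thesis by simp
        qed
        have "(a + \<theta> * b)\<^sup>2 = a\<^sup>2 + 2 * \<theta> * (a * b) + \<theta>\<^sup>2 * b\<^sup>2" for a b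
          by (simp add: power2_eq_square algebra_simps)
        with fw have "q w = (\<Sum>i<k. (r i)\<^sup>2 + 2 * \<theta> * (r i * (f i y - f i z)) + \<theta>\<^sup>2 * (f i y - f i z)\<^sup>2)"
          unfolding q_def by simp
        also have "\<dots> = q z + 2 * \<theta> * (g y - g z) + \<theta>\<^sup>2 * (\<Sum>i<k. (f i y - f i z)\<^sup>2)"
          unfolding q_def g_def r_def[symmetric] sum_subtractf[symmetric] right_diff_distrib[symmetric]
          by (simp only: sum.distrib sum_distrib_left)
        also have "\<dots> \<le> q z + 2 * \<theta> * (g y - g z) + \<theta>\<^sup>2 * Bd"
          unfolding Bd_def using le by (intro add_left_mono mult_left_mono sum_mono) auto
        finally have "d \<le> q z + 2 * \<theta> * (g y - g z) + \<theta>\<^sup>2 * Bd" using d_le[OF \<open>w \<in> K\<close>] by simp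
        moreover have "\<theta>\<^sup>2 * Bd \<le> \<theta> * (d / 2)"
          using mult_left_mono[OF \<theta>Bd, of \<theta>] \<theta> by (simp add: power2_eq_square mult.assoc)
        ultimately have "0 \<le> \<theta> * (d + 2 * (g y - g z))" using z(2) by (simp add: algebra_simps)
        then have "0 \<le> d + 2 * (g y - g z)" using \<theta>(1) by (simp add: zero_le_mult_iff)
        then show ?thesis by simp
      qed
      \<comment> \<open>As \<open>\<Phi> g = g z - q z\<close>, the norm bound gives
        \<open>q z - g z \<le> d / 2 - g z\<close>, thus \<open>q z \<le> d / 2\<close>, against
        \<open>d \<le> q z\<close>.\<close>
      have "M * dual_norm Z jt_norm g \<le> d / 2 - g z"
        by (rule dn(2)[OF g]) (use g_ge in force)
      moreover have "\<bar>\<Phi> g\<bar> \<le> M * dual_norm Z jt_norm g"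
        using C[OF g] mult_right_mono[OF M(2) dn(1)[OF g]] by linarith
      moreover have "\<Phi> g = g z - q z"
      proof -
        have "\<Phi> g = (\<Sum>i<k. r i * \<Phi> (f i))" unfolding g_def by (rule bidual_sum[OF \<Phi> f])
        also have "\<dots> = (\<Sum>i<k. r i * f i z - (r i)\<^sup>2)"
          by (rule sum.cong) (auto simp: r_def power2_eq_square algebra_simps)
        finally show ?thesis by (simp add: g_def q_def r_def sum_subtractf)
      qed
      ultimately show False using d_le[OF z(1)] d by linarith
    qed
    moreover have "0 < e\<^sup>2" using e by simp
    ultimately have "d < e\<^sup>2" by linarith
    from near[OF this] obtain z where z: "z \<in> K" "q z < e\<^sup>2" by blast
    have "\<bar>f i z - \<Phi> (f i)\<bar> < e" if "i < k" for i
    proof -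
      have "(f i z - \<Phi> (f i))\<^sup>2 \<le> q z"
        unfolding q_def using that by (intro member_le_sum[of i _ "\<lambda>i. (f i z - \<Phi> (f i))\<^sup>2"]) auto
      then have "\<bar>f i z - \<Phi> (f i)\<bar>\<^sup>2 < e\<^sup>2" using z(2) by simp
      then show ?thesis using e by (intro power_less_imp_less_base[of _ 2 e]) auto
    qed
    then show "\<exists>z\<in>Z. jt_norm z \<le> M \<and> (\<forall>i<k. \<bar>f i z - \<Phi> (f i)\<bar> < e)"
      using z(1) by (auto simp: K_def)
  qed
qed

section \<open>Weakly Cauchy sequences and non-reflexive subspaces\<close>

lemma lin_subspace_JT: "lin_subspace JT"
  by (auto simp: lin_subspace_def JT.zero_X JT.add_X JT.scale_X)

lemma coord_dual:
  assumes "Z \<subseteq> JT" "lin_subspace Z"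
  shows "(\<lambda>y. if y \<in> Z then y t else 0) \<in> dual_sp Z jt_norm"
  by (rule dual_sp_restrict[of JT _ 1, OF _ _ assms])
    (auto simp: lin_functional_on_def JT.abs_le_nrm)

lemma bsum_dual: "(\<lambda>y. if y \<in> JT then bsum \<gamma> y else 0) \<in> dual_sp JT jt_norm"
  by (rule dual_sp_restrict[of JT _ 1])
    (auto simp: lin_functional_on_def abs_bsum_le bsum_add bsum_scale lin_subspace_JT)

text \<open>Coordinates and branch sums are bounded functionals, so their limits exist along the
  whole sequence. If every mass vanished, averages would identify \<Phi> with evaluation at
  \<open>x0\<close>, contradicting non-triviality.\<close>

theorem weakly_cauchy_J_subsequence:
  assumes "nontrivial_weakly_cauchy JT jt_norm x"
  shows "\<exists>\<phi>. strict_mono \<phi> \<and> equiv_J_basis jt_norm (x \<circ> \<phi>) \<and>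
    complemented_in JT jt_norm (closed_span JT jt_norm (x \<circ> \<phi>))"
proof -
  obtain \<Phi> where x_JT: "\<And>n. x n \<in> JT"
    and conv: "\<And>f. f \<in> dual_sp JT jt_norm \<Longrightarrow> (\<lambda>n. f (x n)) \<longlonglongrightarrow> \<Phi> f"
    and nt: "\<not> in_canonical_image JT jt_norm \<Phi>"
    using assms unfolding nontrivial_weakly_cauchy_def by blast
  have "\<exists>M. \<forall>n. jt_norm (x n) \<le> M"
  proof (rule JT.weakly_bounded_imp_bounded[OF x_JT])
    fix f assume "f \<in> dual_sp JT jt_norm"
    then have "Bseq (\<lambda>n. f (x n))" using conv convergentI convergent_imp_Bseq by blast
    then show "\<exists>B. \<forall>n. \<bar>f (x n)\<bar> \<le> B" by (auto simp: Bseq_def)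
  qed
  then obtain M where M: "\<And>n. jt_norm (x n) \<le> M" by blast
  define x0 where "x0 t = \<Phi> (\<lambda>y. if y \<in> JT then y t else 0)" for t
  define b where "b \<gamma> = \<Phi> (\<lambda>y. if y \<in> JT then bsum \<gamma> y else 0)" for \<gamma>
  have lim: "(\<lambda>n. x n t) \<longlonglongrightarrow> x0 t" for t
    using conv[OF coord_dual[OF subset_refl lin_subspace_JT, of t]] x_JT by (simp add: x0_def)
  have blim: "(\<lambda>n. bsum \<gamma> (x n)) \<longlonglongrightarrow> b \<gamma>" for \<gamma>
    using conv[OF bsum_dual[of \<gamma>]] x_JT by (simp add: b_def)
  have x0: "x0 \<in> JT" using JT.lim_X[of x x0 M, OF lim] x_JT M by auto
  have "\<exists>\<gamma>. b \<gamma> \<noteq> bsum \<gamma> x0"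
  proof (rule ccontr)
    assume "\<not> ?thesis"
    then have blim': "(\<lambda>n. bsum \<gamma> (x n)) \<longlonglongrightarrow> bsum \<gamma> x0" for \<gamma> using blim[of \<gamma>] by simp
    have cl: "closed_subspace JT jt_norm JT"
      by (simp add: closed_subspace_def lin_subspace_JT norm_closed_in_def)
    show False
    proof (rule averages_subsequence[of x M x0, OF x_JT M lim blim'])
      fix \<phi> :: "nat \<Rightarrow> nat" assume \<phi>: "strict_mono \<phi>"
        and av: "\<And>N e. 0 < e \<Longrightarrow> \<exists>m>0. jt_norm (\<lambda>t. (\<Sum>k=N..<N+m. 1 / real m * x (\<phi> k) t) - x0 t) < e"
      have "f x0 = \<Phi> f" if "f \<in> dual_sp JT jt_norm" for f
        by (rule averages_limit(2)[of JT x x0 \<phi>, OF cl x_JT x0 \<phi> av that conv[OF that]])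
      then show False using nt x0 unfolding in_canonical_image_def by metis
    qed
  qed
  then obtain \<gamma> where ne: "b \<gamma> \<noteq> bsum \<gamma> x0" by blast
  obtain \<phi> R C D where \<phi>: "strict_mono (\<phi> :: nat \<Rightarrow> nat)" and J: "J_system (x \<circ> \<phi>) R C D"
    by (rule J_system_subsequence[of x M x0 b \<gamma>, OF x_JT M lim blim ne])
  interpret J_system "x \<circ> \<phi>" R C D by (rule J)
  show ?thesis using \<phi> y_equiv_J_basis W_complemented closed_span_eq_W by auto
qed

text \<open>\<open>x0\<close> is read off from \<Phi> before any functional is chosen. The
  approximating sequence depends on \<open>f\<close> but converges to \<open>x0\<close> at every
  node, so the identities \<open>f x0 = \<Phi> f\<close> fit together. A nonzero mass would give a
  copy of \<open>J\<close> inside the closed span of the sequence, hence inside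
  \<open>Z\<close>.\<close>

theorem nonreflexive_contains_J:
  assumes Z: "closed_subspace JT jt_norm Z" and nr: "\<not> reflexive_sp Z jt_norm"
  shows "\<exists>W. W \<subseteq> Z \<and> closed_subspace JT jt_norm W \<and> isomorphic_to_J jt_norm W \<and> complemented_in JT jt_norm W"
proof (rule ccontr)
  assume noW: "\<not> ?thesis"
  have sub: "Z \<subseteq> JT" and lin: "lin_subspace Z" and cl: "norm_closed_in JT jt_norm Z"
    using Z by (auto simp: closed_subspace_def)
  obtain \<Phi> where \<Phi>: "\<Phi> \<in> bidual_sp Z jt_norm" and nt: "\<not> in_canonical_image Z jt_norm \<Phi>"
    using nr by (auto simp: reflexive_sp_def)
  obtain M where M: "\<And>(k::nat) f e. (\<And>i. i < k \<Longrightarrow> f i \<in> dual_sp Z jt_norm) \<Longrightarrow> 0 < e \<Longrightarrow>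
    \<exists>z\<in>Z. jt_norm z \<le> M \<and> (\<forall>i<k. \<bar>f i z - \<Phi> (f i)\<bar> < e)"
    by (rule goldstine[OF sub lin \<Phi>]) blast
  define x0 where "x0 t = \<Phi> (\<lambda>y. if y \<in> Z then y t else 0)" for t
  have main: "x0 \<in> Z \<and> f x0 = \<Phi> f" if f: "f \<in> dual_sp Z jt_norm" for f
  proof -
    \<comment> \<open>Index 0 is the given functional, index \<open>j + 1\<close> the coordinate at
      the \<open>j\<close>-th node. Term \<open>n\<close> of the sequence treats the first
      \<open>n\<close> of them with error \<open>1 / (n + 1)\<close>.\<close>
    define F where "F i = (case i of 0 \<Rightarrow> f | Suc j \<Rightarrow> (\<lambda>y. if y \<in> Z then y (from_nat j) else 0))" for i
    have F: "F i \<in> dual_sp Z jt_norm" for i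
      using f coord_dual[OF sub lin] by (auto simp: F_def split: nat.split)
    have "\<forall>n. \<exists>z\<in>Z. jt_norm z \<le> M \<and> (\<forall>i<n. \<bar>F i z - \<Phi> (F i)\<bar> < inverse (real (Suc n)))"
    proof
      fix n
      show "\<exists>z\<in>Z. jt_norm z \<le> M \<and> (\<forall>i<n. \<bar>F i z - \<Phi> (F i)\<bar> < inverse (real (Suc n)))"
        by (rule M[of n F "inverse (real (Suc n))"]) (auto simp: F)
    qed
    then obtain z where z: "\<And>n. z n \<in> Z" "\<And>n. jt_norm (z n) \<le> M"
      and zF: "\<And>n i. i < n \<Longrightarrow> \<bar>F i (z n) - \<Phi> (F i)\<bar> < inverse (real (Suc n))" by metis
    have F_lim: "(\<lambda>n. F i (z n)) \<longlonglongrightarrow> \<Phi> (F i)" for i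
    proof -
      have "(\<lambda>n. F i (z n) - \<Phi> (F i)) \<longlonglongrightarrow> 0"
      proof (rule Lim_null_comparison[OF _ LIMSEQ_inverse_real_of_nat])
        show "\<forall>\<^sub>F n in sequentially. norm (F i (z n) - \<Phi> (F i)) \<le> inverse (real (Suc n))"
          using eventually_gt_at_top[of i] by eventually_elim (use zF in \<open>auto intro: less_imp_le\<close>)
      qed
      then show ?thesis by (simp add: LIM_zero_iff)
    qed
    have lim: "(\<lambda>n. z n t) \<longlonglongrightarrow> x0 t" for t
      using F_lim[of "Suc (to_nat t)"] z(1) unfolding F_def nat.case from_nat_to_nat x0_def by simp
    have z_JT: "z n \<in> JT" for n using z(1) sub by blast
    obtain r where r: "strict_mono r" and bconv: "\<And>\<gamma>. convergent (\<lambda>n. bsum \<gamma> (z (r n)))"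
      by (rule bsum_convergent_subsequence[of z M x0, OF z_JT z(2) lim]) blast
    define y where "y n = z (r n)" for n
    have y: "y n \<in> Z" "y n \<in> JT" "jt_norm (y n) \<le> M" for n by (auto simp: y_def z z_JT)
    have ylim: "(\<lambda>n. y n t) \<longlonglongrightarrow> x0 t" for t
      unfolding y_def using LIMSEQ_subseq_LIMSEQ[OF lim r] by (simp add: o_def)
    define b where "b \<gamma> = lim (\<lambda>n. bsum \<gamma> (y n))" for \<gamma>
    have blim: "(\<lambda>n. bsum \<gamma> (y n)) \<longlonglongrightarrow> b \<gamma>" for \<gamma>
      using bconv[of \<gamma>] unfolding b_def y_def by (simp add: convergent_LIMSEQ_iff)
    have x0: "x0 \<in> JT" using JT.lim_X[of y x0 M, OF ylim] y by auto
    have "b \<gamma> = bsum \<gamma> x0" for \<gamma>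
    proof (rule ccontr)
      assume ne: "b \<gamma> \<noteq> bsum \<gamma> x0"
      obtain \<phi> R C D where J: "J_system (y \<circ> \<phi>) R C D"
        by (rule J_system_subsequence[of y M x0 b \<gamma>, OF y(2,3) ylim blim ne])
      interpret J_system "y \<circ> \<phi>" R C D by (rule J)
      have "W \<subseteq> Z"
      proof
        fix v assume "v \<in> W"
        then have v: "v \<in> JT" "\<And>e. 0 < e \<Longrightarrow> \<exists>m a. jt_norm (\<lambda>t. v t - (\<Sum>k<m. a k * (y \<circ> \<phi>) k t)) < e"
          unfolding closed_span_eq_W[symmetric] closed_span_def by auto
        have "(\<lambda>t. \<Sum>k<m. a k * (y \<circ> \<phi>) k t) \<in> Z" for m a
          by (rule lin_subspace_sum[OF lin]) (auto simp: y)
        then have "\<forall>e>0. \<exists>w\<in>Z. jt_norm (\<lambda>t. v t - w t) < e" using v(2) by meson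
        then show "v \<in> Z" using cl v(1) unfolding norm_closed_in_def by blast
      qed
      then show False using noW W_closed_subspace W_isomorphic W_complemented by blast
    qed
    then have blim': "(\<lambda>n. bsum \<gamma> (y n)) \<longlonglongrightarrow> bsum \<gamma> x0" for \<gamma> using blim[of \<gamma>] by simp
    have f_lim: "(\<lambda>n. f (y n)) \<longlonglongrightarrow> \<Phi> f"
      unfolding y_def using LIMSEQ_subseq_LIMSEQ[OF F_lim[of 0] r] by (simp add: o_def F_def)
    show ?thesis
    proof (rule averages_subsequence[of y M x0, OF y(2,3) ylim blim'])
      fix \<phi> :: "nat \<Rightarrow> nat" assume \<phi>: "strict_mono \<phi>"
        and av: "\<And>N e. 0 < e \<Longrightarrow> \<exists>m>0. jt_norm (\<lambda>t. (\<Sum>k=N..<N+m. 1 / real m * y (\<phi> k) t) - x0 t) < e"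
      show "x0 \<in> Z \<and> f x0 = \<Phi> f"
        using averages_limit[of Z y x0 \<phi>, OF Z y(1) x0 \<phi> av] f f_lim by blast
    qed
  qed
  \<comment> \<open>\<open>main\<close> asserts \<open>x0 \<in> Z\<close> only in the presence of a
    functional; the zero functional provides one.\<close>
  have "(\<lambda>y. 0) \<in> dual_sp Z jt_norm" using dual_sp_sum[of 0 _ Z jt_norm] by simp
  then have "x0 \<in> Z" using main by blast
  then show False using nt main unfolding in_canonical_image_def by metis
qed

theorem mainTheorem17:
  shows "(\<forall>x. nontrivial_weakly_cauchy JT jt_norm x \<longrightarrow>
            (\<exists>\<phi>. strict_mono \<phi> \<and> equiv_J_basis jt_norm (x \<circ> \<phi>) \<and>
                 complemented_in JT jt_norm (closed_span JT jt_norm (x \<circ> \<phi>))))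
       \<and> (\<forall>Z. closed_subspace JT jt_norm Z \<and> \<not> reflexive_sp Z jt_norm \<longrightarrow>
            (\<exists>W. W \<subseteq> Z \<and> closed_subspace JT jt_norm W \<and> isomorphic_to_J jt_norm W
                 \<and> complemented_in JT jt_norm W))"
  using weakly_cauchy_J_subsequence nonreflexive_contains_J by blast

end
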